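(* For $k=28,30$ and $b=0$, the quotient $H/P_{C_{k,0}}$ is isomorphic to $C_2^6$; for $k=29,31$ and $b=0$, it is isomorphic to $C_2^5$. In each of these four cases the projected target $\pi(C_{k,0})\subset H/P_{C_{k,0}}$ omits exactly one class $t$. Thus, for a signed integer $m$ prime to six, the condition $$\Bigl(c(m)+\sum_{q^e\parallel|m|}P_q(\min(e,26))\Bigr)\cap C_{k,0}\ne\varnothing$$ holds if and only if the projected baseline $\pi(c(m))$ differs from $t$, or some prime move (for some prime $q\mid m$) has nonzero projection under $\pi$ and cost at most $v_q(|m|)$.
   Context: $O=\mathbb Z[\omega]$, $\omega^2+\omega+1=0$, $\lambda=1-\omega$, $N(b+c\omega)=b^2-bc+c^2$, $\mu_6=O^\times$. $C_n$ is the cyclic group of order $n$. $W=(W_{hg})$ with $W_{hg}=(-1)^{h\cdot g}$, $h,g\in\mathbb F_2^3$. Finite quotient. $\Gamma=\prod_{h\in\mathbb F_2^3}\bigl((\mathbb Z/24\mathbb Z)^\times\times(O/8\lambda O)^\times\bigr)$, with elements $(a_h,\beta_h)_h$. $L\le\Gamma$ is the subgroup of residues with $a_h\equiv\beta_h\pmod\lambda$ for all $h$, $Wa\in8\mathbb Z^8$, $W\beta\in8O^8$. $E^+\le\Gamma$ consists of the images of $((\epsilon_h,\xi_h))_h$ with $\epsilon_h\in\{1,-1\}$, $\prod_h\epsilon_h=1$, $\xi_h\in\mu_6$. $H=\Gamma/(E^+L)$, written additively, with quotient map $\theta$. $\theta_{h,1}(v)$ (resp. $\theta_{h,3}(v)$)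 is the class of the tuple with $v$ in the rational (resp. $O$-) component at $h$ and every other component one. Classes at two. For $e\in\mathbb Z_{>0}^8$, $R_e$ is the set of classes $\theta((u_h,\gamma_h)_h)$ with $u_h\in\{1,7,13,19\}$, $\gamma_h=17^{e_h\bmod2}$, $W(2^{e_h}u_h)_h\in8\mathbb Z^8$. For $f\in\mathbb Z_{>0}^8$, $Q_f$ is the set of classes with $u_h=1$, $\gamma_h\in(O/8\lambda O)^\times$, $\gamma_h\equiv2^{f_h}\pmod\lambda$, $W(2^{f_h}\gamma_h)_h\in8O^8$. $R_0=Q_0=\{0\}$; for $a,r>0$, $R_a=\bigcup_{\sum e_h=a}R_e$, $Q_r=\bigcup_{\sum f_h=r}Q_f$. Put $$C_{k,0}=\bigcup_{a+2r=k}(R_a+Q_r),\qquad a\in\{0,8\}\cup\mathbb Z_{\ge12},\quad r\in\{0,8\}\cup\mathbb Z_{\ge10}.$$ Stabilizer. For $B\subseteq H$, $P_B=\{g\in H:B+g=B\}$; $\pi:H\to H/P_B$ is the projection, here with $B=C_{k,0}$. Prime moves. $c(m)=\theta_{0,1}(m)$ for signed $m$ prime to $6$. For a prime $q>3$ the moves are $\theta_{h,1}(q)-\theta_{0,1}(q)$ for $h\neq0$, of cost $1$; and $\theta_{h,3}(\pi_{\mathfrak q})-f_{\mathfrak q}\theta_{0,1}(q)$ for each $h\in\mathbb F_2^3$ and each prime ideal $\mathfrak q\mid q$ of $O$ with generator $\pi_{\mathfrak q}$, $N(\pi_{\mathfrak q})=q^{f_{\mathfrak q}}$, of cost $f_{\mathfrak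 q}$. $P_q(e)$ is the set of sums of finite sequences of moves at $q$ (repetition allowed, including the empty sum) of total cost at most $e$. Sums over $q^e\parallel|m|$ are sumsets over the primes dividing $m$, with empty sum $\{0\}$. *)

theory Defs
  imports
    "HOL-Analysis.Finite_Cartesian_Product"
    "HOL-Library.Z2"
    "HOL-Computational_Algebra.Primes"
    "HOL-Algebra.Product_Groups"
    "HOL-Algebra.QuotRing"
    "HOL-Algebra.IntRing"
begin

section \<open>The Eisenstein integers\<close>

text \<open>\<open>Eis b c\<close> stands for \<open>b + c \<omega>\<close>, where \<open>\<omega>\<^sup>2 + \<omega> + 1 = 0\<close>.\<close>

datatype eis = Eis (eis_re: int) (eis_om: int)

instantiation eis :: comm_ring_1
begin

definition "0 = Eis 0 0"

definition "1 = Eis 1 0"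

definition "x + y = Eis (eis_re x + eis_re y) (eis_om x + eis_om y)"

definition "- x = Eis (- eis_re x) (- eis_om x)"

definition "x - y = Eis (eis_re x - eis_re y) (eis_om x - eis_om y)"

definition "x * y =
  Eis (eis_re x * eis_re y - eis_om x * eis_om y)
      (eis_re x * eis_om y + eis_om x * eis_re y - eis_om x * eis_om y)"

instance
  by standard
    (simp_all add: zero_eis_def one_eis_def plus_eis_def uminus_eis_def minus_eis_def
      times_eis_def algebra_simps)

end

definition omega :: eis
  where "omega = Eis 0 1"

lemma omega_relation: "omega ^ 2 + omega + 1 = 0"
  by (simp add: omega_def power2_eq_square zero_eis_def one_eis_def plus_eis_def times_eis_def)

lemma Eis_eq: "Eis b c = of_int b + of_int c * omega"
proof -
  have nat: "of_nat n = Eis (int n) 0" for n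
    by (induction n) (simp_all add: zero_eis_def one_eis_def plus_eis_def)
  have "of_int k = Eis k 0" for k
    by (cases k rule: int_cases2) (simp_all add: nat uminus_eis_def)
  then show ?thesis
    by (simp add: omega_def plus_eis_def times_eis_def)
qed

definition lam :: eis
  where "lam = 1 - omega"

definition eis_norm :: "eis \<Rightarrow> int"
  where "eis_norm x = (eis_re x)\<^sup>2 - eis_re x * eis_om x + (eis_om x)\<^sup>2"

definition eis_ring :: "eis ring"
  where "eis_ring = \<lparr>carrier = UNIV, monoid.mult = (*), one = 1, zero = 0, add = (+)\<rparr>"


section \<open>The Walsh matrix\<close>

type_synonym idx = "bit ^ 3"

definition walsh_sign :: "idx \<Rightarrow> idx \<Rightarrow> 'a :: comm_ring_1"
  where "walsh_sign h g = (if (\<Sum>i\<in>UNIV. h $ i * g $ i) = 0 then 1 else - 1)"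

definition walsh :: "(idx \<Rightarrow> 'a :: comm_ring_1) \<Rightarrow> idx \<Rightarrow> 'a"
  where "walsh x h = (\<Sum>g\<in>UNIV. walsh_sign h g * x g)"


section \<open>The finite quotient\<close>

abbreviation modulus_ideal :: "eis set"
  where "modulus_ideal \<equiv> PIdl\<^bsub>eis_ring\<^esub> (8 * lam)"

definition Gamma_grp :: "(idx \<Rightarrow> int set \<times> eis set) monoid"
  where "Gamma_grp = product_group UNIV
    (\<lambda>_. units_of (ZFact 24) \<times>\<times> units_of (eis_ring Quot modulus_ideal))"

text \<open>
  Elements of \<open>Gamma_grp\<close> are described by tuples of representatives. All the congruence conditions
  imposed on representatives below depend only on the residues modulo \<open>24\<close> and \<open>8 \<lambda>\<close>.
\<close>

definition residues_of :: "(idx \<Rightarrow> int \<times> eis) \<Rightarrow> idx \<Rightarrow> int set \<times> eis set"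
  where "residues_of x = (\<lambda>h. (ZMod 24 (fst (x h)), modulus_ideal +>\<^bsub>eis_ring\<^esub> snd (x h)))"

definition L_sub :: "(idx \<Rightarrow> int set \<times> eis set) set"
  where "L_sub = {residues_of (\<lambda>h. (a h, \<beta> h)) | a \<beta>.
    residues_of (\<lambda>h. (a h, \<beta> h)) \<in> carrier Gamma_grp \<and>
    (\<forall>h. lam dvd of_int (a h) - \<beta> h) \<and>
    (\<forall>h. 8 dvd walsh a h) \<and>
    (\<forall>h. 8 dvd walsh \<beta> h)}"

definition Eplus :: "(idx \<Rightarrow> int set \<times> eis set) set"
  where "Eplus = {residues_of (\<lambda>h. (\<epsilon> h, \<xi> h)) | \<epsilon> \<xi>.
    (\<forall>h. \<epsilon> h \<in> {1, - 1}) \<and> (\<Prod>h\<in>UNIV. \<epsilon> h) = 1 \<and> (\<forall>h. \<xi> h dvd 1)}"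

text \<open>The group \<open>H_grp\<close> is written multiplicatively, as usual in \<open>HOL-Algebra\<close>: sums become
  \<open>\<otimes>\<close>, sumsets become \<open><#>\<close>, and \<open>0\<close> becomes \<open>\<one>\<close>.\<close>

definition H_grp :: "(idx \<Rightarrow> int set \<times> eis set) set monoid"
  where "H_grp = Gamma_grp Mod (Eplus <#>\<^bsub>Gamma_grp\<^esub> L_sub)"

definition theta :: "(idx \<Rightarrow> int \<times> eis) \<Rightarrow> (idx \<Rightarrow> int set \<times> eis set) set"
  where "theta x = (Eplus <#>\<^bsub>Gamma_grp\<^esub> L_sub) #>\<^bsub>Gamma_grp\<^esub> residues_of x"

definition theta1 :: "idx \<Rightarrow> int \<Rightarrow> (idx \<Rightarrow> int set \<times> eis set) set"
  where "theta1 h v = theta ((\<lambda>_. (1, 1))(h := (v, 1)))"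

definition theta3 :: "idx \<Rightarrow> eis \<Rightarrow> (idx \<Rightarrow> int set \<times> eis set) set"
  where "theta3 h v = theta ((\<lambda>_. (1, 1))(h := (1, v)))"


section \<open>Classes at two\<close>

definition R_vec :: "(idx \<Rightarrow> nat) \<Rightarrow> (idx \<Rightarrow> int set \<times> eis set) set set"
  where "R_vec e = {theta (\<lambda>h. (u h, 17 ^ (e h mod 2))) | u.
    (\<forall>h. u h \<in> {1, 7, 13, 19}) \<and> (\<forall>h. 8 dvd walsh (\<lambda>g. 2 ^ e g * u g) h)}"

definition Q_vec :: "(idx \<Rightarrow> nat) \<Rightarrow> (idx \<Rightarrow> int set \<times> eis set) set set"
  where "Q_vec f = {theta (\<lambda>h. (1, \<gamma> h)) | \<gamma>.
    residues_of (\<lambda>h. (1, \<gamma> h)) \<in> carrier Gamma_grp \<and>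
    (\<forall>h. lam dvd \<gamma> h - 2 ^ f h) \<and> (\<forall>h. 8 dvd walsh (\<lambda>g. 2 ^ f g * \<gamma> g) h)}"

definition R_set :: "nat \<Rightarrow> (idx \<Rightarrow> int set \<times> eis set) set set"
  where "R_set a = (if a = 0 then {\<one>\<^bsub>H_grp\<^esub>}
    else \<Union>e\<in>{e. (\<forall>h. e h > 0) \<and> (\<Sum>h\<in>UNIV. e h) = a}. R_vec e)"

definition Q_set :: "nat \<Rightarrow> (idx \<Rightarrow> int set \<times> eis set) set set"
  where "Q_set r = (if r = 0 then {\<one>\<^bsub>H_grp\<^esub>}
    else \<Union>f\<in>{f. (\<forall>h. f h > 0) \<and> (\<Sum>h\<in>UNIV. f h) = r}. Q_vec f)"

text \<open>\<open>C0 k\<close> is the set \<open>C\<^bsub>k,0\<^esub>\<close>.\<close>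

definition C0 :: "nat \<Rightarrow> (idx \<Rightarrow> int set \<times> eis set) set set"
  where "C0 k = (\<Union>(a, r)\<in>{(a, r). a + 2 * r = k \<and> a \<in> {0, 8} \<union> {12..} \<and> r \<in> {0, 8} \<union> {10..}}.
    R_set a <#>\<^bsub>H_grp\<^esub> Q_set r)"


section \<open>Stabilizers\<close>

definition stab :: "('a, 'b) monoid_scheme \<Rightarrow> 'a set \<Rightarrow> 'a set"
  where "stab G B = {g \<in> carrier G. B #>\<^bsub>G\<^esub> g = B}"

definition quot :: "('a, 'b) monoid_scheme \<Rightarrow> 'a set \<Rightarrow> 'a set monoid"
  where "quot G B = G Mod stab G B"

definition proj :: "('a, 'b) monoid_scheme \<Rightarrow> 'a set \<Rightarrow> 'a \<Rightarrow> 'a set"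
  where "proj G B x = stab G B #>\<^bsub>G\<^esub> x"

definition C2_power :: "nat \<Rightarrow> (nat \<Rightarrow> int) monoid"
  where "C2_power n = product_group {..<n} (\<lambda>_. integer_mod_group 2)"


section \<open>Prime moves\<close>

definition c_class :: "int \<Rightarrow> (idx \<Rightarrow> int set \<times> eis set) set"
  where "c_class m = theta1 0 m"

text \<open>
  A move is recorded together with its cost. In the second family \<open>p\<close> runs through all generators
  of the prime ideals of \<open>O\<close> dividing \<open>q\<close>; associated generators give the same move, since
  \<open>Eplus\<close> contains all tuples of units of \<open>O\<close>.
\<close>

definition moves :: "nat \<Rightarrow> ((idx \<Rightarrow> int set \<times> eis set) set \<times> nat) set"
  where "moves q =
    {(theta1 h (int q) \<otimes>\<^bsub>H_grp\<^esub> inv\<^bsub>H_grp\<^esub> theta1 0 (int q), 1) | h. h \<noteq> 0} \<union>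
    {(theta3 h p \<otimes>\<^bsub>H_grp\<^esub> inv\<^bsub>H_grp\<^esub> (theta1 0 (int q) [^]\<^bsub>H_grp\<^esub> f), f) | h p f.
      primeideal (PIdl\<^bsub>eis_ring\<^esub> p) eis_ring \<and> of_nat q \<in> PIdl\<^bsub>eis_ring\<^esub> p \<and>
      eis_norm p = int q ^ f}"

definition P_moves :: "nat \<Rightarrow> nat \<Rightarrow> (idx \<Rightarrow> int set \<times> eis set) set set"
  where "P_moves q e = {foldr (\<otimes>\<^bsub>H_grp\<^esub>) (map fst xs) \<one>\<^bsub>H_grp\<^esub> | xs.
    set xs \<subseteq> moves q \<and> sum_list (map snd xs) \<le> e}"

definition sumset :: "('a, 'b) monoid_scheme \<Rightarrow> ('i \<Rightarrow> 'a set) \<Rightarrow> 'i set \<Rightarrow> 'a set"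
  where "sumset G S I = {finprod G s I | s. \<forall>i\<in>I. s i \<in> S i}"

definition move_sums :: "int \<Rightarrow> (idx \<Rightarrow> int set \<times> eis set) set set"
  where "move_sums m = sumset H_grp
    (\<lambda>q. P_moves q (min (multiplicity q (nat \<bar>m\<bar>)) 26)) (prime_factors (nat \<bar>m\<bar>))"

end

theory Submission
  imports Defs "HOL-Analysis.Cartesian_Space"
begin

text \<open>
  Modulo 4 every \<open>\<beta>\<close> prime to \<open>2\<close> is \<open>\<plusminus>\<omega>\<^sup>j (1 + 2\<omega>)\<^sup>b\<close>, and \<open>\<beta>\<^sup>3\<close> reads off the sign and \<open>b\<close>. This
  gives characters of the finite quotient with values in the field with two elements: \<open>S\<close>, the
  product of the signs of the \<open>a\<^sub>h\<close> modulo 4; \<open>A\<close>, the product of the signs of the \<open>\<beta>\<^sub>h\<close> modulo 4,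
  normalised by the signs of \<open>a\<^sub>h\<close> and \<open>\<beta>\<^sub>h\<close> modulo \<open>\<lambda>\<close>; and \<open>B\<^sub>\<ell>\<close>, the sum of the \<open>b\<^sub>h\<close> weighted by an
  affine function \<open>\<ell>\<close>. They vanish on the lattice classes because an element of the Walsh lattice has
  sums over affine planes divisible by 4, and the lattice is closed under products, hence cubes.

  For even \<open>k\<close> the set \<open>C\<^bsub>k,0\<^esub>\<close> is the complement of \<open>B = 0, A = S = 1\<close>, and for odd \<open>k\<close> the
  complement of \<open>B = 0, A = 0\<close>; the stabilizer is then the common kernel of the characters. The omitted class is
  missed because \<open>R\<^sub>8\<close> has \<open>S = 0\<close>, \<open>R\<^sub>a\<close> has \<open>B = 0\<close> and \<open>A = a\<close>, and in \<open>Q\<^sub>8\<close> the condition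
  \<open>B = 0\<close> forces \<open>A = 0\<close>. Everything else lies in \<open>R\<^sub>a + Q\<^sub>8\<close> with \<open>a = k - 16\<close> or, for even
  \<open>k\<close>, in \<open>R\<^sub>8 + Q\<^sub>r\<close> with \<open>r = (k - 8) / 2\<close>, by explicit choices of exponents, signs and powers of \<open>\<omega>\<close>.
\<close>

subsection \<open>Eisenstein residues\<close>

lemma eis_re_simps [simp]:
  "eis_re 0 = 0" "eis_re 1 = 1" "eis_re (x + y) = eis_re x + eis_re y"
  "eis_re (- x) = - eis_re x" "eis_re (x - y) = eis_re x - eis_re y"
  "eis_re (x * y) = eis_re x * eis_re y - eis_om x * eis_om y"
  by (simp_all add: zero_eis_def one_eis_def plus_eis_def uminus_eis_def minus_eis_def times_eis_def)

lemma eis_om_simps [simp]: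
  "eis_om 0 = 0" "eis_om 1 = 0" "eis_om (x + y) = eis_om x + eis_om y"
  "eis_om (- x) = - eis_om x" "eis_om (x - y) = eis_om x - eis_om y"
  "eis_om (x * y) = eis_re x * eis_om y + eis_om x * eis_re y - eis_om x * eis_om y"
  by (simp_all add: zero_eis_def one_eis_def plus_eis_def uminus_eis_def minus_eis_def times_eis_def)

lemma eis_of_int [simp]: "eis_re (of_int n) = n" "eis_om (of_int n) = 0"
proof -
  have "of_int n = Eis n 0"
    by (simp add: Eis_eq)
  then show "eis_re (of_int n) = n" "eis_om (of_int n) = 0"
    by simp_all
qed

lemma eis_numeral [simp]: "eis_re (numeral n) = numeral n" "eis_om (numeral n) = 0"
  using eis_of_int[of "numeral n"] by simp_all

lemma eis_lam [simp]: "eis_re lam = 1" "eis_om lam = - 1"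
  by (simp_all add: lam_def omega_def)

lemma eis_omega [simp]: "eis_re omega = 0" "eis_om omega = 1"
  by (simp_all add: omega_def)

lemma eis_eq_iff: "x = y \<longleftrightarrow> eis_re x = eis_re y \<and> eis_om x = eis_om y"
  by (cases x; cases y) simp

lemma eis_sum: "eis_re (sum f A) = (\<Sum>a\<in>A. eis_re (f a))" "eis_om (sum f A) = (\<Sum>a\<in>A. eis_om (f a))"
  by (induction A rule: infinite_finite_induct) simp_all

lemma of_int_dvd_eis_iff: "of_int n dvd x \<longleftrightarrow> n dvd eis_re x \<and> n dvd eis_om x"
proof
  assume "n dvd eis_re x \<and> n dvd eis_om x"
  then obtain r s where "eis_re x = n * r" "eis_om x = n * s"
    by (auto elim!: dvdE)
  then have "x = of_int n * Eis r s"
    by (simp add: eis_eq_iff)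
  then show "of_int n dvd x" ..
qed (auto elim!: dvdE)

lemma numeral_dvd_eis_iff:
  "numeral n dvd (x :: eis) \<longleftrightarrow> numeral n dvd eis_re x \<and> numeral n dvd eis_om x"
  using of_int_dvd_eis_iff[of "numeral n" x] by simp

lemma lam_dvd_iff: "lam dvd x \<longleftrightarrow> 3 dvd eis_re x + eis_om x"
proof
  assume "3 dvd eis_re x + eis_om x"
  then obtain s where "eis_re x + eis_om x = 3 * s" ..
  then have "x = lam * Eis (eis_re x - s) s"
    by (simp add: eis_eq_iff)
  then show "lam dvd x" ..
qed (auto elim!: dvdE)

text \<open>Since 3 does not divide 8, the moduli 8 and \<open>lam\<close> are coprime, so
  congruences modulo \<open>8 * lam\<close> split.\<close>

lemma eight_lam_dvd_iff: "8 * lam dvd x \<longleftrightarrow> 8 dvd x \<and> lam dvd x"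
proof
  assume "8 dvd x \<and> lam dvd x"
  then obtain y where y: "x = 8 * y" and "3 dvd eis_re x + eis_om x"
    by (auto simp: lam_dvd_iff)
  then have "lam dvd y"
    unfolding lam_dvd_iff by simp presburger
  then show "8 * lam dvd x"
    unfolding y by (rule mult_dvd_mono[OF dvd_refl])
qed (auto dest: dvd_mult_left dvd_mult_right)

text \<open>This means being prime to 6: 2 is inert in O, and \<open>lam\<close> generates the only
  prime over 3.\<close>

definition eis_cop :: "eis \<Rightarrow> bool"
  where "eis_cop x \<longleftrightarrow> \<not> 2 dvd x \<and> \<not> lam dvd x"

lemma eis_cop_iff: "eis_cop x \<longleftrightarrow> (odd (eis_re x) \<or> odd (eis_om x)) \<and> \<not> 3 dvd eis_re x + eis_om x"
  by (simp add: eis_cop_def numeral_dvd_eis_iff lam_dvd_iff)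

lemma eis_norm_mult: "eis_norm (x * y) = eis_norm x * eis_norm y"
  by (simp add: eis_norm_def power2_eq_square algebra_simps)

lemma coprime_6_iff: "coprime a 6 \<longleftrightarrow> odd a \<and> \<not> 3 dvd a" for a :: int
proof -
  have "coprime a (2 * 3) \<longleftrightarrow> coprime a 2 \<and> coprime a 3"
    by (simp only: coprime_mult_right_iff)
  moreover have "coprime a 3 \<longleftrightarrow> \<not> 3 dvd a"
    using prime_imp_coprime[of 3 a] by (auto simp: coprime_commute dest: coprime_common_divisor[of 3 a 3])
  ultimately show ?thesis
    by simp
qed

text \<open>Modulo 3 the norm is the square of the coordinate sum. Passing to the norm makes
  multiplicativity of \<open>eis_cop\<close> immediate.\<close>

lemma eis_cop_iff_norm: "eis_cop x \<longleftrightarrow> coprime (eis_norm x) 6"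
proof -
  have "even (eis_norm x) \<longleftrightarrow> even (eis_re x) \<and> even (eis_om x)"
    by (auto simp: eis_norm_def)
  moreover have "3 dvd eis_norm x \<longleftrightarrow> 3 dvd eis_re x + eis_om x"
  proof -
    have "eis_norm x = (eis_re x + eis_om x)\<^sup>2 - 3 * (eis_re x * eis_om x)"
      by (simp add: eis_norm_def power2_eq_square algebra_simps)
    then have "3 dvd eis_norm x \<longleftrightarrow> 3 dvd (eis_re x + eis_om x)\<^sup>2"
      by (simp add: dvd_diff_left_iff)
    then show ?thesis
      by (simp add: prime_dvd_power_iff)
  qed
  ultimately show ?thesis
    by (auto simp: eis_cop_iff coprime_6_iff)
qed

lemma coprime_6_square: "24 dvd a * a - 1" if "coprime a 6" for a :: int
proof -
  have "a mod 24 \<in> {1, 5, 7, 11, 13, 17, 19, 23}"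
    using that unfolding coprime_6_iff by simp presburger
  then have "(a mod 24) * (a mod 24) mod 24 = 1"
    by auto
  then show ?thesis
    using mod_eq_dvd_iff[of "a * a" 24 1] by (simp add: mod_mult_eq)
qed

text \<open>The quotient of O by \<open>lam\<close> is the field with three elements.\<close>

lemma lam_dvd_pow2: "lam dvd x ^ 2 - 1" if "\<not> lam dvd x"
proof -
  have "3 dvd eis_re x + eis_om x - 1 \<or> 3 dvd eis_re x + eis_om x + 1"
    using that unfolding lam_dvd_iff by presburger
  then have "lam dvd x - 1 \<or> lam dvd x + 1"
    by (simp add: lam_dvd_iff algebra_simps)
  moreover have "x ^ 2 - 1 = (x - 1) * (x + 1)"
    by (simp add: power2_eq_square algebra_simps)
  ultimately show ?thesis
    by auto
qed

text \<open>The quotient of O by 2 is the field with four elements, whose unit group has order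
  3.\<close>

lemma two_dvd_cube: "2 dvd x ^ 3 - 1" if "\<not> 2 dvd x" for x :: eis
  using that by (auto simp: numeral_dvd_eis_iff power3_eq_cube)

text \<open>Write the cube as \<open>1 + 2 * y\<close>; its fourth power is 1 modulo 8 by the
  binomial expansion. Modulo \<open>lam\<close> already the square is 1. This supplies
  \<open>x ^ 11\<close> as an explicit inverse.\<close>

lemma eis_cop_pow12: "8 * lam dvd x ^ 12 - 1" if "eis_cop x"
proof -
  obtain y where y: "x ^ 3 - 1 = 2 * y"
    using two_dvd_cube \<open>eis_cop x\<close> by (auto simp: eis_cop_def)
  then have "x ^ 3 = 1 + 2 * y"
    by (simp add: algebra_simps)
  then have "(x ^ 3) ^ 4 - 1 = 8 * (y + 3 * y ^ 2 + 4 * y ^ 3 + 2 * y ^ 4)"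
    by (simp add: power4_eq_xxxx power3_eq_cube power2_eq_square algebra_simps)
  then have "8 dvd (x ^ 3) ^ 4 - 1"
    by (rule dvdI)
  then have "8 dvd x ^ 12 - 1"
    by (simp flip: power_mult)
  moreover have "lam dvd x ^ 12 - 1"
  proof -
    have "x ^ 12 - 1 = (x ^ 2) ^ 6 - 1 ^ 6"
      by (simp flip: power_mult)
    also have "x ^ 2 - 1 dvd \<dots>"
      unfolding power_diff_sumr2 by simp
    finally show ?thesis
      using lam_dvd_pow2 \<open>eis_cop x\<close> unfolding eis_cop_def by (blast intro: dvd_trans)
  qed
  ultimately show ?thesis
    by (simp add: eight_lam_dvd_iff)
qed

lemma eis_cop_mult_iff: "eis_cop (x * y) \<longleftrightarrow> eis_cop x \<and> eis_cop y"
  by (simp only: eis_cop_iff_norm eis_norm_mult coprime_mult_left_iff)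

lemma eis_cop_cong: "eis_cop x \<longleftrightarrow> eis_cop y" if "8 * lam dvd x - y"
proof -
  have "8 dvd x - y" "lam dvd x - y"
    using that by (auto simp: eight_lam_dvd_iff)
  then have "2 dvd x - y" "lam dvd x - y"
    using dvd_trans[of 2 8 "x - y"] by (auto simp: numeral_dvd_eis_iff)
  then show ?thesis
    unfolding eis_cop_def by (metis diff_add_cancel dvd_add_right_iff)
qed

lemma eis_cop_iff_unit: "eis_cop x \<longleftrightarrow> (\<exists>y. 8 * lam dvd x * y - 1)"
proof
  assume "eis_cop x"
  then have "8 * lam dvd x * x ^ 11 - 1"
    using eis_cop_pow12 by (simp flip: power_Suc)
  then show "\<exists>y. 8 * lam dvd x * y - 1" ..
next
  assume "\<exists>y. 8 * lam dvd x * y - 1"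
  then obtain y where "8 * lam dvd x * y - 1" ..
  then have "eis_cop (x * y) \<longleftrightarrow> eis_cop 1"
    by (rule eis_cop_cong)
  moreover have "eis_cop 1"
    by (simp add: eis_cop_iff)
  ultimately show "eis_cop x"
    unfolding eis_cop_mult_iff by blast
qed

lemma coprime_6_iff_unit: "coprime a 6 \<longleftrightarrow> (\<exists>b. 24 dvd a * b - 1)" for a :: int
proof
  assume "\<exists>b. 24 dvd a * b - 1"
  then obtain b k where "a * b - 1 = 24 * k"
    by (auto elim!: dvdE)
  then have ab: "a * b = 24 * k + 1"
    by simp
  have "odd (24 * k + 1)" "\<not> 3 dvd 24 * k + 1"
    by (simp, presburger)
  then show "coprime a 6"
    unfolding ab[symmetric] by (auto simp: coprime_6_iff)
qed (use coprime_6_square in blast)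

subsection \<open>Walsh transforms\<close>

text \<open>Explicit coordinates on the index space, so that statements about all points become
  finite Boolean checks.\<close>

definition pt :: "bit \<Rightarrow> bit \<Rightarrow> bit \<Rightarrow> idx"
  where "pt x y z = vector [x, y, z]"

lemma pt_nth [simp]: "pt x y z $ 1 = x" "pt x y z $ 2 = y" "pt x y z $ 3 = z"
  by (simp_all add: pt_def)

lemma pt_eq_iff [simp]: "pt x y z = pt x' y' z' \<longleftrightarrow> x = x' \<and> y = y' \<and> z = z'"
  by (auto simp: vec_eq_iff forall_3)

lemma pt_0: "0 = pt 0 0 0"
  by (simp add: vec_eq_iff forall_3)

lemma pt_surj: "\<exists>x y z. h = pt x y z"
  by (intro exI[of _ "h $ 1"] exI[of _ "h $ 2"] exI[of _ "h $ 3"]) (simp add: vec_eq_iff forall_3)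

lemma all_bit: "(\<forall>x :: bit. P x) \<longleftrightarrow> P 0 \<and> P 1"
  by (metis bit_not_zero_iff)

lemma ex_bit: "(\<exists>x :: bit. P x) \<longleftrightarrow> P 0 \<or> P 1"
  by (metis bit_not_zero_iff)

lemma all_idx: "(\<forall>h. P h) \<longleftrightarrow> (\<forall>x y z. P (pt x y z))"
  by (metis pt_surj)

lemma ex_idx: "(\<exists>h. P h) \<longleftrightarrow> (\<exists>x y z. P (pt x y z))"
  by (metis pt_surj)

lemma UNIV_idx: "(UNIV :: idx set) = {pt 0 0 0, pt 0 0 1, pt 0 1 0, pt 0 1 1,
    pt 1 0 0, pt 1 0 1, pt 1 1 0, pt 1 1 1}"
proof -
  have "\<forall>h :: idx. h \<in> {pt 0 0 0, pt 0 0 1, pt 0 1 0, pt 0 1 1, pt 1 0 0, pt 1 0 1, pt 1 1 0, pt 1 1 1}"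
    by (simp add: all_idx all_bit)
  then show ?thesis
    by blast
qed

lemma sum_idx: "(\<Sum>h\<in>UNIV. f h) = f (pt 0 0 0) + f (pt 0 0 1) + f (pt 0 1 0) + f (pt 0 1 1) +
    f (pt 1 0 0) + f (pt 1 0 1) + f (pt 1 1 0) + f (pt 1 1 1)"
  for f :: "idx \<Rightarrow> 'a :: comm_monoid_add"
  unfolding UNIV_idx by (simp add: add.assoc)

lemma finite_idx [simp]: "finite (A :: idx set)"
  by (rule finite_subset[OF subset_UNIV]) (simp add: UNIV_idx)

lemma add_self_idx [simp]: "h + h = 0" for h :: idx
  by (simp add: vec_eq_iff)

definition dot :: "idx \<Rightarrow> idx \<Rightarrow> bit"
  where "dot v h = v $ 1 * h $ 1 + v $ 2 * h $ 2 + v $ 3 * h $ 3"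

lemma walsh_sign_dot: "walsh_sign h g = (if dot h g = 0 then 1 else - 1)"
  by (simp add: walsh_sign_def dot_def sum_3)

lemma dot_commute: "dot h g = dot g h"
  by (simp only: dot_def mult.commute)

lemma dot_add: "dot h (g + g') = dot h g + dot h g'" "dot (h + h') g = dot h g + dot h' g"
  by (simp_all only: dot_def vector_add_component distrib_left distrib_right ac_simps)

lemma dot_0 [simp]: "dot 0 h = 0" "dot h 0 = 0"
  by (simp_all add: dot_def)

lemma dot_pt [simp]: "dot (pt x y z) (pt x' y' z') = x * x' + y * y' + z * z'"
  by (simp add: dot_def)

lemma walsh_sign_add:
  "walsh_sign h (g + g') = walsh_sign h g * walsh_sign h g'"
  "walsh_sign (g + g') h = walsh_sign g h * walsh_sign g' h"
  by (simp_all add: walsh_sign_dot dot_add)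

lemma sum_walsh_sign: "(\<Sum>k\<in>UNIV. walsh_sign k g) = (if g = 0 then 8 else 0)"
proof -
  have "\<forall>g. (\<Sum>k\<in>UNIV. walsh_sign k g) = (if g = 0 then 8 else 0)"
    by (simp add: all_idx all_bit sum_idx walsh_sign_dot pt_0)
  then show ?thesis ..
qed

text \<open>The convolution theorem for the group of order 8: after expansion, orthogonality of
  characters keeps only the terms with \<open>g' = g\<close>.\<close>

lemma walsh_convolution:
  fixes a b :: "idx \<Rightarrow> 'a :: comm_ring_1"
  shows "(\<Sum>k\<in>UNIV. walsh a k * walsh b (h + k)) = 8 * walsh (\<lambda>g. a g * b g) h"
proof -
  have "(\<Sum>k\<in>UNIV. walsh a k * walsh b (h + k)) =
      (\<Sum>k\<in>UNIV. \<Sum>g\<in>UNIV. \<Sum>g'\<in>UNIV. a g * b g' * walsh_sign h g' * walsh_sign k (g + g'))"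
    by (simp add: walsh_def sum_product walsh_sign_add algebra_simps)
  also have "\<dots> = (\<Sum>g\<in>UNIV. \<Sum>g'\<in>UNIV. a g * b g' * walsh_sign h g' * (\<Sum>k\<in>UNIV. walsh_sign k (g + g')))"
    unfolding sum_distrib_left
    by (subst sum.swap, rule sum.cong[OF refl], rule sum.swap)
  also have "\<dots> = (\<Sum>g\<in>UNIV. \<Sum>g'\<in>UNIV. if g' = g then 8 * (walsh_sign h g * (a g * b g)) else 0)"
  proof (intro sum.cong refl)
    fix g g' :: idx
    have "g + g' = 0 \<longleftrightarrow> g' = g"
      by (metis add_self_idx add_left_cancel)
    then show "a g * b g' * walsh_sign h g' * (\<Sum>k\<in>UNIV. walsh_sign k (g + g')) =
        (if g' = g then 8 * (walsh_sign h g * (a g * b g)) else 0)"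
      by (simp add: sum_walsh_sign mult_ac)
  qed
  also have "\<dots> = 8 * walsh (\<lambda>g. a g * b g) h"
    by (simp add: walsh_def sum_distrib_left)
  finally show ?thesis .
qed

lemma walsh_add: "walsh (\<lambda>g. a g + b g) h = walsh a h + walsh b h"
  by (simp add: walsh_def sum.distrib algebra_simps)

lemma walsh_diff: "walsh (\<lambda>g. a g - b g) h = walsh a h - walsh b h"
  by (simp add: walsh_def sum_subtractf algebra_simps)

lemma walsh_mult_left: "walsh (\<lambda>g. c * a g) h = c * walsh a h"
  by (simp add: walsh_def sum_distrib_left algebra_simps)

lemma dvd_walsh: "(\<And>g. d dvd a g) \<Longrightarrow> d dvd walsh a h"
  unfolding walsh_def by (intro dvd_sum) simp

lemma dvd_walsh_cong: "(\<And>g. d dvd a g - b g) \<Longrightarrow> d dvd walsh a h \<longleftrightarrow> d dvd walsh b h"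
  using dvd_walsh[of d "\<lambda>g. a g - b g" h] unfolding walsh_diff
  by (metis diff_add_cancel dvd_add_right_iff)

lemma walsh_one: "8 dvd walsh (\<lambda>_. 1 :: 'a :: comm_ring_1) h"
proof -
  have "walsh (\<lambda>_. 1 :: 'a) h = (\<Sum>k\<in>UNIV. walsh_sign k h)"
    by (simp add: walsh_def walsh_sign_dot dot_commute)
  then show ?thesis
    by (simp add: sum_walsh_sign)
qed

lemma walsh_eis: "eis_re (walsh x h) = walsh (\<lambda>g. eis_re (x g)) h"
    "eis_om (walsh x h) = walsh (\<lambda>g. eis_om (x g)) h"
  unfolding walsh_def eis_sum by (auto intro!: sum.cong simp: walsh_sign_dot)

lemma dvd_walsh_eis: "numeral n dvd walsh x h \<longleftrightarrow>
    numeral n dvd walsh (\<lambda>g. eis_re (x g)) h \<and> numeral n dvd walsh (\<lambda>g. eis_om (x g)) h"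
  by (simp add: numeral_dvd_eis_iff walsh_eis)

text \<open>By the convolution theorem, 8 times the transform of the product is a sum of terms
  divisible by 64. Hence the Walsh lattice is a ring.\<close>

lemma walsh_mult_int:
  fixes a b :: "idx \<Rightarrow> int"
  assumes "\<And>h. 8 dvd walsh a h" "\<And>h. 8 dvd walsh b h"
  shows "8 dvd walsh (\<lambda>g. a g * b g) h"
proof -
  have "8 * 8 dvd (\<Sum>k\<in>UNIV. walsh a k * walsh b (h + k))"
    using assms by (intro dvd_sum mult_dvd_mono)
  then show ?thesis
    unfolding walsh_convolution by (simp only: dvd_mult_cancel_left) simp
qed

lemma walsh_mult_eis:
  fixes a b :: "idx \<Rightarrow> eis"
  assumes "\<And>h. 8 dvd walsh a h" "\<And>h. 8 dvd walsh b h"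
  shows "8 dvd walsh (\<lambda>g. a g * b g) h"
proof -
  have "8 dvd walsh (\<lambda>g. eis_re (a g)) h" "8 dvd walsh (\<lambda>g. eis_om (a g)) h"
    "8 dvd walsh (\<lambda>g. eis_re (b g)) h" "8 dvd walsh (\<lambda>g. eis_om (b g)) h" for h
    using assms by (auto simp: dvd_walsh_eis)
  then show ?thesis
    unfolding dvd_walsh_eis by (simp add: walsh_diff walsh_add walsh_mult_int)
qed

lemma walsh_0: "walsh a 0 = (\<Sum>h\<in>UNIV. a h)"
  by (simp add: walsh_def walsh_sign_dot)

text \<open>Twice the indicator of \<open>dot v g = c\<close> is 1 plus or minus the Walsh sign of
  \<open>v\<close>; for \<open>v = 0\<close> the set is everything or empty.\<close>

lemma sum_plane: "2 * (\<Sum>g | dot v g = c. a g) = walsh a 0 + (if c = 0 then walsh a v else - walsh a v)"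
  for a :: "idx \<Rightarrow> int"
proof -
  have "2 * (\<Sum>g | dot v g = c. a g) = (\<Sum>g\<in>UNIV. if dot v g = c then 2 * a g else 0)"
    by (simp add: sum.inter_filter[symmetric] sum_distrib_left)
  also have "\<dots> = (\<Sum>g\<in>UNIV. a g + (if c = 0 then 1 else - 1) * (walsh_sign v g * a g))"
    by (intro sum.cong refl) (cases c; simp add: walsh_sign_dot)
  also have "\<dots> = walsh a 0 + (if c = 0 then 1 else - 1) * walsh a v"
    unfolding walsh_0 by (simp add: sum.distrib walsh_def sum_distrib_left)
  finally show ?thesis
    by simp
qed

subsection \<open>Representatives\<close>

lemma eis_cring: "cring eis_ring"
proof (rule cringI)
  show "abelian_group eis_ring"
    by (rule abelian_groupI) (auto simp: eis_ring_def algebra_simps intro: exI[of _ "- x" for x])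
  show "comm_monoid eis_ring"
    by (rule comm_monoidI) (auto simp: eis_ring_def algebra_simps)
qed (simp add: eis_ring_def algebra_simps)

lemma PIdl_eis: "PIdl\<^bsub>eis_ring\<^esub> x = {y. x dvd y}"
  by (auto simp: cgenideal_def eis_ring_def dvd_def mult.commute)

lemma ideal_PIdl_eis: "ideal (PIdl\<^bsub>eis_ring\<^esub> x) eis_ring"
  by (rule cring.cgenideal_ideal[OF eis_cring]) (simp add: eis_ring_def)

lemma eis_coset_eq_iff:
  "PIdl\<^bsub>eis_ring\<^esub> x +>\<^bsub>eis_ring\<^esub> a = PIdl\<^bsub>eis_ring\<^esub> x +>\<^bsub>eis_ring\<^esub> b \<longleftrightarrow> x dvd a - b"
proof -
  have *: "PIdl\<^bsub>eis_ring\<^esub> x +>\<^bsub>eis_ring\<^esub> a = {y. x dvd y - a}" for a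
  proof -
    have "(\<exists>h. x dvd h \<and> y = h + a) \<longleftrightarrow> x dvd y - a" for y
      by (metis add_diff_cancel_right' diff_add_cancel)
    then show ?thesis
      unfolding a_r_coset_def' PIdl_eis by (simp add: eis_ring_def set_eq_iff)
  qed
  show ?thesis
    unfolding *
  proof
    assume "x dvd a - b"
    then have "x dvd y - a \<longleftrightarrow> x dvd y - b" for y
      using dvd_add_left_iff[of x "a - b" "y - a"] by simp
    then show "{y. x dvd y - a} = {y. x dvd y - b}"
      by simp
  next
    assume "{y. x dvd y - a} = {y. x dvd y - b}"
    then have "a \<in> {y. x dvd y - b}"
      by (metis (mono_tags) diff_self dvd_0_right mem_Collect_eq)
    then show "x dvd a - b"
      by simp
  qed
qed

lemma Units_eis_Quot:
  "Units (eis_ring Quot modulus_ideal) = {modulus_ideal +>\<^bsub>eis_ring\<^esub> b | b. eis_cop b}"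
proof -
  interpret ideal modulus_ideal eis_ring
    by (rule ideal_PIdl_eis)
  have [simp]: "carrier eis_ring = UNIV" "\<one>\<^bsub>eis_ring\<^esub> = 1" "a \<otimes>\<^bsub>eis_ring\<^esub> b = a * b" for a b
    by (simp_all add: eis_ring_def)
  have carr: "carrier (eis_ring Quot modulus_ideal) = range (\<lambda>b. modulus_ideal +>\<^bsub>eis_ring\<^esub> b)"
    by (auto simp: FactRing_def A_RCOSETS_defs a_r_coset_def)
  have unit: "(modulus_ideal +>\<^bsub>eis_ring\<^esub> a) \<otimes>\<^bsub>eis_ring Quot modulus_ideal\<^esub> (modulus_ideal +>\<^bsub>eis_ring\<^esub> b)
    = \<one>\<^bsub>eis_ring Quot modulus_ideal\<^esub> \<longleftrightarrow> 8 * lam dvd a * b - 1" for a b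
    by (simp add: FactRing_def rcoset_mult_add eis_coset_eq_iff)
  show ?thesis
    unfolding Units_def carr eis_cop_iff_unit
    by (auto simp only: bex_simps ball_simps rangeE unit mult.commute cong: conj_cong) (metis rangeI mult.commute unit)+
qed

lemma Units_ZFact_24: "Units (ZFact 24) = {ZMod 24 a | a. coprime a 6}"
proof -
  interpret ideal "Idl\<^bsub>\<Z>\<^esub> {24}" \<Z>
    by (rule int.genideal_ideal) fast
  have carr: "carrier (ZFact 24) = range (ZMod 24)"
    by (auto simp: ZFact_def FactRing_def A_RCOSETS_defs a_r_coset_def ZMod_def)
  have unit: "ZMod 24 a \<otimes>\<^bsub>ZFact 24\<^esub> ZMod 24 b = \<one>\<^bsub>ZFact 24\<^esub> \<longleftrightarrow> 24 dvd a * b - 1" for a b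
    unfolding mod_eq_dvd_iff[symmetric] ZMod_eq_mod[symmetric]
    by (simp add: ZFact_def FactRing_def rcoset_mult_add ZMod_def)
  show ?thesis
    unfolding Units_def carr coprime_6_iff_unit
    by (auto simp only: bex_simps ball_simps rangeE unit mult.commute cong: conj_cong) (metis rangeI mult.commute unit)+
qed

section \<open>Tuples of representatives and the group Gamma\<close>

definition unit_tuple :: "(idx \<Rightarrow> int \<times> eis) \<Rightarrow> bool"
  where "unit_tuple x \<longleftrightarrow> (\<forall>h. coprime (fst (x h)) 6 \<and> eis_cop (snd (x h)))"

definition tmul :: "(idx \<Rightarrow> int \<times> eis) \<Rightarrow> (idx \<Rightarrow> int \<times> eis) \<Rightarrow> idx \<Rightarrow> int \<times> eis"
  where "tmul x y = (\<lambda>h. (fst (x h) * fst (y h), snd (x h) * snd (y h)))"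

definition tpow :: "(idx \<Rightarrow> int \<times> eis) \<Rightarrow> nat \<Rightarrow> idx \<Rightarrow> int \<times> eis"
  where "tpow x n = (\<lambda>h. (fst (x h) ^ n, snd (x h) ^ n))"

abbreviation tone :: "idx \<Rightarrow> int \<times> eis"
  where "tone \<equiv> \<lambda>_. (1, 1)"

lemma tmul_apply [simp]: "fst (tmul x y h) = fst (x h) * fst (y h)" "snd (tmul x y h) = snd (x h) * snd (y h)"
  by (simp_all add: tmul_def)

lemma tmul_commute: "tmul x y = tmul y x"
  by (simp add: tmul_def mult.commute)

lemma tmul_one [simp]: "tmul tone x = x" "tmul x tone = x"
  by (simp_all add: tmul_def)

lemma tpow_Suc: "tpow x (Suc n) = tmul x (tpow x n)"
  by (simp add: tpow_def tmul_def)

lemma unit_tuple_tmul_iff: "unit_tuple (tmul x y) \<longleftrightarrow> unit_tuple x \<and> unit_tuple y"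
  by (auto simp: unit_tuple_def eis_cop_mult_iff)

lemma eis_cop_one: "eis_cop 1"
  by (simp add: eis_cop_iff)

lemma unit_tuple_tone: "unit_tuple tone"
  by (simp add: unit_tuple_def eis_cop_one)

lemma residues_of_eq_iff: "residues_of x = residues_of y \<longleftrightarrow>
    (\<forall>h. 24 dvd fst (x h) - fst (y h) \<and> 8 * lam dvd snd (x h) - snd (y h))"
  by (auto simp: residues_of_def fun_eq_iff ZMod_eq_mod mod_eq_dvd_iff eis_coset_eq_iff)

lemma coprime_6_cong: "coprime a 6 \<longleftrightarrow> coprime b 6" if "24 dvd a - b" for a b :: int
proof -
  have "even a \<longleftrightarrow> even b" "3 dvd a \<longleftrightarrow> 3 dvd b"
    using that by presburger+
  then show ?thesis
    by (simp add: coprime_6_iff)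
qed

lemma carrier_Gamma: "carrier Gamma_grp = {residues_of x | x. unit_tuple x}"
proof (intro equalityI subsetI)
  fix z assume "z \<in> carrier Gamma_grp"
  then have "\<forall>h. \<exists>p. coprime (fst p) 6 \<and> eis_cop (snd p) \<and>
      z h = (ZMod 24 (fst p), modulus_ideal +>\<^bsub>eis_ring\<^esub> snd p)"
    by (fastforce simp: Gamma_grp_def units_of_carrier Units_ZFact_24 Units_eis_Quot PiE_iff)
  then obtain x where "\<forall>h. coprime (fst (x h)) 6 \<and> eis_cop (snd (x h)) \<and>
      z h = (ZMod 24 (fst (x h)), modulus_ideal +>\<^bsub>eis_ring\<^esub> snd (x h))"
    by metis
  then have "unit_tuple x" "z = residues_of x"
    by (simp_all add: unit_tuple_def residues_of_def fun_eq_iff)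
  then show "z \<in> {residues_of x | x. unit_tuple x}"
    by blast
next
  fix z assume "z \<in> {residues_of x | x. unit_tuple x}"
  then show "z \<in> carrier Gamma_grp"
    by (auto simp: Gamma_grp_def units_of_carrier Units_ZFact_24 Units_eis_Quot residues_of_def unit_tuple_def)
qed

lemma residues_of_in_Gamma_iff: "residues_of x \<in> carrier Gamma_grp \<longleftrightarrow> unit_tuple x"
proof
  assume "residues_of x \<in> carrier Gamma_grp"
  then obtain y where "unit_tuple y" "residues_of x = residues_of y"
    by (auto simp: carrier_Gamma)
  then show "unit_tuple x"
    using coprime_6_cong eis_cop_cong unfolding unit_tuple_def residues_of_eq_iff by blast
qed (auto simp: carrier_Gamma)

lemma restrict_UNIV: "restrict f UNIV = f"
  by (simp add: restrict_def)

lemma residues_of_mult: "residues_of x \<otimes>\<^bsub>Gamma_grp\<^esub> residues_of y = residues_of (tmul x y)"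
proof -
  interpret I: ideal "Idl\<^bsub>\<Z>\<^esub> {24}" \<Z>
    by (rule int.genideal_ideal) fast
  interpret J: ideal modulus_ideal eis_ring
    by (rule ideal_PIdl_eis)
  have [simp]: "carrier eis_ring = UNIV" "a \<otimes>\<^bsub>eis_ring\<^esub> b = a * b" for a b
    by (simp_all add: eis_ring_def)
  show ?thesis
    by (simp add: Gamma_grp_def residues_of_def tmul_def units_of_mult ZFact_def FactRing_def
        ZMod_def I.rcoset_mult_add J.rcoset_mult_add restrict_UNIV)
qed

lemma one_Gamma: "\<one>\<^bsub>Gamma_grp\<^esub> = residues_of tone"
proof -
  have [simp]: "\<one>\<^bsub>eis_ring\<^esub> = 1"
    by (simp add: eis_ring_def)
  show ?thesis
    by (simp add: Gamma_grp_def residues_of_def units_of_one ZFact_def FactRing_def ZMod_def restrict_UNIV)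
qed

lemma comm_group_Gamma: "comm_group Gamma_grp"
proof -
  interpret J: ideal modulus_ideal eis_ring
    by (rule ideal_PIdl_eis)
  have "group (units_of (ZFact 24))" "group (units_of (eis_ring Quot modulus_ideal))"
    by (auto intro!: monoid.units_group ring.is_monoid J.quotient_is_ring cring.axioms(1) ZFact_is_cring)
  then have "group Gamma_grp"
    unfolding Gamma_grp_def by (intro product_group DirProd_group)
  then show ?thesis
    by (rule group.group_comm_groupI)
      (auto simp: carrier_Gamma residues_of_mult tmul_commute)
qed

interpretation Gam: comm_group Gamma_grp
  by (rule comm_group_Gamma)

text \<open>Inverses exist because the unit groups have exponents dividing 12.\<close>

lemma residues_of_tpow_12: "residues_of (tpow x 12) = residues_of tone" if "unit_tuple x"
proof -
  have "24 dvd fst (x h) ^ 12 - 1" for h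
  proof -
    have "fst (x h) ^ 12 - 1 = (fst (x h) ^ 2) ^ 6 - 1 ^ 6"
      by (simp flip: power_mult)
    also have "fst (x h) ^ 2 - 1 dvd \<dots>"
      unfolding power_diff_sumr2 by simp
    finally show ?thesis
      using coprime_6_square[of "fst (x h)"] that
      unfolding unit_tuple_def by (metis dvd_trans power2_eq_square)
  qed
  then show ?thesis
    using that eis_cop_pow12 by (auto simp: residues_of_eq_iff tpow_def unit_tuple_def)
qed

text \<open>Closure under products suffices, because in exponent dividing 12 the inverse is the
  eleventh power.\<close>

lemma subgroup_residues_of:
  assumes "P tone" "\<And>x y. P x \<Longrightarrow> P y \<Longrightarrow> P (tmul x y)" "\<And>x. P x \<Longrightarrow> unit_tuple x"
  shows "subgroup {residues_of x | x. P x} Gamma_grp"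
proof (rule Gam.subgroupI)
  show "{residues_of x | x. P x} \<subseteq> carrier Gamma_grp"
    using assms(3) by (auto simp: residues_of_in_Gamma_iff)
  show "{residues_of x | x. P x} \<noteq> {}"
    using assms(1) by blast
  fix z assume "z \<in> {residues_of x | x. P x}"
  then obtain x where x: "z = residues_of x" "P x"
    by blast
  have P: "P (tpow x n)" for n
  proof (induction n)
    case 0
    then show ?case
      using assms(1) by (simp add: tpow_def)
  next
    case (Suc n)
    then show ?case
      using assms(2)[OF x(2)] by (simp add: tpow_Suc)
  qed
  have "residues_of (tpow x 11) \<otimes>\<^bsub>Gamma_grp\<^esub> z = \<one>\<^bsub>Gamma_grp\<^esub>"
    using residues_of_tpow_12[OF assms(3)[OF x(2)]] tpow_Suc[of x 11]
    unfolding x residues_of_mult tmul_commute[of _ x] one_Gamma by simp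
  then have "inv\<^bsub>Gamma_grp\<^esub> z = residues_of (tpow x 11)"
    using P x assms(3) by (intro Gam.inv_equality) (auto simp: residues_of_in_Gamma_iff)
  then show "inv\<^bsub>Gamma_grp\<^esub> z \<in> {residues_of x | x. P x}"
    using P by blast
next
  fix a b assume "a \<in> {residues_of x | x. P x}" "b \<in> {residues_of x | x. P x}"
  then show "a \<otimes>\<^bsub>Gamma_grp\<^esub> b \<in> {residues_of x | x. P x}"
    using assms(2) by (auto simp: residues_of_mult)
qed

section \<open>The subgroups L and E^+ and their product\<close>

definition L_tuple :: "(idx \<Rightarrow> int \<times> eis) \<Rightarrow> bool"
  where "L_tuple x \<longleftrightarrow> unit_tuple x \<and> (\<forall>h. lam dvd of_int (fst (x h)) - snd (x h)) \<and>
    (\<forall>h. 8 dvd walsh (\<lambda>g. fst (x g)) h) \<and> (\<forall>h. 8 dvd walsh (\<lambda>g. snd (x g)) h)"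

definition E_tuple :: "(idx \<Rightarrow> int \<times> eis) \<Rightarrow> bool"
  where "E_tuple x \<longleftrightarrow> (\<forall>h. fst (x h) \<in> {1, - 1}) \<and> (\<Prod>h\<in>UNIV. fst (x h)) = 1 \<and> (\<forall>h. snd (x h) dvd 1)"

lemma L_sub_eq: "L_sub = {residues_of x | x. L_tuple x}"
proof (intro equalityI subsetI)
  fix z assume "z \<in> L_sub"
  then obtain a \<beta> where "z = residues_of (\<lambda>h. (a h, \<beta> h))" "L_tuple (\<lambda>h. (a h, \<beta> h))"
    unfolding L_sub_def L_tuple_def residues_of_in_Gamma_iff fst_conv snd_conv by blast
  then show "z \<in> {residues_of x | x. L_tuple x}"
    by blast
next
  have "residues_of x \<in> L_sub" if "L_tuple x" for x
    unfolding L_sub_def mem_Collect_eq residues_of_in_Gamma_iff using that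
    by (intro exI[of _ "\<lambda>h. fst (x h)"] exI[of _ "\<lambda>h. snd (x h)"]) (simp add: L_tuple_def)
  then show "z \<in> L_sub" if "z \<in> {residues_of x | x. L_tuple x}" for z
    using that by blast
qed

lemma Eplus_eq: "Eplus = {residues_of x | x. E_tuple x}"
proof (intro equalityI subsetI)
  fix z assume "z \<in> Eplus"
  then obtain \<epsilon> \<xi> where "z = residues_of (\<lambda>h. (\<epsilon> h, \<xi> h))" "E_tuple (\<lambda>h. (\<epsilon> h, \<xi> h))"
    unfolding Eplus_def E_tuple_def fst_conv snd_conv by blast
  then show "z \<in> {residues_of x | x. E_tuple x}"
    by blast
next
  have "residues_of x \<in> Eplus" if "E_tuple x" for x
    unfolding Eplus_def mem_Collect_eq using that
    by (intro exI[of _ "\<lambda>h. fst (x h)"] exI[of _ "\<lambda>h. snd (x h)"]) (simp add: E_tuple_def)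
  then show "z \<in> Eplus" if "z \<in> {residues_of x | x. E_tuple x}" for z
    using that by blast
qed

lemma eis_cop_dvd_one:
  assumes "x dvd 1"
  shows "eis_cop x"
proof -
  obtain y where "1 = x * y"
    using assms ..
  then show ?thesis
    using eis_cop_mult_iff[of x y] eis_cop_one by simp
qed

lemma E_tuple_unit: "unit_tuple x" if "E_tuple x"
proof -
  have "coprime (fst (x h)) 6" for h
  proof -
    have "fst (x h) = 1 \<or> fst (x h) = - 1"
      using that by (auto simp: E_tuple_def)
    then show ?thesis
      by auto
  qed
  then show ?thesis
    using that by (simp add: unit_tuple_def E_tuple_def eis_cop_dvd_one)
qed

text \<open>Closure under products is where the ring property of the Walsh lattice enters.\<close>

lemma subgroup_L: "subgroup L_sub Gamma_grp"
  unfolding L_sub_eq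
proof (rule subgroup_residues_of)
  show "L_tuple tone"
    by (simp add: L_tuple_def unit_tuple_tone walsh_one)
  fix x y assume xy: "L_tuple x" "L_tuple y"
  have "lam dvd of_int (fst (tmul x y h)) - snd (tmul x y h)" for h
  proof -
    have "of_int (fst (tmul x y h)) - snd (tmul x y h) =
        of_int (fst (x h)) * (of_int (fst (y h)) - snd (y h)) + (of_int (fst (x h)) - snd (x h)) * snd (y h)"
      by (simp add: algebra_simps)
    then show ?thesis
      using xy by (simp add: L_tuple_def)
  qed
  then show "L_tuple (tmul x y)"
    using xy by (simp add: L_tuple_def unit_tuple_tmul_iff walsh_mult_int walsh_mult_eis)
qed (simp add: L_tuple_def)

lemma subgroup_Eplus: "subgroup Eplus Gamma_grp"
  unfolding Eplus_eq
proof (rule subgroup_residues_of)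
  show "E_tuple tone"
    by (simp add: E_tuple_def)
  fix x y assume xy: "E_tuple x" "E_tuple y"
  have "fst (tmul x y h) \<in> {1, - 1}" for h
  proof -
    have "fst (x h) \<in> {1, - 1}" "fst (y h) \<in> {1, - 1}"
      using xy by (simp_all add: E_tuple_def)
    then show ?thesis
      by auto
  qed
  moreover have "snd (tmul x y h) dvd 1" for h
    using xy mult_dvd_mono[of "snd (x h)" 1 "snd (y h)" 1] by (simp add: E_tuple_def)
  ultimately show "E_tuple (tmul x y)"
    using xy unfolding E_tuple_def by (simp add: prod.distrib)
qed (rule E_tuple_unit)

abbreviation EL :: "(idx \<Rightarrow> int set \<times> eis set) set"
  where "EL \<equiv> Eplus <#>\<^bsub>Gamma_grp\<^esub> L_sub"

lemma subgroup_EL: "subgroup EL Gamma_grp"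
  by (rule Gam.mult_subgroups[OF subgroup_Eplus subgroup_L])

lemma EL_eq: "EL = {residues_of (tmul e l) | e l. E_tuple e \<and> L_tuple l}"
  unfolding set_mult_def Eplus_eq L_sub_eq residues_of_mult[symmetric] by blast

lemma normal_EL: "EL \<lhd> Gamma_grp"
  using subgroup_EL by (simp add: Gam.normal_iff_subgroup)

section \<open>The quotient H and the descent of characters to it\<close>

lemma comm_group_H: "comm_group H_grp"
  unfolding H_grp_def by (rule Gam.abelian_FactGroup[OF subgroup_EL])

interpretation H: comm_group H_grp
  by (rule comm_group_H)

lemma carrier_H: "carrier H_grp = {theta x | x. unit_tuple x}"
  by (auto simp: H_grp_def FactGroup_def RCOSETS_def theta_def carrier_Gamma)

lemma theta_in_H: "unit_tuple x \<Longrightarrow> theta x \<in> carrier H_grp"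
  by (auto simp: carrier_H)

lemma theta_mult: "theta x \<otimes>\<^bsub>H_grp\<^esub> theta y = theta (tmul x y)" if "unit_tuple x" "unit_tuple y"
  using normal.rcos_sum[OF normal_EL, of "residues_of x" "residues_of y"] that
  by (simp add: H_grp_def theta_def residues_of_in_Gamma_iff residues_of_mult)

lemma theta_tone: "theta tone = \<one>\<^bsub>H_grp\<^esub>"
  using subgroup.subset[OF subgroup_EL]
  by (simp add: theta_def H_grp_def FactGroup_def one_Gamma[symmetric] Gam.coset_mult_one)

text \<open>Reduces equality in H to congruences between representatives, once an element of E^+ and
  one of L are exhibited.\<close>

lemma theta_eqI:
  assumes "unit_tuple x" "E_tuple e" "L_tuple l"
    and "\<And>h. 24 dvd fst (y h) - fst (tmul (tmul e l) x h)"
    and "\<And>h. 8 * lam dvd snd (y h) - snd (tmul (tmul e l) x h)"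
  shows "theta y = theta x"
proof -
  have "residues_of y = residues_of (tmul e l) \<otimes>\<^bsub>Gamma_grp\<^esub> residues_of x"
    using assms(4,5) by (simp add: residues_of_mult residues_of_eq_iff)
  moreover have "residues_of (tmul e l) \<in> EL"
    using assms by (auto simp: EL_eq)
  ultimately have "residues_of y \<in> EL #>\<^bsub>Gamma_grp\<^esub> residues_of x"
    by (auto simp: r_coset_def)
  then show ?thesis
    using Gam.repr_independence[OF _ _ subgroup_EL] assms(1)
    by (simp add: theta_def residues_of_in_Gamma_iff)
qed

lemma theta_eqD:
  assumes "theta x = theta y" "unit_tuple x"
  obtains e l where "E_tuple e" "L_tuple l" "residues_of x = residues_of (tmul (tmul e l) y)"
proof -
  have "residues_of x \<in> EL #>\<^bsub>Gamma_grp\<^esub> residues_of x"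
    using assms(2) Gam.rcos_self[OF _ subgroup_EL] by (simp add: residues_of_in_Gamma_iff)
  then have "residues_of x \<in> EL #>\<^bsub>Gamma_grp\<^esub> residues_of y"
    using assms(1) by (simp add: theta_def)
  then show ?thesis
    using that by (auto simp: r_coset_def EL_eq residues_of_mult)
qed

text \<open>The arbitrary choice of a representative is harmless for functions satisfying
  \<open>tuple_char\<close>, as \<open>H_char_theta\<close> shows.\<close>

definition H_char :: "((idx \<Rightarrow> int \<times> eis) \<Rightarrow> bit) \<Rightarrow> (idx \<Rightarrow> int set \<times> eis set) set \<Rightarrow> bit"
  where "H_char \<phi> X = \<phi> (SOME x. unit_tuple x \<and> theta x = X)"

text \<open>What lets a bit-valued function of representatives descend to an additive character of
  H: it depends on residues only and kills both E^+ and L.\<close>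

locale tuple_char =
  fixes \<phi> :: "(idx \<Rightarrow> int \<times> eis) \<Rightarrow> bit"
  assumes mult: "unit_tuple x \<Longrightarrow> unit_tuple y \<Longrightarrow> \<phi> (tmul x y) = \<phi> x + \<phi> y"
    and cong: "residues_of x = residues_of y \<Longrightarrow> \<phi> x = \<phi> y"
    and E: "E_tuple x \<Longrightarrow> \<phi> x = 0"
    and L: "L_tuple x \<Longrightarrow> \<phi> x = 0"
begin

lemma H_char_theta: "H_char \<phi> (theta x) = \<phi> x" if "unit_tuple x"
proof -
  define y where "y = (SOME y. unit_tuple y \<and> theta y = theta x)"
  have "\<exists>y. unit_tuple y \<and> theta y = theta x"
    using that by blast
  then have y: "unit_tuple y" "theta y = theta x"
    unfolding y_def by (metis (mono_tags, lifting) someI_ex)+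
  from y(2,1) obtain e l where "E_tuple e" "L_tuple l" "residues_of y = residues_of (tmul (tmul e l) x)"
    by (rule theta_eqD)
  moreover from this have "unit_tuple e" "unit_tuple l"
    by (simp_all add: E_tuple_unit L_tuple_def)
  ultimately have "\<phi> y = \<phi> x"
    using cong[of y "tmul (tmul e l) x"] that by (simp add: mult E L unit_tuple_tmul_iff)
  then show ?thesis
    by (simp add: H_char_def y_def)
qed

lemma H_char_mult: "H_char \<phi> (X \<otimes>\<^bsub>H_grp\<^esub> Y) = H_char \<phi> X + H_char \<phi> Y"
  if "X \<in> carrier H_grp" "Y \<in> carrier H_grp"
  using that by (auto simp: carrier_H theta_mult H_char_theta unit_tuple_tmul_iff mult)

end

subsection \<open>Characters\<close>

text \<open>Together with \<open>sgn3\<close>, the nontrivial character modulo 4 and modulo 3,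
  written additively; non-units receive the default 0.\<close>

definition sgn4 :: "int \<Rightarrow> bit"
  where "sgn4 n = (if n mod 4 = 3 then 1 else 0)"

definition sgn3 :: "int \<Rightarrow> bit"
  where "sgn3 n = (if n mod 3 = 2 then 1 else 0)"

text \<open>Modulo \<open>lam\<close> one has \<open>omega = 1\<close>, so the coordinate sum is the
  residue of \<open>x\<close> in the field with three elements.\<close>

definition lsgn :: "eis \<Rightarrow> bit"
  where "lsgn x = sgn3 (eis_re x + eis_om x)"

text \<open>
  Cubing kills \<open>omega\<close>, so that \<open>x ^ 3\<close> is congruent to \<open>(- 1)\<^sup>a (1 + 2 \<omega>)\<^sup>b\<close> modulo 4 for \<open>x\<close> prime to 2,
  where \<open>a = asgn x\<close> and \<open>b = bsgn x\<close>.
\<close>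

definition asgn :: "eis \<Rightarrow> bit"
  where "asgn x = sgn4 (eis_re (x ^ 3))"

definition bsgn :: "eis \<Rightarrow> bit"
  where "bsgn x = (if eis_om (x ^ 3) mod 4 = 2 then 1 else 0)"

text \<open>Lifts a bit to the integers, so that bit identities can be read off from congruences
  modulo 4.\<close>

definition ib :: "bit \<Rightarrow> int"
  where "ib b = (if b = 1 then 1 else 0)"

lemma ib_simps [simp]: "ib 0 = 0" "ib 1 = 1"
  by (simp_all add: ib_def)

lemma bit_add_cancel [simp]: "b + b = 0" "b + (b + c) = c" for b c :: bit
  by (cases b; cases c; simp)+

lemma sum_ib: "even ((\<Sum>h\<in>A. ib (z h)) - ib (\<Sum>h\<in>A. z h))"
proof (induction A rule: infinite_finite_induct)
  case (insert x A)
  then show ?case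
    by (cases "z x"; cases "\<Sum>h\<in>A. z h"; simp)
qed simp_all

lemma sum_bit_eq_0_iff: "(\<Sum>h\<in>A. z h) = 0 \<longleftrightarrow> even (\<Sum>h\<in>A. ib (z h))"
  using sum_ib[of z A] by (cases "\<Sum>h\<in>A. z h"; simp)

lemma sgn4_mod4: "4 dvd n - (1 + 2 * ib (sgn4 n))" if "odd n"
  using that unfolding sgn4_def by (simp; presburger)

lemma sgn4_cong: "4 dvd m - n \<Longrightarrow> sgn4 m = sgn4 n"
  unfolding sgn4_def by (metis mod_eq_dvd_iff)

lemma sgn3_cong: "3 dvd m - n \<Longrightarrow> sgn3 m = sgn3 n"
  unfolding sgn3_def by (metis mod_eq_dvd_iff)

lemma sgn4_mult: "sgn4 (m * n) = sgn4 m + sgn4 n" if "odd m" "odd n"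
proof -
  have "m mod 4 = 1 \<or> m mod 4 = 3" "n mod 4 = 1 \<or> n mod 4 = 3"
    using that by presburger+
  moreover have "m * n mod 4 = (m mod 4) * (n mod 4) mod 4"
    by (simp add: mod_mult_eq)
  ultimately show ?thesis
    unfolding sgn4_def by (elim disjE) simp_all
qed

lemma sgn3_mult: "sgn3 (m * n) = sgn3 m + sgn3 n" if "\<not> 3 dvd m" "\<not> 3 dvd n"
proof -
  have "m mod 3 = 1 \<or> m mod 3 = 2" "n mod 3 = 1 \<or> n mod 3 = 2"
    using that by presburger+
  moreover have "m * n mod 3 = (m mod 3) * (n mod 3) mod 3"
    by (simp add: mod_mult_eq)
  ultimately show ?thesis
    unfolding sgn3_def by (elim disjE) simp_all
qed

lemma cube_parity: "odd (eis_re (x ^ 3))" "even (eis_om (x ^ 3))" if "\<not> 2 dvd x"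
  using two_dvd_cube[OF that] by (auto simp: numeral_dvd_eis_iff)

lemma lsgn_mult: "lsgn (x * y) = lsgn x + lsgn y" if "eis_cop x" "eis_cop y"
proof -
  have "lsgn (x * y) = sgn3 ((eis_re x + eis_om x) * (eis_re y + eis_om y))"
    unfolding lsgn_def
  proof (rule sgn3_cong, rule dvdI)
    show "eis_re (x * y) + eis_om (x * y) - (eis_re x + eis_om x) * (eis_re y + eis_om y) =
        3 * - (eis_om x * eis_om y)"
      by (simp add: algebra_simps)
  qed
  then show ?thesis
    using that unfolding lsgn_def eis_cop_iff by (simp add: sgn3_mult)
qed

text \<open>Cubes of elements prime to 2 have odd first and even second coordinate. In a product of
  two such cubes the cross term of the second coordinates is a multiple of 4, so the signs multiply
  and the halved second coordinates add modulo 2.\<close>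

lemma asgn_bsgn_mult:
  assumes "eis_cop x" "eis_cop y"
  shows "asgn (x * y) = asgn x + asgn y" "bsgn (x * y) = bsgn x + bsgn y"
proof -
  let ?p = "eis_re (x ^ 3)" and ?p' = "eis_re (y ^ 3)"
  have odd: "odd ?p" "odd ?p'"
    using assms cube_parity unfolding eis_cop_def by blast+
  obtain r r' where r: "eis_om (x ^ 3) = 2 * r" "eis_om (y ^ 3) = 2 * r'"
    using assms cube_parity unfolding eis_cop_def by (metis dvdE)
  have "asgn (x * y) = sgn4 (?p * ?p')"
    unfolding asgn_def power_mult_distrib by (rule sgn4_cong) (simp add: r)
  then show "asgn (x * y) = asgn x + asgn y"
    using odd by (simp add: sgn4_mult asgn_def)
  have *: "2 * n mod 4 = 2 \<longleftrightarrow> odd n" for n :: int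
    by presburger
  have om: "eis_om ((x * y) ^ 3) = 2 * (?p * r' + r * ?p' - 2 * (r * r'))"
    unfolding power_mult_distrib by (simp add: r algebra_simps)
  show "bsgn (x * y) = bsgn x + bsgn y"
    using odd unfolding bsgn_def r om * by simp
qed

lemma eis_sgn_cong:
  assumes "8 dvd x - y"
  shows "asgn x = asgn y" "bsgn x = bsgn y"
proof -
  have "x - y dvd x ^ 3 - y ^ 3"
    unfolding power_diff_sumr2 by simp
  then have "8 dvd eis_re (x ^ 3) - eis_re (y ^ 3)" "8 dvd eis_om (x ^ 3) - eis_om (y ^ 3)"
    using dvd_trans[OF assms, of "x ^ 3 - y ^ 3"] by (simp_all add: numeral_dvd_eis_iff)
  then have *: "4 dvd eis_re (x ^ 3) - eis_re (y ^ 3)" "4 dvd eis_om (x ^ 3) - eis_om (y ^ 3)"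
    by presburger+
  show "asgn x = asgn y"
    unfolding asgn_def using *(1) by (rule sgn4_cong)
  show "bsgn x = bsgn y"
    unfolding bsgn_def using *(2) by (metis mod_eq_dvd_iff)
qed

lemma lsgn_cong: "lam dvd x - y \<Longrightarrow> lsgn x = lsgn y"
  unfolding lsgn_def lam_dvd_iff by (rule sgn3_cong) (simp add: algebra_simps)

definition charS :: "(idx \<Rightarrow> int \<times> eis) \<Rightarrow> bit"
  where "charS x = (\<Sum>h\<in>UNIV. sgn4 (fst (x h)))"

definition charA :: "(idx \<Rightarrow> int \<times> eis) \<Rightarrow> bit"
  where "charA x = (\<Sum>h\<in>UNIV. sgn3 (fst (x h)) + lsgn (snd (x h)) + asgn (snd (x h)))"

text \<open>The constants are included as \<open>v = 0\<close>; the zero sets of the other affine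
  functions are the affine planes.\<close>

definition aff :: "idx \<Rightarrow> bit \<Rightarrow> idx \<Rightarrow> bit"
  where "aff v c h = dot v h + c"

definition charB :: "idx \<Rightarrow> bit \<Rightarrow> (idx \<Rightarrow> int \<times> eis) \<Rightarrow> bit"
  where "charB v c x = (\<Sum>h\<in>UNIV. aff v c h * bsgn (snd (x h)))"

lemma sum_sgn4_unit: "\<lbrakk>finite A; \<And>h. h \<in> A \<Longrightarrow> \<epsilon> h \<in> {1, - 1}\<rbrakk> \<Longrightarrow>
    (\<Prod>h\<in>A. \<epsilon> h) = (if (\<Sum>h\<in>A. sgn4 (\<epsilon> h)) = 0 then 1 else - 1)"
proof (induction A rule: finite_induct)
  case (insert x A)
  have "\<epsilon> x = 1 \<and> sgn4 (\<epsilon> x) = 0 \<or> \<epsilon> x = - 1 \<and> sgn4 (\<epsilon> x) = 1"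
    using insert.prems[of x] by (auto simp: sgn4_def)
  moreover have "(\<Prod>h\<in>A. \<epsilon> h) = (if (\<Sum>h\<in>A. sgn4 (\<epsilon> h)) = 0 then 1 else - 1)"
    using insert by blast
  ultimately show ?case
    using insert.hyps by (elim disjE; cases "\<Sum>h\<in>A. sgn4 (\<epsilon> h)"; simp)
qed simp

lemma E_tuple_sgn4: "(\<Sum>h\<in>UNIV. sgn4 (fst (x h))) = 0" if "E_tuple x"
  using sum_sgn4_unit[of UNIV "\<lambda>h. fst (x h)"] that by (auto simp: E_tuple_def split: if_splits)

lemma eis_unit_cases:
  assumes "x dvd 1"
  shows "x \<in> {Eis 1 0, Eis (- 1) 0, Eis 0 1, Eis 0 (- 1), Eis 1 1, Eis (- 1) (- 1)}"
proof -
  obtain y where y: "1 = x * y"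
    using assms ..
  have "eis_norm x * eis_norm y = 1"
    unfolding eis_norm_mult[symmetric] y[symmetric] by (simp add: eis_norm_def)
  then have "eis_norm x = 1 \<or> eis_norm x = - 1"
    using zmult_eq_1_iff by blast
  moreover define p q where pq: "p = eis_re x" "q = eis_om x"
  \<comment> \<open>Completing the square in either coordinate shows that the norm is nonnegative
    and that norm 1 bounds both coordinates by 1.\<close>
  have four: "4 * eis_norm x = (2 * p - q)\<^sup>2 + 3 * q\<^sup>2" "4 * eis_norm x = (2 * q - p)\<^sup>2 + 3 * p\<^sup>2"
    by (simp_all add: eis_norm_def pq power2_eq_square algebra_simps)
  then have "eis_norm x \<ge> 0"
    using zero_le_power2[of "2 * p - q"] zero_le_power2[of q] by linarith
  ultimately have norm: "eis_norm x = 1"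
    by linarith
  have small: "n \<in> {- 1, 0, 1}" if "3 * n\<^sup>2 \<le> 4" for n :: int
  proof -
    have "n\<^sup>2 < 2\<^sup>2"
      using that by simp
    then have "\<bar>n\<bar> < 2"
      using power2_less_imp_less[of "\<bar>n\<bar>" 2] by simp
    then show ?thesis
      by auto
  qed
  have "p \<in> {- 1, 0, 1}" "q \<in> {- 1, 0, 1}"
    using four norm zero_le_power2[of "2 * p - q"] zero_le_power2[of "2 * q - p"]
    by (intro small; linarith)+
  moreover have "p\<^sup>2 - p * q + q\<^sup>2 = 1"
    using norm by (simp add: eis_norm_def pq)
  moreover have "x = Eis p q"
    by (simp add: pq)
  ultimately show ?thesis
    by auto
qed

text \<open>A unit is a sign times a power of \<open>omega\<close>, and \<open>omega\<close> becomes
  1 both modulo \<open>lam\<close> and under cubing, so either function returns the sign.\<close>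

lemma eis_unit_sgn:
  assumes "x dvd 1"
  shows "lsgn x = asgn x" "bsgn x = 0"
  using eis_unit_cases[OF assms]
  by (auto simp: lsgn_def asgn_def bsgn_def sgn3_def sgn4_def power3_eq_cube)

lemma dvd_sum_plane:
  fixes a :: "idx \<Rightarrow> int"
  assumes "\<And>h. 2 * d dvd walsh a h"
  shows "d dvd (\<Sum>g | dot v g = c. a g)"
proof -
  have "2 * d dvd 2 * (\<Sum>g | dot v g = c. a g)"
    unfolding sum_plane using assms by simp
  then show ?thesis
    by simp
qed

lemma sum_aff: "(\<Sum>h\<in>UNIV. aff v c h * z h) = (\<Sum>h | dot v h = c + 1. z h)"
proof -
  have "aff v c h = (if dot v h = c + 1 then 1 else 0)" for h
    by (cases c; cases "dot v h") (simp_all add: aff_def)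
  then have "(\<Sum>h\<in>UNIV. aff v c h * z h) = (\<Sum>h\<in>UNIV. if dot v h = c + 1 then z h else 0)"
    by (intro sum.cong) simp_all
  then show ?thesis
    by (simp add: sum.inter_filter[symmetric])
qed

text \<open>Sum the congruences \<open>a = 1 + 2 * ib (sgn4 a)\<close> modulo 4; the constant terms
  add up to the cardinality, which vanishes modulo 4.\<close>

lemma sum_sgn4_eq_0_iff:
  assumes "\<And>h. h \<in> A \<Longrightarrow> odd (a h)" "4 dvd int (card A)"
  shows "(\<Sum>h\<in>A. sgn4 (a h)) = 0 \<longleftrightarrow> 4 dvd (\<Sum>h\<in>A. a h)"
proof -
  have "4 dvd (\<Sum>h\<in>A. a h - (1 + 2 * ib (sgn4 (a h))))"
    using assms(1) by (intro dvd_sum sgn4_mod4)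
  also have "(\<Sum>h\<in>A. a h - (1 + 2 * ib (sgn4 (a h)))) = (\<Sum>h\<in>A. a h) - (int (card A) + 2 * (\<Sum>h\<in>A. ib (sgn4 (a h))))"
    by (simp add: sum_subtractf sum.distrib sum_distrib_left)
  finally show ?thesis
    unfolding sum_bit_eq_0_iff using assms(2) by presburger
qed

lemma sum_half_eq_0_iff:
  fixes a :: "idx \<Rightarrow> int"
  assumes "\<And>h. h \<in> A \<Longrightarrow> even (a h)"
  shows "(\<Sum>h\<in>A. if a h mod 4 = 2 then 1 else 0 :: bit) = 0 \<longleftrightarrow> 4 dvd (\<Sum>h\<in>A. a h)"
proof -
  have "4 dvd a h - 2 * ib (if a h mod 4 = 2 then 1 else 0)" if "h \<in> A" for h
    using assms[OF that] by (simp; presburger)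
  then have "4 dvd (\<Sum>h\<in>A. a h - 2 * ib (if a h mod 4 = 2 then 1 else 0))"
    by (rule dvd_sum)
  also have "\<dots> = (\<Sum>h\<in>A. a h) - 2 * (\<Sum>h\<in>A. ib (if a h mod 4 = 2 then 1 else 0))"
    by (simp add: sum_subtractf sum_distrib_left)
  finally show ?thesis
    unfolding sum_bit_eq_0_iff by presburger
qed

lemma card_bit [simp]: "CARD(bit) = 2"
proof -
  have "(UNIV :: bit set) = {0, 1}"
    by (auto simp: set_eq_iff)
  show ?thesis
    unfolding \<open>UNIV = {0, 1}\<close> by simp
qed

lemma L_tuple_cube:
  assumes "L_tuple x"
  shows "8 dvd walsh (\<lambda>g. eis_re (snd (x g) ^ 3)) h" "8 dvd walsh (\<lambda>g. eis_om (snd (x g) ^ 3)) h"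
proof -
  have "8 dvd walsh (\<lambda>g. snd (x g) * (snd (x g) * snd (x g))) h" for h
    using assms by (intro walsh_mult_eis) (simp_all add: L_tuple_def)
  then show "8 dvd walsh (\<lambda>g. eis_re (snd (x g) ^ 3)) h" "8 dvd walsh (\<lambda>g. eis_om (snd (x g) ^ 3)) h"
    unfolding dvd_walsh_eis power3_eq_cube mult.assoc by blast+
qed

interpretation charS: tuple_char charS
proof
  fix x y assume "unit_tuple x" "unit_tuple y"
  then have "sgn4 (fst (tmul x y h)) = sgn4 (fst (x h)) + sgn4 (fst (y h))" for h
    by (simp add: unit_tuple_def coprime_6_iff sgn4_mult)
  then show "charS (tmul x y) = charS x + charS y"
    by (simp only: charS_def sum.distrib)
next
  fix x y assume "residues_of x = residues_of y"
  then have "24 dvd fst (x h) - fst (y h)" for h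
    by (simp add: residues_of_eq_iff)
  then have "4 dvd fst (x h) - fst (y h)" for h
    by (rule dvd_trans[rotated]) simp
  then show "charS x = charS y"
    unfolding charS_def by (intro sum.cong refl sgn4_cong)
next
  fix x assume "E_tuple x"
  then show "charS x = 0"
    by (simp add: charS_def E_tuple_sgn4)
next
  fix x assume x: "L_tuple x"
  then have "8 dvd (\<Sum>h\<in>UNIV. fst (x h))"
    by (simp add: L_tuple_def flip: walsh_0)
  then have "4 dvd (\<Sum>h\<in>UNIV. fst (x h))"
    by presburger
  then show "charS x = 0"
    unfolding charS_def using x
    by (subst sum_sgn4_eq_0_iff) (simp_all add: L_tuple_def unit_tuple_def coprime_6_iff)
qed

interpretation charA: tuple_char charA
proof
  fix x y assume "unit_tuple x" "unit_tuple y"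
  then have "sgn3 (fst (tmul x y h)) = sgn3 (fst (x h)) + sgn3 (fst (y h))"
    "lsgn (snd (tmul x y h)) = lsgn (snd (x h)) + lsgn (snd (y h))"
    "asgn (snd (tmul x y h)) = asgn (snd (x h)) + asgn (snd (y h))" for h
    by (simp_all add: unit_tuple_def coprime_6_iff sgn3_mult lsgn_mult asgn_bsgn_mult)
  then show "charA (tmul x y) = charA x + charA y"
    by (simp only: charA_def sum.distrib add_ac)
next
  fix x y assume xy: "residues_of x = residues_of y"
  have "sgn3 (fst (x h)) = sgn3 (fst (y h))" "lsgn (snd (x h)) = lsgn (snd (y h))"
     "asgn (snd (x h)) = asgn (snd (y h))" for h
  proof -
    have "24 dvd fst (x h) - fst (y h)"
      using xy by (simp add: residues_of_eq_iff)
    then show "sgn3 (fst (x h)) = sgn3 (fst (y h))"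
      by (intro sgn3_cong) presburger
    have "8 * lam dvd snd (x h) - snd (y h)"
      using xy by (simp add: residues_of_eq_iff)
    then show "lsgn (snd (x h)) = lsgn (snd (y h))" "asgn (snd (x h)) = asgn (snd (y h))"
      unfolding eight_lam_dvd_iff by (simp_all add: lsgn_cong eis_sgn_cong)
  qed
  then show "charA x = charA y"
    by (simp add: charA_def)
next
  fix x assume x: "E_tuple x"
  \<comment> \<open>For a unit, \<open>lsgn\<close> and \<open>asgn\<close> cancel; on 1 and -1 the
    characters modulo 3 and 4 agree. The sum is thus governed by the product of the rational signs,
    which is 1 in E^+.\<close>
  have "sgn3 (fst (x h)) + lsgn (snd (x h)) + asgn (snd (x h)) = sgn4 (fst (x h))" for h
  proof -
    have "fst (x h) = 1 \<or> fst (x h) = - 1" "snd (x h) dvd 1"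
      using x by (auto simp: E_tuple_def)
    then show ?thesis
      by (auto simp: eis_unit_sgn sgn3_def sgn4_def add.assoc)
  qed
  then show "charA x = 0"
    using x by (simp add: charA_def E_tuple_sgn4)
next
  fix x assume x: "L_tuple x"
  \<comment> \<open>On L the congruence modulo \<open>lam\<close> cancels the first two terms,
    leaving the sign of the cube modulo 4.\<close>
  have "sgn3 (fst (x h)) + lsgn (snd (x h)) + asgn (snd (x h)) = sgn4 (eis_re (snd (x h) ^ 3))" for h
  proof -
    have "lam dvd of_int (fst (x h)) - snd (x h)"
      using x by (simp add: L_tuple_def)
    then have "sgn3 (fst (x h)) = lsgn (snd (x h))"
      unfolding lsgn_def lam_dvd_iff by (intro sgn3_cong) (simp add: algebra_simps)
    then show ?thesis
      by (simp add: asgn_def add.assoc)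
  qed
  then have "charA x = (\<Sum>h\<in>UNIV. sgn4 (eis_re (snd (x h) ^ 3)))"
    by (simp add: charA_def)
  also have "8 dvd (\<Sum>h\<in>UNIV. eis_re (snd (x h) ^ 3))"
    unfolding walsh_0[symmetric] using x by (rule L_tuple_cube)
  then have "4 dvd (\<Sum>h\<in>UNIV. eis_re (snd (x h) ^ 3))"
    by presburger
  then have "(\<Sum>h\<in>UNIV. sgn4 (eis_re (snd (x h) ^ 3))) = 0"
    using x by (subst sum_sgn4_eq_0_iff) (simp_all add: L_tuple_def unit_tuple_def eis_cop_def cube_parity)
  finally show "charA x = 0" .
qed

interpretation charB: tuple_char "charB v c"
proof
  fix x y assume "unit_tuple x" "unit_tuple y"
  then have "bsgn (snd (tmul x y h)) = bsgn (snd (x h)) + bsgn (snd (y h))" for h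
    by (simp add: unit_tuple_def asgn_bsgn_mult)
  then show "charB v c (tmul x y) = charB v c x + charB v c y"
    by (simp only: charB_def distrib_left sum.distrib)
next
  fix x y assume xy: "residues_of x = residues_of y"
  have "bsgn (snd (x h)) = bsgn (snd (y h))" for h
  proof -
    have "8 * lam dvd snd (x h) - snd (y h)"
      using xy by (simp add: residues_of_eq_iff)
    then show ?thesis
      unfolding eight_lam_dvd_iff by (simp add: eis_sgn_cong)
  qed
  then show "charB v c x = charB v c y"
    by (simp add: charB_def)
next
  fix x assume "E_tuple x"
  then show "charB v c x = 0"
    by (simp add: charB_def E_tuple_def eis_unit_sgn)
next
  fix x assume x: "L_tuple x"
  \<comment> \<open>Cubes stay in the lattice; \<open>sum_plane\<close> loses one factor 2, so plane
    sums remain divisible by 4.\<close>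
  have "4 dvd (\<Sum>h | dot v h = c + 1. eis_om (snd (x h) ^ 3))"
    using L_tuple_cube(2)[OF x] by (intro dvd_sum_plane) simp
  then show "charB v c x = 0"
    unfolding charB_def sum_aff bsgn_def using x
    by (subst sum_half_eq_0_iff) (simp_all add: L_tuple_def unit_tuple_def eis_cop_def cube_parity)
qed

subsection \<open>The omitted class\<close>

text \<open>The affine functions form the first-order Reed-Muller code of length 8, which is
  self-dual.\<close>

lemma aff_orthogonal:
  assumes "\<And>v c. (\<Sum>h\<in>UNIV. aff v c h * z h) = 0"
  shows "\<exists>v c. z = aff v c"
proof -
  have bits: "\<forall>a b c d e f g h :: bit. a + b + c + d + e + f + g + h = 0 \<longrightarrow> b + d + f + h = 0 \<longrightarrow>
      c + d + g + h = 0 \<longrightarrow> e + f + g + h = 0 \<longrightarrow>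
      d = (a + c) + (a + b) + a \<and> f = (a + e) + (a + b) + a \<and> g = (a + e) + (a + c) + a \<and>
      h = (a + e) + (a + c) + (a + b) + a"
    by (simp add: all_bit)
  \<comment> \<open>An affine function is determined by its values at 0 and the three unit vectors;
    orthogonality to the constant 1 and the three coordinates fixes the other four values.\<close>
  let ?v = "pt (z (pt 0 0 0) + z (pt 1 0 0)) (z (pt 0 0 0) + z (pt 0 1 0)) (z (pt 0 0 0) + z (pt 0 0 1))"
  have "\<forall>h. z h = aff ?v (z (pt 0 0 0)) h"
    using assms[of "pt 0 0 0" 1] assms[of "pt 1 0 0" 0] assms[of "pt 0 1 0" 0] assms[of "pt 0 0 1" 0]
      bits[rule_format, of "z (pt 0 0 0)" "z (pt 0 0 1)" "z (pt 0 1 0)" "z (pt 0 1 1)"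
        "z (pt 1 0 0)" "z (pt 1 0 1)" "z (pt 1 1 0)" "z (pt 1 1 1)"]
    unfolding all_idx all_bit aff_def sum_idx dot_pt mult_1 mult_zero_left mult_zero_right mult_1_right add_0 add_0_right
    by (metis bit_add_cancel add.commute)
  then show ?thesis
    by blast
qed

lemma aff_add3: "aff v c (g + h + k) = aff v c g + aff v c h + aff v c k"
  by (simp only: aff_def dot_add add_ac bit_add_cancel)

lemma aff_plus: "aff v c h + aff v' c' h = aff (v + v') (c + c') h" "aff v c h + 1 = aff v (c + 1) h"
  by (simp_all only: aff_def dot_add add_ac)

definition ob :: "int \<Rightarrow> bit"
  where "ob n = (if odd n then 1 else 0)"

lemma sum_ob: "(\<Sum>h\<in>A. ob (a h)) = 0 \<longleftrightarrow> even (\<Sum>h\<in>A. a h)"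
proof -
  have "even (a h - ib (ob (a h)))" for h
    by (simp add: ob_def)
  then have "even (\<Sum>h\<in>A. a h - ib (ob (a h)))"
    by (rule dvd_sum)
  then show ?thesis
    unfolding sum_bit_eq_0_iff sum_subtractf by simp
qed

text \<open>In \<open>x ^ 3 - x = (x - 1) * x * (x + 1)\<close> both outer factors are divisible by
  2.\<close>

lemma cube_eq_mod4: "4 dvd x ^ 3 - x" if "2 dvd x - 1" for x :: eis
proof -
  obtain y where "x - 1 = 2 * y"
    using \<open>2 dvd x - 1\<close> ..
  then have "x = 1 + 2 * y"
    by (simp add: algebra_simps)
  then have "x ^ 3 - x = 4 * ((1 + 2 * y) * (y + y ^ 2))"
    by (simp add: power3_eq_cube power2_eq_square algebra_simps)
  then show ?thesis
    by simp
qed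

text \<open>\<open>omega ^ zidx x\<close> is the residue of \<open>x\<close> modulo 2.\<close>

definition zidx :: "eis \<Rightarrow> nat"
  where "zidx x = (if even (eis_om x) then 0 else if even (eis_re x) then 1 else 2)"

lemma omega_cube: "omega ^ 3 = 1"
  by (simp add: eis_eq_iff power3_eq_cube)

text \<open>Rotate \<open>x\<close> by a power of \<open>omega\<close> to make it 1 modulo 2. Then
  it agrees with its cube modulo 4, and cubing forgets the rotation.\<close>

lemma omega_zidx_cube: "4 dvd x - omega ^ zidx x * x ^ 3" if "\<not> 2 dvd x"
proof -
  define y where "y = omega ^ (2 * zidx x) * x"
  have "2 dvd y - 1"
    using that by (auto simp: y_def zidx_def numeral_dvd_eis_iff power2_eq_square power4_eq_xxxx)
  moreover have "(omega ^ (2 * zidx x)) ^ 3 = (omega ^ 3) ^ (2 * zidx x)"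
    by (simp only: power_mult[symmetric] mult.commute)
  then have "y ^ 3 = x ^ 3"
    by (simp add: y_def power_mult_distrib omega_cube)
  ultimately have "4 dvd x ^ 3 - y"
    using cube_eq_mod4[of y] by metis
  then have "4 dvd omega ^ zidx x * (x ^ 3 - y)"
    by simp
  moreover have "omega ^ zidx x * y = x"
  proof -
    have "omega ^ zidx x * omega ^ (2 * zidx x) = (omega ^ 3) ^ zidx x"
      by (simp flip: power_mult power_add)
    then show ?thesis
      by (simp add: y_def omega_cube flip: mult.assoc)
  qed
  ultimately have "4 dvd omega ^ zidx x * x ^ 3 - x"
    by (simp add: algebra_simps)
  then show ?thesis
    by (subst dvd_minus_iff[symmetric]) simp
qed

text \<open>The case of all exponents 1 in the classes \<open>Q_set 8\<close>. The Walsh condition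
  makes reduction modulo 2 an affine map to the field with four elements avoiding 0. Its fibres are
  zero sets of affine functions, so vanishing of all \<open>charB\<close> controls the second
  coordinates of the cubes on each fibre. Comparing total sums modulo 4 shows that the three fibre
  sums of first coordinates agree, and an empty fibre makes them all 0.\<close>

lemma charA_ones_eq_0:
  fixes \<gamma> :: "idx \<Rightarrow> eis"
  assumes unit: "\<And>h. eis_cop (\<gamma> h)" and walsh: "\<And>h. 8 dvd walsh (\<lambda>g. 2 * \<gamma> g) h"
    and B: "\<And>v c. (\<Sum>h\<in>UNIV. aff v c h * bsgn (\<gamma> h)) = 0"
  shows "(\<Sum>h\<in>UNIV. asgn (\<gamma> h)) = 0"
proof -
  let ?p = "\<lambda>h. eis_re (\<gamma> h)" and ?q = "\<lambda>h. eis_om (\<gamma> h)"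
  let ?P = "\<lambda>h. eis_re (\<gamma> h ^ 3)" and ?Q = "\<lambda>h. eis_om (\<gamma> h ^ 3)"
  have cop: "\<not> 2 dvd \<gamma> h" for h
    using unit by (simp add: eis_cop_def)
  have "4 dvd walsh \<gamma> h" for h
    using walsh[of h] by (simp add: walsh_mult_left numeral_dvd_eis_iff) presburger
  then have w4: "4 dvd walsh ?p h" "4 dvd walsh ?q h" for h
    unfolding numeral_dvd_eis_iff walsh_eis by blast+
  have "even (\<Sum>g | dot v g = c. ?p g)" "even (\<Sum>g | dot v g = c. ?q g)" for v c
    using w4 by (auto intro!: dvd_sum_plane)
  then obtain vp cp vq cq where aff: "(\<lambda>h. ob (?p h)) = aff vp cp" "(\<lambda>h. ob (?q h)) = aff vq cq"
    using aff_orthogonal[of "\<lambda>h. ob (?p h)"] aff_orthogonal[of "\<lambda>h. ob (?q h)"]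
    unfolding sum_aff sum_ob by blast
  define Z where "Z j = {h. zidx (\<gamma> h) = j}" for j
  have affp: "aff vp cp h = ob (?p h)" and affq: "aff vq cq h = ob (?q h)" for h
    using aff by (metis, metis)
  have odd_or: "odd (?p h) \<or> odd (?q h)" for h
    using unit by (simp add: eis_cop_iff)
  \<comment> \<open>As the residue is never 0, one even coordinate, or an even coordinate sum,
    already identifies it.\<close>
  have Z: "Z 0 = {h. aff vq cq h = 0}" "Z 1 = {h. aff vp cp h = 0}" "Z 2 = {h. aff (vp + vq) (cp + cq) h = 0}"
    using odd_or unfolding aff_plus(1)[symmetric] affp affq by (auto simp: Z_def zidx_def ob_def split: if_splits)
  have plane: "{h. aff v c h = 0} = {h. dot v h = c}" for v c
    by (auto simp: aff_def)
  have Qsum: "4 dvd (\<Sum>h | aff v c h = 0. ?Q h)" for v c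
    using B[of v "c + 1"] sum_half_eq_0_iff[of "{h. dot v h = c}" ?Q] cube_parity(2)[OF cop]
    unfolding plane sum_aff bsgn_def add.assoc bit_add_cancel add_0_right by blast
  have Qj: "4 dvd (\<Sum>h\<in>Z 0. ?Q h)" "4 dvd (\<Sum>h\<in>Z 1. ?Q h)" "4 dvd (\<Sum>h\<in>Z 2. ?Q h)"
    unfolding Z by (rule Qsum)+
  have split: "(\<Sum>h\<in>UNIV. f h) = (\<Sum>h\<in>Z 0. f h) + (\<Sum>h\<in>Z 1. f h) + (\<Sum>h\<in>Z 2. f h)" for f :: "idx \<Rightarrow> int"
  proof -
    have "zidx (\<gamma> h) \<in> {0, 1, 2}" for h
      by (simp add: zidx_def)
    then have UNIV: "UNIV = (Z 0 \<union> Z 1) \<union> Z 2"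
      by (auto simp: Z_def)
    have disj: "(Z 0 \<union> Z 1) \<inter> Z 2 = {}" "Z 0 \<inter> Z 1 = {}"
      by (auto simp: Z_def)
    show ?thesis
      by (simp only: UNIV sum.union_disjoint[OF finite_idx finite_idx disj(1)]
          sum.union_disjoint[OF finite_idx finite_idx disj(2)])
  qed
  have mod4: "4 dvd eis_re (\<gamma> h) - eis_re (omega ^ zidx (\<gamma> h) * \<gamma> h ^ 3)"
      "4 dvd eis_om (\<gamma> h) - eis_om (omega ^ zidx (\<gamma> h) * \<gamma> h ^ 3)" for h
    using omega_zidx_cube[OF cop, of h] by (simp_all add: numeral_dvd_eis_iff del: eis_re_simps(6) eis_om_simps(6))
  define P0 P1 P2 where "P0 = (\<Sum>h\<in>Z 0. ?P h)" "P1 = (\<Sum>h\<in>Z 1. ?P h)" "P2 = (\<Sum>h\<in>Z 2. ?P h)"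
  define Q0 Q1 Q2 where "Q0 = (\<Sum>h\<in>Z 0. ?Q h)" "Q1 = (\<Sum>h\<in>Z 1. ?Q h)" "Q2 = (\<Sum>h\<in>Z 2. ?Q h)"
  have Q: "4 dvd Q0" "4 dvd Q1" "4 dvd Q2"
    using Qj by (simp_all add: Q0_Q1_Q2_def)
  \<comment> \<open>\<open>omega\<close> sends \<open>P + Q * omega\<close> to
    \<open>- Q + (P - Q) * omega\<close>, and its square sends it to
    \<open>(Q - P) - P * omega\<close>.\<close>
  have s0: "(\<Sum>h\<in>Z 0. eis_re (omega ^ zidx (\<gamma> h) * \<gamma> h ^ 3)) = P0" "(\<Sum>h\<in>Z 0. eis_om (omega ^ zidx (\<gamma> h) * \<gamma> h ^ 3)) = Q0"
    by (simp_all add: P0_P1_P2_def Q0_Q1_Q2_def Z_def)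
  have s1: "(\<Sum>h\<in>Z 1. eis_re (omega ^ zidx (\<gamma> h) * \<gamma> h ^ 3)) = - Q1" "(\<Sum>h\<in>Z 1. eis_om (omega ^ zidx (\<gamma> h) * \<gamma> h ^ 3)) = P1 - Q1"
    by (simp_all add: P0_P1_P2_def Q0_Q1_Q2_def Z_def sum_negf sum_subtractf)
  have s2: "(\<Sum>h\<in>Z 2. eis_re (omega ^ zidx (\<gamma> h) * \<gamma> h ^ 3)) = Q2 - P2" "(\<Sum>h\<in>Z 2. eis_om (omega ^ zidx (\<gamma> h) * \<gamma> h ^ 3)) = - P2"
    by (simp_all add: P0_P1_P2_def Q0_Q1_Q2_def Z_def sum_negf sum_subtractf power2_eq_square)
  have "4 dvd (\<Sum>h\<in>UNIV. ?p h) - (\<Sum>h\<in>UNIV. eis_re (omega ^ zidx (\<gamma> h) * \<gamma> h ^ 3))"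
      "4 dvd (\<Sum>h\<in>UNIV. ?q h) - (\<Sum>h\<in>UNIV. eis_om (omega ^ zidx (\<gamma> h) * \<gamma> h ^ 3))"
    unfolding sum_subtractf[symmetric] using mod4 by (auto intro!: dvd_sum)
  moreover have "4 dvd (\<Sum>h\<in>UNIV. ?p h)" "4 dvd (\<Sum>h\<in>UNIV. ?q h)"
    using w4 by (simp_all flip: walsh_0)
  ultimately have re: "4 dvd P0 - Q1 + (Q2 - P2)" and om: "4 dvd Q0 + (P1 - Q1) - P2"
    unfolding split[of "\<lambda>h. eis_re (omega ^ zidx (\<gamma> h) * \<gamma> h ^ 3)"]
      split[of "\<lambda>h. eis_om (omega ^ zidx (\<gamma> h) * \<gamma> h ^ 3)"] s0 s1 s2 by presburger+
  \<comment> \<open>an affine map to the field with four elements that misses 0 also misses a nonzero value\<close>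
  have "Z 0 = {} \<or> Z 1 = {} \<or> Z 2 = {}"
  proof (rule ccontr)
    assume "\<not> ?thesis"
    then obtain g h k where "g \<in> Z 0" "h \<in> Z 1" "k \<in> Z 2"
      by blast
    then have "ob (?p g) = 1" "ob (?q g) = 0" "ob (?p h) = 0" "ob (?q h) = 1" "ob (?p k) = 1" "ob (?q k) = 1"
      using odd_or by (auto simp: Z_def zidx_def ob_def split: if_splits)
    then have "ob (?p (g + h + k)) = 0" "ob (?q (g + h + k)) = 0"
      unfolding affp[symmetric] affq[symmetric] aff_add3 by simp_all
    then show False
      using odd_or[of "g + h + k"] by (simp add: ob_def split: if_splits)
  qed
  then have "P0 = 0 \<or> P1 = 0 \<or> P2 = 0"
    by (auto simp: P0_P1_P2_def)
  \<comment> \<open>With all three \<open>Q\<close> sums divisible by 4, \<open>re\<close> says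
    \<open>P0 = P2\<close> and \<open>om\<close> says \<open>P1 = P2\<close> modulo 4.\<close>
  then have "4 dvd P0 + P1 + P2"
    using re om Q by presburger
  then have "4 dvd (\<Sum>h\<in>UNIV. ?P h)"
    unfolding split[of ?P] by (simp add: P0_P1_P2_def)
  then show ?thesis
    unfolding asgn_def using cube_parity[OF cop] by (subst sum_sgn4_eq_0_iff) simp_all
qed


section \<open>Character values on the classes R_a and Q_r\<close>

lemma eis_17_cases: "(17 :: eis) ^ (n mod 2) = (if even n then 1 else 17)"
  by (cases "even n") (auto simp: even_iff_mod_2_eq_zero odd_iff_mod_2_eq_one)

lemma eis_cop_17: "eis_cop (17 ^ (n mod 2))"
  unfolding eis_17_cases by (simp add: eis_cop_iff)

lemma of_nat_bit: "of_nat n = (if even n then 0 else 1 :: bit)"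
  by (induction n) auto

text \<open>17 is 1 modulo 8, hence invisible to \<open>asgn\<close> and \<open>bsgn\<close>, but it
  is -1 modulo \<open>lam\<close>.\<close>

lemma sgn_17: "lsgn (17 ^ (n mod 2)) = of_nat n" "asgn (17 ^ (n mod 2)) = 0" "bsgn (17 ^ (n mod 2)) = 0"
  unfolding eis_17_cases
  by (simp_all add: of_nat_bit lsgn_def asgn_def bsgn_def sgn3_def sgn4_def power3_eq_cube)

lemma sum_8_all_1:
  fixes e :: "idx \<Rightarrow> nat"
  assumes "\<And>h. e h > 0" "(\<Sum>h\<in>UNIV. e h) = 8"
  shows "e h = 1"
proof -
  have "8 = e h + (\<Sum>g\<in>UNIV - {h}. e g)"
    using sum.remove[of UNIV h e] assms(2) by simp
  moreover have "card (UNIV - {h}) * 1 \<le> (\<Sum>g\<in>UNIV - {h}. e g)"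
    using sum_bounded_below[of "UNIV - {h}" 1 e] assms(1) by (simp add: Suc_le_eq)
  ultimately show ?thesis
    using assms(1)[of h] by simp
qed

text \<open>All allowed \<open>u h\<close> are 1 modulo 3, so \<open>charA\<close> sees only the
  powers of 17, whose exponents add up to \<open>a\<close>. For \<open>a = 8\<close> every exponent
  is 1, and halving the lattice condition at 0 makes the sum of the \<open>u h\<close> divisible by
  4.\<close>

lemma R_setE:
  assumes "X \<in> R_set a"
  obtains x where "unit_tuple x" "X = theta x" "charA x = of_nat a" "\<And>v c. charB v c x = 0"
    "a \<in> {0, 8} \<Longrightarrow> charS x = 0"
proof (cases "a = 0")
  case True
  have "charA tone = 0" "charS tone = 0" "charB v c tone = 0" for v c
    using charA.E[of tone] charS.E[of tone] charB.E[of tone] by (simp_all add: E_tuple_def)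
  moreover have "X = theta tone"
    using assms True by (simp add: R_set_def theta_tone)
  ultimately show ?thesis
    using that[of tone] unit_tuple_tone True by simp
next
  case False
  then obtain e where e: "\<And>h. e h > 0" "(\<Sum>h\<in>UNIV. e h) = a" "X \<in> R_vec e"
    using assms by (auto simp: R_set_def)
  then obtain u where u: "X = theta (\<lambda>h. (u h, 17 ^ (e h mod 2)))" "\<And>h. u h \<in> {1, 7, 13, 19}"
    "\<And>h. 8 dvd walsh (\<lambda>g. 2 ^ e g * u g) h"
    unfolding R_vec_def by blast
  let ?x = "\<lambda>h. (u h, 17 ^ (e h mod 2))"
  have cop: "coprime (u h) 6 \<and> sgn3 (u h) = 0" for h
    using u(2)[of h] by (auto simp: coprime_6_iff sgn3_def)
  show ?thesis
  proof (rule that[of ?x])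
    show "unit_tuple ?x"
      using cop by (simp add: unit_tuple_def eis_cop_17)
    have "charA ?x = (\<Sum>h\<in>UNIV. of_nat (e h))"
      unfolding charA_def fst_conv snd_conv sgn_17 by (simp only: cop add_0 add_0_right)
    then show "charA ?x = of_nat a"
      using e(2) by (simp only: of_nat_sum[symmetric])
    show "charB v c ?x = 0" for v c
      by (simp add: charB_def sgn_17)
    show "charS ?x = 0" if "a \<in> {0, 8}"
    proof -
      have "e h = 1" for h
        using that False e by (intro sum_8_all_1) auto
      then have "8 dvd 2 * (\<Sum>h\<in>UNIV. u h)"
        using u(3)[of 0] by (simp add: walsh_0 sum_distrib_left)
      then have "4 dvd (\<Sum>h\<in>UNIV. u h)"
        by presburger
      then show ?thesis
        unfolding charS_def fst_conv using cop
        by (subst sum_sgn4_eq_0_iff) (simp_all add: coprime_6_iff)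
    qed
  qed (rule u(1))
qed

text \<open>The rational entries are 1, which kills \<open>charS\<close>. For \<open>r = 8\<close>
  each \<gamma> is 2 modulo \<open>lam\<close>; these eight signs cancel and
  \<open>charA_ones_eq_0\<close> handles the rest.\<close>

lemma Q_setE:
  assumes "X \<in> Q_set r"
  obtains x where "unit_tuple x" "X = theta x" "charS x = 0"
    "r \<in> {0, 8} \<Longrightarrow> (\<And>v c. charB v c x = 0) \<Longrightarrow> charA x = 0"
proof (cases "r = 0")
  case True
  have "charA tone = 0" "charS tone = 0" "charB v c tone = 0" for v c
    using charA.E[of tone] charS.E[of tone] charB.E[of tone] by (simp_all add: E_tuple_def)
  moreover have "X = theta tone"
    using assms True by (simp add: Q_set_def theta_tone)
  ultimately show ?thesis
    using that[of tone] unit_tuple_tone by simp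
next
  case False
  then obtain f where f: "\<And>h. f h > 0" "(\<Sum>h\<in>UNIV. f h) = r" "X \<in> Q_vec f"
    using assms by (auto simp: Q_set_def)
  then obtain \<gamma> where \<gamma>: "X = theta (\<lambda>h. (1, \<gamma> h))" "unit_tuple (\<lambda>h. (1, \<gamma> h))"
    "\<And>h. lam dvd \<gamma> h - 2 ^ f h" "\<And>h. 8 dvd walsh (\<lambda>g. 2 ^ f g * \<gamma> g) h"
    unfolding Q_vec_def residues_of_in_Gamma_iff by blast
  let ?x = "\<lambda>h. (1, \<gamma> h) :: int \<times> eis"
  show ?thesis
  proof (rule that[of ?x])
    show "charS ?x = 0"
      by (simp add: charS_def sgn4_def)
    show "charA ?x = 0" if "r \<in> {0, 8}" "\<And>v c. charB v c ?x = 0"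
    proof -
      have f1: "f h = 1" for h
        using that(1) False f by (intro sum_8_all_1) auto
      have "lsgn (\<gamma> h) = lsgn 2" for h
        using \<gamma>(3)[of h] by (intro lsgn_cong) (simp add: f1)
      then have "sgn3 (fst (?x h)) + lsgn (snd (?x h)) + asgn (snd (?x h)) = 1 + asgn (\<gamma> h)" for h
        by (simp add: lsgn_def sgn3_def)
      then have "charA ?x = (\<Sum>h\<in>(UNIV :: idx set). 1) + (\<Sum>h\<in>UNIV. asgn (\<gamma> h))"
        by (simp only: charA_def sum.distrib)
      also have "(\<Sum>h\<in>(UNIV :: idx set). 1 :: bit) = 0"
        by (simp only: sum_idx bit_add_cancel add.assoc)
      also have "(\<Sum>h\<in>UNIV. asgn (\<gamma> h)) = 0"
        using \<gamma>(2,4) that(2) by (intro charA_ones_eq_0) (simp_all add: unit_tuple_def f1 charB_def)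
      finally show ?thesis
        by simp
    qed
  qed (use \<gamma> in simp_all)
qed

text \<open>The class missed by \<open>C0 k\<close>, in terms of characters. Even \<open>k\<close>
  prescribes \<open>charS\<close> as well, which accounts for the extra factor C_2 in the
  quotient.\<close>

definition omitted :: "nat \<Rightarrow> (idx \<Rightarrow> int \<times> eis) \<Rightarrow> bool"
  where "omitted k x \<longleftrightarrow> (\<forall>v c. charB v c x = 0) \<and>
    (if even k then charA x = 1 \<and> charS x = 1 else charA x = 0)"

lemma C0_avoids:
  assumes k: "k \<in> {28, 29, 30, 31}" and X: "X \<in> C0 k"
  shows "\<exists>x. unit_tuple x \<and> X = theta x \<and> \<not> omitted k x"
proof -
  obtain a r Y Z where ar: "a + 2 * r = k" "a \<in> {0, 8} \<union> {12..}" "r \<in> {0, 8} \<union> {10..}"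
    and YZ: "Y \<in> R_set a" "Z \<in> Q_set r" "X = Y \<otimes>\<^bsub>H_grp\<^esub> Z"
    using X unfolding C0_def set_mult_def by blast
  from YZ(1) obtain y where y: "unit_tuple y" "Y = theta y" "charA y = of_nat a" "\<And>v c. charB v c y = 0"
    "a \<in> {0, 8} \<Longrightarrow> charS y = 0"
    by (rule R_setE) blast
  from YZ(2) obtain z where z: "unit_tuple z" "Z = theta z" "charS z = 0"
    "r \<in> {0, 8} \<Longrightarrow> (\<And>v c. charB v c z = 0) \<Longrightarrow> charA z = 0"
    by (rule Q_setE) blast
  \<comment> \<open>Otherwise \<open>a \<ge> 12\<close> and \<open>r \<ge> 10\<close>, so that
    \<open>k \<ge> 32\<close>.\<close>
  have "r \<in> {0, 8} \<or> a \<in> {0, 8}"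
    using k ar by auto
  moreover have "even k" if "a \<in> {0, 8}"
    using that unfolding ar(1)[symmetric] by auto
  ultimately have cases: "r \<in> {0, 8} \<or> even k \<and> a \<in> {0, 8}"
    by blast
  have "\<not> omitted k (tmul y z)"
  proof
    assume om: "omitted k (tmul y z)"
    then have B: "charB v c z = 0" for v c
      using y z unfolding omitted_def by (simp add: charB.mult)
    have "even k \<longleftrightarrow> even a"
      using ar(1) by auto
    then have "of_nat a = (if even k then 0 else 1 :: bit)"
      by (simp add: of_nat_bit)
    then have A: "charA (tmul y z) = (if even k then 0 else 1) + charA z"
      and S: "charS (tmul y z) = charS y"
      using y z by (simp_all add: charA.mult charS.mult)
    show False
      using cases
    proof
      assume "r \<in> {0, 8}"
      then have "charA z = 0"
        using z(4) B by blast
      then show False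
        using om A unfolding omitted_def by (simp split: if_splits)
    next
      assume "even k \<and> a \<in> {0, 8}"
      then show False
        using om S y(5) unfolding omitted_def by simp
    qed
  qed
  moreover have "X = theta (tmul y z)" "unit_tuple (tmul y z)"
    using YZ(3) y z by (simp_all add: theta_mult unit_tuple_tmul_iff)
  ultimately show ?thesis
    by blast
qed

subsection \<open>Coverage\<close>

lemma seventeen_pow: "8 dvd (17 :: int) ^ n - 1" "8 dvd (17 :: eis) ^ n - 1"
proof -
  have "(17 :: int) - 1 dvd 17 ^ n - 1 ^ n" "(17 :: eis) - 1 dvd 17 ^ n - 1 ^ n"
    unfolding power_diff_sumr2 by simp_all
  moreover have "(8 :: int) dvd 17 - 1" "(8 :: eis) dvd 17 - 1"
    by (simp_all add: numeral_dvd_eis_iff)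
  ultimately show "8 dvd (17 :: int) ^ n - 1" "8 dvd (17 :: eis) ^ n - 1"
    by (auto intro: dvd_trans)
qed

lemma pow_mod3: "3 dvd (17 :: int) ^ n - (- 1) ^ n" "3 dvd (2 :: int) ^ n - (- 1) ^ n"
proof -
  have "(17 :: int) - (- 1) dvd 17 ^ n - (- 1) ^ n" "(2 :: int) - (- 1) dvd 2 ^ n - (- 1) ^ n"
    unfolding power_diff_sumr2 by simp_all
  then show "3 dvd (17 :: int) ^ n - (- 1) ^ n" "3 dvd (2 :: int) ^ n - (- 1) ^ n"
    using dvd_trans[of 3 18 "(17 :: int) ^ n - (- 1) ^ n"] by simp_all
qed

lemma lam_dvd_of_int: "lam dvd of_int n \<longleftrightarrow> 3 dvd n"
  by (simp add: lam_dvd_iff)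

text \<open>The listed values are the units modulo 24 that are 1 modulo 3. As 17 is -1 modulo 3, at
  most one factor 17 is required.\<close>

lemma R_residue:
  fixes n :: int
  assumes "coprime n 6"
  shows "\<exists>i u. u \<in> {1, 7, 13, 19} \<and> 24 dvd u - n * 17 ^ i"
proof -
  have "n mod 24 \<in> {1, 5, 7, 11, 13, 17, 19, 23}"
    using assms unfolding coprime_6_iff by simp presburger
  moreover have "17 * n mod 24 = 17 * (n mod 24) mod 24"
    by (simp add: mod_mult_right_eq)
  ultimately have "n mod 24 \<in> {1, 7, 13, 19} \<or> 17 * n mod 24 \<in> {1, 7, 13, 19}"
    by auto
  then show ?thesis
  proof
    assume "n mod 24 \<in> {1, 7, 13, 19}"
    moreover have "24 dvd n mod 24 - n * 17 ^ 0"
      by (simp; presburger)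
    ultimately show ?thesis
      by blast
  next
    assume "17 * n mod 24 \<in> {1, 7, 13, 19}"
    moreover have "24 dvd 17 * n mod 24 - n * 17 ^ 1"
      by (simp; presburger)
    ultimately show ?thesis
      by blast
  qed
qed

text \<open>
  Since 17 is 1 modulo 8 and \<open>- 1\<close> modulo \<open>lam\<close>, its powers adjust the residues modulo \<open>lam\<close> without
  affecting the lattice conditions.
\<close>

lemma theta_in_sumset:
  fixes e f :: "idx \<Rightarrow> nat" and \<epsilon> :: "idx \<Rightarrow> int" and \<xi> :: "idx \<Rightarrow> eis"
  assumes x: "unit_tuple x"
    and \<epsilon>: "\<And>h. \<epsilon> h \<in> {1, - 1}" "(\<Prod>h\<in>UNIV. \<epsilon> h) = 1" and \<xi>: "\<And>h. \<xi> h dvd 1"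
    and lam: "\<And>h. lam dvd \<xi> h * snd (x h) - of_int ((- 1) ^ (e h + f h) * \<epsilon> h * fst (x h))"
    and R: "\<And>h. 8 dvd walsh (\<lambda>g. 2 ^ e g * (\<epsilon> g * fst (x g))) h"
    and Q: "\<And>h. 8 dvd walsh (\<lambda>g. 2 ^ f g * (\<xi> g * snd (x g))) h"
  shows "theta x \<in> R_vec e <#>\<^bsub>H_grp\<^esub> Q_vec f"
proof -
  have E: "E_tuple (\<lambda>h. (\<epsilon> h, \<xi> h))"
    using \<epsilon> \<xi> by (simp add: E_tuple_def)
  have "unit_tuple (tmul (\<lambda>h. (\<epsilon> h, \<xi> h)) x)"
    using E x by (simp add: unit_tuple_tmul_iff E_tuple_unit)
  then have cop: "coprime (\<epsilon> h * fst (x h)) 6" "eis_cop (\<xi> h * snd (x h))" for h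
    by (simp_all add: unit_tuple_def)
  have "\<forall>h. \<exists>i u. u \<in> {1, 7, 13, 19} \<and> 24 dvd u - \<epsilon> h * fst (x h) * 17 ^ i"
    using R_residue[OF cop(1)] by blast
  then obtain i u where u: "\<And>h. u h \<in> {1, 7, 13, 19}" "\<And>h. 24 dvd u h - \<epsilon> h * fst (x h) * 17 ^ i h"
    by metis
  \<comment> \<open>The factor \<open>17 ^ i h\<close> keeps pace with the rational component modulo
    \<open>lam\<close>, and \<open>17 ^ e h\<close> offsets the component
    \<open>17 ^ (e h mod 2)\<close> of the R-class.\<close>
  define \<gamma> where "\<gamma> h = \<xi> h * snd (x h) * 17 ^ (i h + e h)" for h
  have u_unit: "unit_tuple (\<lambda>h. (u h, 17 ^ (e h mod 2)))"
  proof -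
    have "coprime (u h) 6" for h
      using u(1)[of h] by (auto simp: coprime_6_iff)
    then show ?thesis
      by (simp add: unit_tuple_def eis_cop_17)
  qed
  have cop17: "eis_cop (17 ^ n)" for n
    using eis_cop_mult_iff by (induction n) (auto simp: eis_cop_one, auto simp: eis_cop_iff)
  then have \<gamma>_unit: "unit_tuple (\<lambda>h. (1, \<gamma> h))"
    using cop(2) by (simp add: unit_tuple_def \<gamma>_def eis_cop_mult_iff)
  have "8 dvd walsh (\<lambda>g. 2 ^ e g * u g) h" for h
  proof (subst dvd_walsh_cong)
    fix g
    have "8 dvd u g - \<epsilon> g * fst (x g) * 17 ^ i g"
      using u(2)[of g] by (rule dvd_trans[rotated]) simp
    then have "8 dvd (u g - \<epsilon> g * fst (x g) * 17 ^ i g) + \<epsilon> g * fst (x g) * (17 ^ i g - 1)"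
      by (intro dvd_add dvd_mult seventeen_pow)
    then have "8 dvd u g - \<epsilon> g * fst (x g)"
      by (simp add: algebra_simps)
    then show "8 dvd 2 ^ e g * u g - 2 ^ e g * (\<epsilon> g * fst (x g))"
      unfolding right_diff_distrib[symmetric] by (rule dvd_mult)
  qed (rule R)
  then have 1: "theta (\<lambda>h. (u h, 17 ^ (e h mod 2))) \<in> R_vec e"
    unfolding R_vec_def using u(1) by blast
  have "8 dvd walsh (\<lambda>g. 2 ^ f g * \<gamma> g) h" for h
  proof (subst dvd_walsh_cong)
    fix g
    have "8 dvd \<xi> g * snd (x g) * (17 ^ (i g + e g) - 1)"
      by (intro dvd_mult seventeen_pow)
    then have "8 dvd \<gamma> g - \<xi> g * snd (x g)"
      by (simp add: \<gamma>_def right_diff_distrib)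
    then show "8 dvd 2 ^ f g * \<gamma> g - 2 ^ f g * (\<xi> g * snd (x g))"
      unfolding right_diff_distrib[symmetric] by (rule dvd_mult)
  qed (rule Q)
  moreover have "lam dvd \<gamma> h - 2 ^ f h" for h
  proof -
    let ?n = "\<epsilon> h * fst (x h)"
    have "3 dvd u h - 1"
      using u(1)[of h] by auto
    then have "3 dvd ?n * 17 ^ i h - 1"
      using u(2)[of h] by presburger
    then obtain r where r: "?n * 17 ^ i h = 1 + 3 * r"
      by (auto elim!: dvdE simp: algebra_simps)
    obtain s where s: "(17 :: int) ^ e h = (- 1) ^ e h + 3 * s"
      using pow_mod3(1)[of "e h"] by (auto elim!: dvdE simp: algebra_simps)
    obtain t where t: "(2 :: int) ^ f h = (- 1) ^ f h + 3 * t"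
      using pow_mod3(2)[of "f h"] by (auto elim!: dvdE simp: algebra_simps)
    \<comment> \<open>Modulo 3 one has \<open>?n * 17 ^ i h = 1\<close>, while 17 and 2 are both -1;
      this explains the sign in the hypothesis \<open>lam\<close>.\<close>
    have "(- 1) ^ (e h + f h) * ?n * 17 ^ (i h + e h) - 2 ^ f h =
        (- 1) ^ e h * (- 1) ^ f h * (?n * 17 ^ i h) * 17 ^ e h - 2 ^ f h"
      by (simp add: power_add)
    also have "\<dots> = ((- 1) ^ e h * (- 1) ^ e h - 1) * (- 1) ^ f h + 3 * ((- 1) ^ e h * (- 1) ^ f h * (r * 17 ^ e h + s) - t)"
      unfolding r s t by (simp add: algebra_simps)
    also have "\<dots> = 3 * ((- 1) ^ e h * (- 1) ^ f h * (r * 17 ^ e h + s) - t)"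
      by (simp flip: power_add)
    finally have "3 dvd (- 1) ^ (e h + f h) * ?n * 17 ^ (i h + e h) - 2 ^ f h"
      by simp
    then have "lam dvd of_int ((- 1) ^ (e h + f h) * ?n * 17 ^ (i h + e h) - 2 ^ f h)"
      by (simp only: lam_dvd_of_int)
    moreover have "lam dvd (\<xi> h * snd (x h) - of_int ((- 1) ^ (e h + f h) * \<epsilon> h * fst (x h))) * 17 ^ (i h + e h)"
      using lam by (rule dvd_mult2)
    ultimately have "lam dvd (\<xi> h * snd (x h) - of_int ((- 1) ^ (e h + f h) * \<epsilon> h * fst (x h))) * 17 ^ (i h + e h)
        + of_int ((- 1) ^ (e h + f h) * ?n * 17 ^ (i h + e h) - 2 ^ f h)"
      by (rule dvd_add[rotated])
    then show ?thesis
      unfolding \<gamma>_def by (simp add: algebra_simps)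
  qed
  ultimately have 2: "theta (\<lambda>h. (1, \<gamma> h)) \<in> Q_vec f"
    unfolding Q_vec_def residues_of_in_Gamma_iff using \<gamma>_unit by blast
  have 3: "theta (tmul (\<lambda>h. (u h, 17 ^ (e h mod 2))) (\<lambda>h. (1, \<gamma> h))) = theta x"
  proof (rule theta_eqI[OF x E])
    \<comment> \<open>This is the remaining discrepancy. It lies in L because powers of 17 are 1
      modulo 8 and the two exponents at \<open>h\<close> have equal parity.\<close>
    let ?l = "\<lambda>h. (17 ^ i h, 17 ^ (e h mod 2 + (i h + e h))) :: int \<times> eis"
    show "L_tuple ?l"
      unfolding L_tuple_def
    proof (intro conjI allI)
      show "unit_tuple ?l"
        using coprime_6_iff[of 17] by (simp add: unit_tuple_def cop17 coprime_power_left_iff)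
      fix h
      have "even (e h mod 2 + e h)"
        by simp
      then have "3 dvd (17 :: int) ^ (e h mod 2 + e h) - 1"
        using pow_mod3(1)[of "e h mod 2 + e h"] by (simp only: power_minus_even power_one)
      then have "3 dvd (17 :: int) ^ i h * (17 ^ (e h mod 2 + e h) - 1)"
        by (rule dvd_mult)
      also have "(17 :: int) ^ i h * (17 ^ (e h mod 2 + e h) - 1) = 17 ^ (e h mod 2 + (i h + e h)) - 17 ^ i h"
        by (simp add: power_add right_diff_distrib mult_ac)
      finally have "3 dvd (17 :: int) ^ i h - 17 ^ (e h mod 2 + (i h + e h))"
        by (subst dvd_diff_commute)
      then show "lam dvd of_int (fst (?l h)) - snd (?l h)"
        using lam_dvd_of_int[of "17 ^ i h - 17 ^ (e h mod 2 + (i h + e h))"] by simp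
      show "8 dvd walsh (\<lambda>g. fst (?l g)) h" "8 dvd walsh (\<lambda>g. snd (?l g)) h"
        by (simp_all add: dvd_walsh_cong[of 8 _ "\<lambda>_. 1"] seventeen_pow walsh_one)
    qed
    fix h
    show "24 dvd fst (tmul (\<lambda>h. (u h, 17 ^ (e h mod 2))) (\<lambda>h. (1, \<gamma> h)) h) -
        fst (tmul (tmul (\<lambda>h. (\<epsilon> h, \<xi> h)) ?l) x h)"
      using u(2)[of h] by (simp add: mult_ac)
    show "8 * lam dvd snd (tmul (\<lambda>h. (u h, 17 ^ (e h mod 2))) (\<lambda>h. (1, \<gamma> h)) h) -
        snd (tmul (tmul (\<lambda>h. (\<epsilon> h, \<xi> h)) ?l) x h)"
      by (simp add: \<gamma>_def power_add mult_ac)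
  qed
  show ?thesis
    unfolding set_mult_def using 1 2 3 theta_mult[OF u_unit \<gamma>_unit] by force
qed

definition sg :: "bit \<Rightarrow> int"
  where "sg b = (if b = 0 then 1 else - 1)"

lemma sg_add: "sg (b + c) = sg b * sg c"
  by (cases b; cases c) (simp_all add: sg_def)

lemma sg_sg [simp]: "sg b * sg b = 1"
  by (simp add: sg_def)

lemma sg_of_nat: "sg (of_nat n) = (- 1) ^ n"
  by (simp add: sg_def of_nat_bit)

lemma prod_sg: "(\<Prod>h\<in>A. sg (z h)) = sg (\<Sum>h\<in>A. z h)"
  by (induction A rule: infinite_finite_induct) (simp_all add: sg_add, simp_all add: sg_def)

lemma lam_dvd_omega_pow: "lam dvd omega ^ n - 1"
proof -
  have "omega - 1 dvd omega ^ n - 1 ^ n"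
    unfolding power_diff_sumr2 by simp
  moreover have "lam dvd omega - 1"
    by (simp add: lam_dvd_iff)
  ultimately show ?thesis
    by (auto intro: dvd_trans)
qed

lemma sgn3_mod3: "3 dvd n - sg (sgn3 n)" if "\<not> 3 dvd n"
  using that unfolding sgn3_def sg_def by (simp; presburger)

lemma cube_mod4: "4 dvd x ^ 3 - Eis (1 + 2 * ib (asgn x)) (2 * ib (bsgn x))" if "\<not> 2 dvd x"
proof -
  have "4 dvd eis_re (x ^ 3) - (1 + 2 * ib (asgn x))"
    unfolding asgn_def by (rule sgn4_mod4) (rule cube_parity[OF that])
  moreover have "4 dvd eis_om (x ^ 3) - 2 * ib (bsgn x)"
    using cube_parity(2)[OF that] unfolding bsgn_def by (simp; presburger)
  ultimately show ?thesis
    by (simp add: numeral_dvd_eis_iff del: eis_re_simps(6) eis_om_simps(6))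
qed

text \<open>The sign of the unit is forced modulo \<open>lam\<close>; its \<open>omega\<close>-part is free.\<close>

lemma unit_normalisation:
  assumes "coprime a 6" "eis_cop x"
  shows "\<exists>\<xi>. \<xi> dvd 1 \<and> lam dvd \<xi> * x - of_int (sg \<delta> * a) \<and>
    4 dvd \<xi> * x - omega ^ n * Eis (1 + 2 * ib (\<delta> + (sgn3 a + lsgn x + asgn x))) (2 * ib (bsgn x))"
proof -
  \<comment> \<open>The sign \<open>t\<close> achieves the congruence modulo \<open>lam\<close>. The
    exponent \<open>m\<close> replaces the residue of \<open>x\<close> modulo 2 by that of
    \<open>omega ^ n\<close>, since \<open>2 * zidx x\<close> is \<open>- zidx x\<close> modulo
    3.\<close>
  define t where "t = \<delta> + sgn3 a + lsgn x"
  define m where "m = n + 2 * zidx x"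
  let ?\<xi> = "of_int (sg t) * omega ^ m"
  have [simp]: "\<not> 2 dvd x" "\<not> lam dvd x" "\<not> 3 dvd a"
    using assms by (auto simp: eis_cop_def coprime_6_iff)
  have "omega ^ m * omega ^ (2 * m) = (omega ^ 3) ^ m"
    by (simp flip: power_add power_mult)
  then have "of_int (sg t * sg t) * (omega ^ m * omega ^ (2 * m)) = 1"
    by (simp only: omega_cube sg_sg) simp
  then have "1 = ?\<xi> * (of_int (sg t) * omega ^ (2 * m))"
    by (simp only: of_int_mult mult_ac)
  then have "?\<xi> dvd 1"
    by (rule dvdI)
  moreover have "lam dvd ?\<xi> * x - of_int (sg \<delta> * a)"
  proof -
    have "3 dvd (eis_re x + eis_om x) - sg (lsgn x)"
      unfolding lsgn_def using \<open>\<not> lam dvd x\<close> unfolding lam_dvd_iff by (rule sgn3_mod3)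
    then have "lam dvd x - of_int (sg (lsgn x))"
      by (simp add: lam_dvd_iff algebra_simps)
    moreover have "lam dvd of_int (sg (sgn3 a) - a)"
      unfolding lam_dvd_of_int by (subst dvd_diff_commute) (simp add: sgn3_mod3)
    ultimately have "lam dvd of_int (sg t) * x * (omega ^ m - 1) + of_int (sg t) * (x - of_int (sg (lsgn x)))
        + of_int (sg \<delta>) * of_int (sg (sgn3 a) - a)"
      using lam_dvd_omega_pow by (intro dvd_add dvd_mult)
    moreover have "sg t * sg (lsgn x) = sg \<delta> * sg (sgn3 a)"
      by (cases \<delta>; cases "sgn3 a"; cases "lsgn x"; simp add: t_def sg_def)
    then have "of_int (sg t) * of_int (sg (lsgn x)) = (of_int (sg \<delta>) * of_int (sg (sgn3 a)) :: eis)"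
      by (metis of_int_mult)
    ultimately show ?thesis
      by (simp add: algebra_simps)
  qed
  moreover have "4 dvd ?\<xi> * x - omega ^ n * Eis (1 + 2 * ib (\<delta> + (sgn3 a + lsgn x + asgn x))) (2 * ib (bsgn x))"
  proof -
    have "omega ^ m * omega ^ zidx x = omega ^ n * (omega ^ 3) ^ zidx x"
      by (simp add: m_def add.commute flip: power_add power_mult)
    then have "omega ^ m * (omega ^ zidx x * x ^ 3) = omega ^ n * x ^ 3"
      by (simp add: omega_cube flip: mult.assoc)
    then have "?\<xi> * x - of_int (sg t) * omega ^ n * x ^ 3 = ?\<xi> * (x - omega ^ zidx x * x ^ 3)"
      by (simp only: right_diff_distrib mult.assoc)
    moreover have "4 dvd ?\<xi> * (x - omega ^ zidx x * x ^ 3)"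
      by (rule dvd_mult) (simp add: omega_zidx_cube)
    ultimately have 1: "4 dvd ?\<xi> * x - of_int (sg t) * omega ^ n * x ^ 3"
      by (simp only:)
    have 2: "4 dvd of_int (sg t) * omega ^ n * (x ^ 3 - Eis (1 + 2 * ib (asgn x)) (2 * ib (bsgn x)))"
      by (rule dvd_mult) (simp add: cube_mod4)
    have "\<delta> + (sgn3 a + lsgn x + asgn x) = t + asgn x"
      by (simp only: t_def add.assoc)
    then have 3: "4 dvd omega ^ n * (of_int (sg t) * Eis (1 + 2 * ib (asgn x)) (2 * ib (bsgn x))
        - Eis (1 + 2 * ib (\<delta> + (sgn3 a + lsgn x + asgn x))) (2 * ib (bsgn x)))"
      by (intro dvd_mult) (cases t; cases "asgn x"; cases "bsgn x"; simp add: numeral_dvd_eis_iff sg_def)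
    show ?thesis
      using dvd_add[OF dvd_add[OF 1 2] 3] by (simp only: right_diff_distrib mult_ac add_diff_cancel_left' diff_add_cancel add_diff_eq)
  qed
  ultimately show ?thesis
    by blast
qed

text \<open>An affine function takes the value 1 at 0, 4 or 8 points.\<close>

lemma sum_ib_aff: "4 dvd (\<Sum>h\<in>UNIV. ib (aff v c h))"
proof -
  have "\<forall>v. \<forall>c. 4 dvd (\<Sum>h\<in>UNIV. ib (aff v c h))"
    unfolding all_idx all_bit sum_idx aff_def by simp
  then show ?thesis
    by blast
qed

lemma even_sum_ib_aff: "even (\<Sum>h | dot w h = 1. ib (aff v c h))"
proof -
  have *: "\<forall>w v c. even (\<Sum>h\<in>UNIV. if dot w h = 1 then ib (aff v c h) else 0)"
    unfolding all_idx all_bit sum_idx aff_def by simp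
  have "(\<Sum>h | dot w h = 1. ib (aff v c h)) = (\<Sum>h\<in>UNIV. if dot w h = 1 then ib (aff v c h) else 0)"
    by (simp add: sum.inter_filter[symmetric])
  then show ?thesis
    using * by metis
qed

text \<open>Affine parities make every plane sum even, so by \<open>sum_plane\<close> all transforms
  agree modulo 4 with the one at 0. There the single bit condition on \<open>z\<close>
  decides.\<close>

lemma half_lattice:
  assumes "\<And>h. 4 dvd y h - (ib (aff v c h) + 2 * ib (z h))" "(\<Sum>h\<in>UNIV. z h) = 0"
  shows "4 dvd walsh y w"
proof -
  have "4 dvd (\<Sum>h\<in>UNIV. y h - (ib (aff v c h) + 2 * ib (z h)))"
    using assms(1) by (intro dvd_sum)
  moreover have "(\<Sum>h\<in>UNIV. y h - (ib (aff v c h) + 2 * ib (z h))) =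
      (\<Sum>h\<in>UNIV. y h) - ((\<Sum>h\<in>UNIV. ib (aff v c h)) + 2 * (\<Sum>h\<in>UNIV. ib (z h)))"
    by (simp only: sum_subtractf sum.distrib sum_distrib_left)
  moreover have "even (\<Sum>h\<in>UNIV. ib (z h))"
    using assms(2) unfolding sum_bit_eq_0_iff .
  ultimately have 0: "4 dvd walsh y 0"
    unfolding walsh_0 using sum_ib_aff[where v = v and c = c] by presburger
  have "even (y h - ib (aff v c h))" for h
    using assms(1)[of h] by presburger
  then have "even (\<Sum>h | dot w h = 1. y h - ib (aff v c h))"
    by (rule dvd_sum)
  then have "even (\<Sum>h | dot w h = 1. y h)"
    unfolding sum_subtractf using even_sum_ib_aff[where w = w and v = v and c = c] by simp
  then show ?thesis
    using sum_plane[where v = w and c = 1 and a = y] 0 by simp presburger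
qed

lemma walsh_double: "8 dvd walsh (\<lambda>g. 2 * y g) h \<longleftrightarrow> 4 dvd walsh y h" for y :: "idx \<Rightarrow> int"
  unfolding walsh_mult_left by presburger

text \<open>Here \<open>\<delta>\<close> encodes the tuple of rational signs, \<open>n\<close> the residues modulo 2 of the \<open>O\<close>-components.\<close>

lemma theta_in_sumset_bits:
  fixes e f n :: "idx \<Rightarrow> nat" and \<delta> :: "idx \<Rightarrow> bit"
  assumes x: "unit_tuple x" and \<delta>: "(\<Sum>h\<in>UNIV. \<delta> h) = 0" and pos: "\<And>h. e h > 0" "\<And>h. f h > 0"
    and R: "\<And>h. 4 dvd walsh (\<lambda>g. 2 ^ (e g - 1) * (sg (\<delta> g) * fst (x g))) h"
    and Q: "\<And>y h. (\<And>g. 4 dvd y g - 2 ^ (f g - 1) * (omega ^ n g * Eis (1 + 2 * ib (of_nat (e g + f g) + \<delta> g +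
        (sgn3 (fst (x g)) + lsgn (snd (x g)) + asgn (snd (x g))))) (2 * ib (bsgn (snd (x g)))))) \<Longrightarrow>
      4 dvd walsh (\<lambda>g. eis_re (y g)) h \<and> 4 dvd walsh (\<lambda>g. eis_om (y g)) h"
  shows "theta x \<in> R_vec e <#>\<^bsub>H_grp\<^esub> Q_vec f"
proof -
  have unit: "coprime (fst (x h)) 6" "eis_cop (snd (x h))" for h
    using x by (simp_all add: unit_tuple_def)
  have "\<forall>h. \<exists>\<xi>. \<xi> dvd 1 \<and> lam dvd \<xi> * snd (x h) - of_int (sg (of_nat (e h + f h) + \<delta> h) * fst (x h)) \<and>
    4 dvd \<xi> * snd (x h) - omega ^ n h * Eis (1 + 2 * ib (of_nat (e h + f h) + \<delta> h +
        (sgn3 (fst (x h)) + lsgn (snd (x h)) + asgn (snd (x h))))) (2 * ib (bsgn (snd (x h))))"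
    using unit_normalisation[OF unit] by blast
  then obtain \<xi> where \<xi>: "\<And>h. \<xi> h dvd 1"
    "\<And>h. lam dvd \<xi> h * snd (x h) - of_int (sg (of_nat (e h + f h) + \<delta> h) * fst (x h))"
    "\<And>h. 4 dvd \<xi> h * snd (x h) - omega ^ n h * Eis (1 + 2 * ib (of_nat (e h + f h) + \<delta> h +
        (sgn3 (fst (x h)) + lsgn (snd (x h)) + asgn (snd (x h))))) (2 * ib (bsgn (snd (x h))))"
    by metis
  \<comment> \<open>Positive exponents allow one factor 2 to be split off, lowering the modulus from
    8 to 4.\<close>
  have pow: "2 ^ e h = (2 * 2 ^ (e h - 1) :: int)" "2 ^ f h = (2 * 2 ^ (f h - 1) :: eis)" for h
    using pos[of h] by (simp_all flip: power_Suc)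
  show ?thesis
  proof (rule theta_in_sumset[OF x])
    show "sg (\<delta> h) \<in> {1, - 1}" for h
      by (simp add: sg_def)
    show "(\<Prod>h\<in>UNIV. sg (\<delta> h)) = 1"
      unfolding prod_sg \<delta> by (simp add: sg_def)
    show "\<xi> h dvd 1" for h
      by (rule \<xi>)
    show "lam dvd \<xi> h * snd (x h) - of_int ((- 1) ^ (e h + f h) * sg (\<delta> h) * fst (x h))" for h
      using \<xi>(2)[of h] unfolding sg_add sg_of_nat .
    show "8 dvd walsh (\<lambda>g. 2 ^ e g * (sg (\<delta> g) * fst (x g))) h" for h
      unfolding pow mult.assoc walsh_double by (rule R)
    define y where "y g = 2 ^ (f g - 1) * (\<xi> g * snd (x g))" for g
    have "4 dvd walsh (\<lambda>g. eis_re (y g)) h \<and> 4 dvd walsh (\<lambda>g. eis_om (y g)) h" for h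
    proof (rule Q)
      show "4 dvd y g - 2 ^ (f g - 1) * (omega ^ n g * Eis (1 + 2 * ib (of_nat (e g + f g) + \<delta> g +
        (sgn3 (fst (x g)) + lsgn (snd (x g)) + asgn (snd (x g))))) (2 * ib (bsgn (snd (x g)))))" for g
        unfolding y_def right_diff_distrib[symmetric] by (rule dvd_mult) (rule \<xi>)
    qed
    then show "8 dvd walsh (\<lambda>g. 2 ^ f g * (\<xi> g * snd (x g))) h" for h
      unfolding pow mult.assoc y_def[symmetric] dvd_walsh_eis by (simp add: walsh_double)
  qed
qed

lemma dot_separates:
  assumes "w \<noteq> 0" "w \<noteq> v"
  shows "\<exists>h. dot w h = 1 \<and> dot v h = 0"
proof -
  have "\<forall>w v. w \<noteq> pt 0 0 0 \<longrightarrow> w \<noteq> v \<longrightarrow> (\<exists>h. dot w h = 1 \<and> dot v h = 0)"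
    unfolding all_idx ex_idx all_bit ex_bit by simp
  then show ?thesis
    using assms unfolding pt_0 by blast
qed

text \<open>Distinct nonzero \<open>w\<close> and \<open>v\<close> are linearly independent, so
  \<open>dot w\<close> and \<open>aff v c\<close> jointly take all four pairs of values.\<close>

lemma independent_planes:
  assumes "w \<noteq> 0" "v \<noteq> 0" "w \<noteq> v"
  shows "\<exists>\<delta>. (\<Sum>h\<in>UNIV. \<delta> h) = 0 \<and> (\<Sum>h\<in>UNIV. dot w h * \<delta> h) = s \<and> (\<Sum>h\<in>UNIV. aff v c h * \<delta> h) = t"
proof -
  obtain g h where "dot w g = 1" "dot v g = 0" "dot v h = 1" "dot w h = 0"
    using dot_separates[of w v] dot_separates[of v w] assms by metis
  then have "dot w (if j = 0 then if i = 0 then 0 else g else if i = 0 then h else g + h) = i \<and>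
      dot v (if j = 0 then if i = 0 then 0 else g else if i = 0 then h else g + h) = j" for i j
    by (cases i; cases j) (simp_all add: dot_add)
  then have "\<exists>h. dot w h = i \<and> aff v c h = j" for i j
    unfolding aff_def by (metis add.assoc add_0_right bit_add_cancel(1))
  then obtain h1 h2 h3 where h: "dot w h1 = 1" "aff v c h1 = 0" "dot w h2 = 0" "aff v c h2 = 1"
    "dot w h3 = 0" "aff v c h3 = 0"
    by metis
  \<comment> \<open>\<open>h1\<close> carries \<open>s\<close>, \<open>h2\<close> carries
    \<open>t\<close>, and \<open>h3\<close>, invisible to both weights, restores total sum
    0.\<close>
  define \<delta> where "\<delta> h = (if h = h1 then s else 0) + (if h = h2 then t else 0) + (if h = h3 then s + t else 0)" for h
  have *: "b * (if P then c else 0) = (if P then b * c else 0)" for b c :: bit and P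
    by simp
  have sum: "(\<Sum>h\<in>UNIV. z h * \<delta> h) = z h1 * s + z h2 * t + z h3 * (s + t)" for z
  proof -
    have "(\<Sum>h\<in>UNIV. z h * \<delta> h) = (\<Sum>h\<in>UNIV. if h = h1 then z h * s else 0) +
        (\<Sum>h\<in>UNIV. if h = h2 then z h * t else 0) + (\<Sum>h\<in>UNIV. if h = h3 then z h * (s + t) else 0)"
      unfolding sum.distrib[symmetric] by (simp only: \<delta>_def distrib_left *)
    then show ?thesis
      by (simp only: sum.delta finite_idx UNIV_I if_True)
  qed
  have "(\<Sum>h\<in>UNIV. \<delta> h) = 0"
    using sum[of "\<lambda>_. 1"] unfolding mult_1 by (simp only: bit_add_cancel)
  moreover have "(\<Sum>h\<in>UNIV. dot w h * \<delta> h) = s" "(\<Sum>h\<in>UNIV. aff v c h * \<delta> h) = t"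
    unfolding sum h by simp_all
  ultimately show ?thesis
    by blast
qed

lemma charB_linear: "charB v c x = v $ 1 * charB (pt 1 0 0) 0 x + v $ 2 * charB (pt 0 1 0) 0 x +
    v $ 3 * charB (pt 0 0 1) 0 x + c * charB 0 1 x"
proof -
  have "aff v c h = v $ 1 * aff (pt 1 0 0) 0 h + v $ 2 * aff (pt 0 1 0) 0 h + v $ 3 * aff (pt 0 0 1) 0 h + c * aff 0 1 h" for h
    by (simp only: aff_def dot_def pt_nth mult_1 mult_zero_left add_0 add_0_right zero_index mult_1_right)
  then show ?thesis
    unfolding charB_def by (simp only: sum_distrib_left distrib_right sum.distrib mult.assoc)
qed

text \<open>A nonzero linear form takes each value on eight of the sixteen affine functions, of
  which only two are constant. For the zero form the value must be 0, and any nonconstant function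
  will do.\<close>

lemma charB_hits:
  assumes "\<not> ((\<forall>v c. charB v c x = 0) \<and> t = 1)"
  shows "\<exists>v c. v \<noteq> 0 \<and> charB v c x = t"
proof -
  let ?b1 = "charB (pt 1 0 0) 0 x" and ?b2 = "charB (pt 0 1 0) 0 x" and ?b3 = "charB (pt 0 0 1) 0 x"
    and ?b0 = "charB 0 1 x"
  have "charB v c x = 0" if "?b0 = 0" "?b1 = 0" "?b2 = 0" "?b3 = 0" for v c
    unfolding charB_linear[of v c x] that by simp
  then have neg: "\<not> (?b0 = 0 \<and> ?b1 = 0 \<and> ?b2 = 0 \<and> ?b3 = 0 \<and> t = 1)"
    using assms by blast
  have hits: "\<forall>b0 b1 b2 b3 t. \<not> (b0 = 0 \<and> b1 = 0 \<and> b2 = 0 \<and> b3 = 0 \<and> t = 1) \<longrightarrow>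
      (\<exists>x y z c :: bit. \<not> (x = 0 \<and> y = 0 \<and> z = 0) \<and> x * b1 + y * b2 + z * b3 + c * b0 = t)"
    unfolding all_bit ex_bit by simp
  obtain a b d c where nz: "\<not> (a = 0 \<and> b = 0 \<and> d = 0)" and eq: "a * ?b1 + b * ?b2 + d * ?b3 + c * ?b0 = t"
    using hits[rule_format, OF neg] by metis
  have "pt a b d \<noteq> 0"
    using nz unfolding pt_0 pt_eq_iff .
  moreover have "charB (pt a b d) c x = t"
    using charB_linear[of "pt a b d" c x] unfolding pt_nth eq .
  ultimately show ?thesis
    by blast
qed

lemma dvd_4_eis_comp: "4 dvd x - y \<Longrightarrow> 4 dvd eis_re x - eis_re y" "4 dvd x - y \<Longrightarrow> 4 dvd eis_om x - eis_om y"
  for x y :: eis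
  by (simp_all add: numeral_dvd_eis_iff)

lemma dvd_4_trans: "4 dvd a - b \<Longrightarrow> 4 dvd b - c \<Longrightarrow> 4 dvd a - c" for a b c :: int
  by presburger

lemma sg_mod4: "4 dvd sg d * a - (1 + 2 * ib (d + sgn4 a))" if "odd a"
  using sgn4_mod4[OF that] by (cases d; cases "sgn4 a"; simp add: sg_def; presburger)

lemma dvd_4_shift: "4 dvd a + 1 \<longleftrightarrow> 4 dvd a - 3" "4 dvd a + 2 \<longleftrightarrow> 4 dvd a - 2" "4 dvd a + 3 \<longleftrightarrow> 4 dvd a - 1"
  for a :: int
  by presburger+

text \<open>The bit \<open>l\<close> selects the residue of \<open>y\<close> modulo 2, namely 1 or
  \<open>omega\<close>; hence the parities of the two coordinates are \<open>l\<close> and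
  \<open>l + 1\<close>, in the shape required by \<open>half_lattice\<close>.\<close>

lemma omega_mod4_comps:
  assumes "4 dvd y - omega ^ (if l + 1 = 1 then 1 else 0) * Eis (1 + 2 * ib p) (2 * ib b)"
  shows "4 dvd eis_re y - (ib l + 2 * ib (l * p + (l + 1) * b))"
    "4 dvd eis_om y - (ib (l + 1) + 2 * ib ((l + 1) * p + b))"
proof -
  note * = dvd_4_eis_comp(1)[OF assms] dvd_4_eis_comp(2)[OF assms]
  show "4 dvd eis_re y - (ib l + 2 * ib (l * p + (l + 1) * b))"
    using * by (cases l; cases p; cases b; simp add: dvd_4_shift)
  show "4 dvd eis_om y - (ib (l + 1) + 2 * ib ((l + 1) * p + b))"
    using * by (cases l; cases p; cases b; simp add: dvd_4_shift)
qed

text \<open>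
  The exponent vector \<open>e\<close> is 1 on a plane and 2 off it, except at the point 0, which absorbs the
  remaining weight; the residues modulo 2 of the \<open>O\<close>-components are 1 and \<open>omega\<close> on two further parallel planes.
\<close>

lemma cover_ones:
  assumes x: "unit_tuple x" and a: "a \<ge> 12"
    and hyp: "\<not> ((\<forall>v c. charB v c x = 0) \<and> charA x + of_nat a = 1)"
  shows "theta x \<in> R_set a <#>\<^bsub>H_grp\<^esub> Q_set 8"
proof -
  let ?s = "\<lambda>h. sgn4 (fst (x h))" and ?b = "\<lambda>h. bsgn (snd (x h))"
  let ?\<alpha> = "\<lambda>h. sgn3 (fst (x h)) + lsgn (snd (x h)) + asgn (snd (x h))"
  obtain v c where v: "v \<noteq> 0" and vc: "charB v c x = charA x + of_nat a"
    using charB_hits[OF hyp] by blast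
  obtain w where w: "w \<noteq> 0" "w \<noteq> v"
  proof -
    have "pt 0 0 1 \<noteq> 0" "pt 0 1 0 \<noteq> 0" "pt 0 0 1 \<noteq> pt 0 1 0"
      by (simp_all add: pt_0)
    then show ?thesis
      using that by metis
  qed
  \<comment> \<open>The plane contributes 4 and the three nonzero points off it contribute 6,
    leaving \<open>a - 10\<close> for the point 0.\<close>
  define e where "e h = (if dot w h = 1 then 1 else if h = 0 then a - 10 else 2)" for h
  have four: "\<forall>w. w \<noteq> 0 \<longrightarrow> (\<Sum>h\<in>UNIV. if dot w h = 1 then 1 else if h = 0 then k else 2) = 10 + k" for k :: nat
    unfolding pt_0 all_idx all_bit sum_idx by simp
  have sum_e: "(\<Sum>h\<in>UNIV. e h) = a"
    using four w(1) a unfolding e_def by simp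
  \<comment> \<open>At 0 the factor is \<open>2 ^ (a - 11)\<close>, which is 2 for
    \<open>a = 12\<close> and 0 modulo 4 for larger \<open>a\<close>.\<close>
  define k0 :: bit where "k0 = (if a = 12 then 1 else 0)"
  let ?p = "\<lambda>h. of_nat (e h + 1) + ?\<alpha> h"
  \<comment> \<open>The conditions put the signs in E^+ and satisfy the lattice conditions for the
    rational part and for the \<open>omega\<close>-coordinates. The remaining condition, on the
    first coordinates, follows from the choice of \<open>v\<close> and \<open>c\<close>.\<close>
  obtain \<delta> where \<delta>: "(\<Sum>h\<in>UNIV. \<delta> h) = 0" "(\<Sum>h\<in>UNIV. dot w h * \<delta> h) = (\<Sum>h\<in>UNIV. dot w h * ?s h) + (1 + k0)"
    "(\<Sum>h\<in>UNIV. aff v (c + 1) h * \<delta> h) = (\<Sum>h\<in>UNIV. ?b h) + (\<Sum>h\<in>UNIV. aff v (c + 1) h * ?p h)"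
    using independent_planes[OF w(1) v w(2)] by blast
  have "theta x \<in> R_vec e <#>\<^bsub>H_grp\<^esub> Q_vec (\<lambda>_. 1)"
  proof (rule theta_in_sumset_bits[OF x \<delta>(1)])
    show "e h > 0" "(1 :: nat) > 0" for h
      using a by (simp_all add: e_def)
    show "4 dvd walsh (\<lambda>g. 2 ^ (e g - 1) * (sg (\<delta> g) * fst (x g))) h" for h
    proof (rule half_lattice)
      fix g
      define m where "m = sg (\<delta> g) * fst (x g)"
      have odd: "odd (fst (x g))"
        using x by (simp add: unit_tuple_def coprime_6_iff)
      then have "odd m"
        by (simp add: m_def sg_def)
      have 1: "4 dvd m - (1 + 2 * ib (\<delta> g + ?s g))"
        unfolding m_def using odd by (rule sg_mod4)
      have 2: "4 dvd 2 * m - 2"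
        using \<open>odd m\<close> by presburger
      have 3: "4 dvd 2 ^ (a - 11) * m - 2 * ib k0"
      proof (cases "a = 12")
        case False
        then have "a - 11 = Suc (Suc (a - 13))"
          using a by simp
        then show ?thesis
          using False by (simp add: k0_def)
      qed (use 2 in \<open>simp add: k0_def\<close>)
      show "4 dvd 2 ^ (e g - 1) * (sg (\<delta> g) * fst (x g)) - (ib (aff w 0 g) +
          2 * ib (dot w g * (\<delta> g + ?s g) + (dot w g + 1) * (if g = 0 then k0 else 1)))"
        unfolding m_def[symmetric]
        by (cases "g = 0"; cases "dot w g"; cases k0) (use 1 2 3 in \<open>simp_all add: e_def aff_def\<close>)
    next
      have *: "\<forall>w. w \<noteq> 0 \<longrightarrow> (\<Sum>h\<in>UNIV. (dot w h + 1) * (if h = 0 then k else 1)) = 1 + k" for k :: bit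
        unfolding pt_0 all_idx all_bit sum_idx by (cases k) simp_all
      show "(\<Sum>g\<in>UNIV. dot w g * (\<delta> g + ?s g) + (dot w g + 1) * (if g = 0 then k0 else 1)) = 0"
        unfolding sum.distrib distrib_left \<delta>(2) *[rule_format, OF w(1)]
        by (simp only: add_ac bit_add_cancel add_0_right)
    qed
    have "(\<Sum>h\<in>UNIV. ?p h) = of_nat (\<Sum>h\<in>UNIV. e h + 1) + charA x"
      by (simp only: sum.distrib[of _ ?\<alpha>] charA_def of_nat_sum)
    also have "(\<Sum>h\<in>UNIV. e h + 1) = a + 8"
      unfolding sum.distrib sum_e by simp
    also have "of_nat (a + 8) + charA x = charA x + of_nat a"
      by (simp add: of_nat_bit add.commute)
    finally have sum_p: "(\<Sum>h\<in>UNIV. ?p h) = charA x + of_nat a" .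
    have compl: "aff v c h = aff v (c + 1) h + 1" for h
      by (simp only: aff_def add.assoc bit_add_cancel add_0_right)
    have charB_compl: "charB v c x = (\<Sum>h\<in>UNIV. aff v (c + 1) h * ?b h) + (\<Sum>h\<in>UNIV. ?b h)"
      by (simp only: charB_def compl distrib_right mult_1 sum.distrib)
    fix y :: "idx \<Rightarrow> eis" and h
    assume y: "\<And>g. 4 dvd y g - 2 ^ (1 - 1) * (omega ^ (if aff v (c + 1) g = 1 then 1 else 0) *
      Eis (1 + 2 * ib (of_nat (e g + 1) + \<delta> g + ?\<alpha> g)) (2 * ib (?b g)))"
    have perm: "of_nat (e g + 1) + \<delta> g + ?\<alpha> g = \<delta> g + ?p g" for g
      by (simp only: add_ac)
    have y': "4 dvd y g - omega ^ (if aff v c g + 1 = 1 then 1 else 0) *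
      Eis (1 + 2 * ib (\<delta> g + ?p g)) (2 * ib (?b g))" for g
      using y[of g] unfolding perm aff_plus(2)[symmetric] by (simp only: diff_self_eq_0 power_0 mult_1)
    have "4 dvd walsh (\<lambda>g. eis_re (y g)) h"
    proof (rule half_lattice)
      fix g
      show "4 dvd eis_re (y g) - (ib (aff v c g) +
          2 * ib (aff v c g * (\<delta> g + ?p g) + aff v (c + 1) g * ?b g))"
        unfolding aff_plus(2)[symmetric] using y' by (rule omega_mod4_comps)
    next
      have "(\<Sum>g\<in>UNIV. aff v c g * (\<delta> g + ?p g) + aff v (c + 1) g * ?b g) =
          (\<Sum>g\<in>UNIV. aff v (c + 1) g * \<delta> g) + (\<Sum>g\<in>UNIV. aff v (c + 1) g * ?p g) +
          ((\<Sum>g\<in>UNIV. \<delta> g) + (\<Sum>g\<in>UNIV. ?p g)) + (\<Sum>g\<in>UNIV. aff v (c + 1) g * ?b g)"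
        by (simp only: compl distrib_left distrib_right sum.distrib mult_1 add_ac)
      then show "(\<Sum>g\<in>UNIV. aff v c g * (\<delta> g + ?p g) + aff v (c + 1) g * ?b g) = 0"
        unfolding \<delta> sum_p vc[symmetric] charB_compl by (simp only: add_ac bit_add_cancel add_0 add_0_right)
    qed
    moreover have "4 dvd walsh (\<lambda>g. eis_om (y g)) h"
    proof (rule half_lattice)
      fix g
      show "4 dvd eis_om (y g) - (ib (aff v (c + 1) g) +
          2 * ib (aff v (c + 1) g * (\<delta> g + ?p g) + ?b g))"
        unfolding aff_plus(2)[symmetric] using y' by (rule omega_mod4_comps)
    next
      show "(\<Sum>g\<in>UNIV. aff v (c + 1) g * (\<delta> g + ?p g) + ?b g) = 0"
        unfolding sum.distrib distrib_left \<delta>(3) by (simp only: add_ac bit_add_cancel)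
    qed
    ultimately show "4 dvd walsh (\<lambda>g. eis_re (y g)) h \<and> 4 dvd walsh (\<lambda>g. eis_om (y g)) h" ..
  qed
  moreover have "e h > 0" for h
    using a by (simp add: e_def)
  then have "R_vec e \<subseteq> R_set a"
    using sum_e a unfolding R_set_def by auto
  moreover have "Q_vec (\<lambda>_. 1) \<subseteq> Q_set 8"
    by (auto simp: Q_set_def intro!: exI[of _ "\<lambda>_. 1"])
  ultimately show ?thesis
    unfolding set_mult_def by blast
qed

text \<open>After doubling, only the residue modulo 2 matters, and the powers of
  \<open>omega\<close> realise all three nonzero residues.\<close>

lemma omega_powers_mod2:
  assumes "\<not> (r = 0 \<and> s = 0)"
  shows "\<exists>n. \<forall>i j. 4 dvd eis_re (2 * (omega ^ n * Eis (1 + 2 * i) (2 * j))) - 2 * ib r \<and>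
    4 dvd eis_om (2 * (omega ^ n * Eis (1 + 2 * i) (2 * j))) - 2 * ib s"
proof (cases "r = 0")
  case True
  then have "s = 1"
    using assms by simp
  with True show ?thesis
    by (intro exI[of _ 1]) (simp; presburger)
next
  case r: False
  show ?thesis
  proof (cases "s = 0")
    case True
    with r show ?thesis
      by (intro exI[of _ 0]) (simp; presburger)
  next
    case False
    with r show ?thesis
      by (intro exI[of _ 2]) (simp add: power2_eq_square; presburger)
  qed
qed

text \<open>
  Here \<open>f\<close> exceeds 1 exactly on the line of points \<open>pt 0 0 z\<close>, where the affine map
  \<open>pt x y z \<mapsto> x + y \<omega>\<close> giving the residues modulo 2 vanishes.
\<close>

lemma cover_eight:
  assumes x: "unit_tuple x" and r: "r \<in> {10, 11}" and S: "charS x = 0"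
  shows "theta x \<in> R_set 8 <#>\<^bsub>H_grp\<^esub> Q_set r"
proof -
  let ?s = "\<lambda>h. sgn4 (fst (x h))" and ?b = "\<lambda>h. bsgn (snd (x h))"
  let ?\<alpha> = "\<lambda>h. sgn3 (fst (x h)) + lsgn (snd (x h)) + asgn (snd (x h))"
  define f where "f h = (if h = pt 0 0 0 then 2 else if h = pt 0 0 1 then r - 8 else 1)" for h
  define q where "q h = of_nat (1 + f h) + ?\<alpha> h" for h
  \<comment> \<open>At \<open>pt 0 0 1\<close> the factor is \<open>2 ^ (r - 9)\<close>, which is 2
    for \<open>r = 10\<close> and 0 modulo 4 for \<open>r = 11\<close>.\<close>
  define k1 :: bit where "k1 = (if r = 10 then 1 else 0)"
  \<comment> \<open>\<open>X\<close> and \<open>Y\<close> collect the bits that all points other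
    than 0 contribute to the two coordinate sums before signs are chosen. The point 0 must cancel
    them, and it can supply any pair except zero.\<close>
  define X where "X = k1 + (?b (pt 0 1 0) + ?b (pt 0 1 1) + q (pt 1 0 0) + q (pt 1 0 1) +
    q (pt 1 1 0) + ?b (pt 1 1 0) + q (pt 1 1 1) + ?b (pt 1 1 1))"
  define Y where "Y = q (pt 0 1 0) + ?b (pt 0 1 0) + q (pt 0 1 1) + ?b (pt 0 1 1) +
    ?b (pt 1 0 0) + ?b (pt 1 0 1) + q (pt 1 1 0) + q (pt 1 1 1)"
  have "\<exists>t. \<not> (X + t = 0 \<and> Y + t = 0)"
    unfolding ex_bit by (cases X; cases Y; simp)
  then obtain t where t: "\<not> (X + t = 0 \<and> Y + t = 0)" ..
  \<comment> \<open>Two sign changes preserve the product of signs; the one at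
    \<open>pt 1 0 0\<close> shifts only the first coordinate sum, the one at \<open>pt 0 1 0\<close>
    only the second.\<close>
  define \<delta> where "\<delta> h = (if h = pt 1 0 0 \<or> h = pt 0 1 0 then t else 0)" for h
  from omega_powers_mod2[OF t] obtain n0 where
    n0: "\<And>i j. 4 dvd eis_re (2 * (omega ^ n0 * Eis (1 + 2 * i) (2 * j))) - 2 * ib (X + t)"
      "\<And>i j. 4 dvd eis_om (2 * (omega ^ n0 * Eis (1 + 2 * i) (2 * j))) - 2 * ib (Y + t)"
    by blast
  define n where "n h = (if h $ 1 = 0 then if h $ 2 = 0 then if h $ 3 = 0 then n0 else 0 else 1
    else if h $ 2 = 0 then 0 else 2)" for h :: idx
  define P where "P h = \<delta> h + q h" for h
  define zr where "zr h = (if h $ 1 = 0 then if h $ 2 = 0 then if h $ 3 = 0 then X + t else k1 else ?b h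
    else if h $ 2 = 0 then P h else 1 + P h + ?b h)" for h
  define zo where "zo h = (if h $ 1 = 0 then if h $ 2 = 0 then if h $ 3 = 0 then Y + t else 0 else P h + ?b h
    else if h $ 2 = 0 then ?b h else 1 + P h)" for h
  have "theta x \<in> R_vec (\<lambda>_. 1) <#>\<^bsub>H_grp\<^esub> Q_vec f"
  proof (rule theta_in_sumset_bits[OF x])
    show sum_\<delta>: "(\<Sum>h\<in>UNIV. \<delta> h) = 0"
      by (simp add: sum_idx \<delta>_def)
    show "(1 :: nat) > 0" "f h > 0" for h
      using r by (auto simp: f_def)
    show "4 dvd walsh (\<lambda>g. 2 ^ (1 - 1) * (sg (\<delta> g) * fst (x g))) h" for h
    proof (rule half_lattice)
      fix g
      have "odd (fst (x g))"
        using x by (simp add: unit_tuple_def coprime_6_iff)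
      then show "4 dvd 2 ^ (1 - 1) * (sg (\<delta> g) * fst (x g)) - (ib (aff 0 1 g) + 2 * ib (\<delta> g + ?s g))"
        using sg_mod4 by (simp add: aff_def)
      show "(\<Sum>g\<in>UNIV. \<delta> g + ?s g) = 0"
        unfolding sum.distrib sum_\<delta> using S by (simp add: charS_def)
    qed
    fix y :: "idx \<Rightarrow> eis" and h
    assume y: "\<And>g. 4 dvd y g - 2 ^ (f g - 1) * (omega ^ n g *
      Eis (1 + 2 * ib (of_nat (1 + f g) + \<delta> g + ?\<alpha> g)) (2 * ib (?b g)))"
    have perm: "of_nat (1 + f g) + \<delta> g + ?\<alpha> g = P g" for g
      by (simp only: P_def q_def add_ac)
    note re = dvd_4_eis_comp(1)[OF y, unfolded perm] and om = dvd_4_eis_comp(2)[OF y, unfolded perm]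
    have "\<forall>g. 4 dvd eis_re (y g) - (ib (aff (pt 1 0 0) 0 g) + 2 * ib (zr g)) \<and>
        4 dvd eis_om (y g) - (ib (aff (pt 0 1 0) 0 g) + 2 * ib (zo g))"
    proof -
      have r_cases: "4 dvd eis_re (2 ^ (r - 9) * Eis (1 + 2 * i) (2 * j)) - 2 * ib k1"
        "4 dvd eis_om (2 ^ (r - 9) * Eis (1 + 2 * i) (2 * j))" for i j
        using r by (auto simp: k1_def power2_eq_square)
      have "4 dvd eis_re (y (pt 0 0 0)) - 2 * ib (X + t) \<and> 4 dvd eis_om (y (pt 0 0 0)) - 2 * ib (Y + t)"
      proof -
        have "2 ^ (f (pt 0 0 0) - 1) * (omega ^ n (pt 0 0 0) * z) = 2 * (omega ^ n0 * z)" for z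
          by (simp add: f_def n_def)
        then show "4 dvd eis_re (y (pt 0 0 0)) - 2 * ib (X + t) \<and> 4 dvd eis_om (y (pt 0 0 0)) - 2 * ib (Y + t)"
          using dvd_4_trans[OF re[of "pt 0 0 0"], of "2 * ib (X + t)"]
            dvd_4_trans[OF om[of "pt 0 0 0"], of "2 * ib (Y + t)"] n0 by (simp_all only:)
      qed
      moreover have "4 dvd eis_re (y (pt 0 0 1)) - 2 * ib k1 \<and> 4 dvd eis_om (y (pt 0 0 1)) - 0"
      proof -
        have "2 ^ (f (pt 0 0 1) - 1) * (omega ^ n (pt 0 0 1) * z) = 2 ^ (r - 9) * z" for z
          by (simp add: f_def n_def)
        then show "4 dvd eis_re (y (pt 0 0 1)) - 2 * ib k1 \<and> 4 dvd eis_om (y (pt 0 0 1)) - 0"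
          using dvd_4_trans[OF re[of "pt 0 0 1"], of "2 * ib k1"]
            dvd_4_trans[OF om[of "pt 0 0 1"], of 0] r_cases by (simp_all only: diff_0_right)
      qed
      moreover have "4 dvd eis_re (y (pt 0 1 z)) - 2 * ib (?b (pt 0 1 z))"
        "4 dvd eis_om (y (pt 0 1 z)) - (1 + 2 * ib (P (pt 0 1 z) + ?b (pt 0 1 z)))" for z
        using re[of "pt 0 1 z"] om[of "pt 0 1 z"]
        by (cases "P (pt 0 1 z)"; cases "?b (pt 0 1 z)"; simp add: f_def n_def dvd_4_shift)+
      moreover have "4 dvd eis_re (y (pt 1 0 z)) - (1 + 2 * ib (P (pt 1 0 z)))"
        "4 dvd eis_om (y (pt 1 0 z)) - 2 * ib (?b (pt 1 0 z))" for z
        using re[of "pt 1 0 z"] om[of "pt 1 0 z"] by (simp_all add: f_def n_def)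
      moreover have "4 dvd eis_re (y (pt 1 1 z)) - (1 + 2 * ib (1 + P (pt 1 1 z) + ?b (pt 1 1 z)))"
        "4 dvd eis_om (y (pt 1 1 z)) - (1 + 2 * ib (1 + P (pt 1 1 z)))" for z
        using re[of "pt 1 1 z"] om[of "pt 1 1 z"]
        by (cases "P (pt 1 1 z)"; cases "?b (pt 1 1 z)"; simp add: f_def n_def power2_eq_square dvd_4_shift)+
      ultimately show ?thesis
        unfolding all_idx all_bit zr_def zo_def aff_def dot_pt pt_nth by simp
    qed
    note z = this
    have "4 dvd walsh (\<lambda>g. eis_re (y g)) h"
    proof (rule half_lattice)
      show "4 dvd eis_re (y g) - (ib (aff (pt 1 0 0) 0 g) + 2 * ib (zr g))" for g
        using z by blast
      show "(\<Sum>g\<in>UNIV. zr g) = 0"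
        by (simp only: sum_idx zr_def pt_nth P_def \<delta>_def X_def pt_eq_iff zero_neq_one one_neq_zero simp_thms
            if_True if_False add_ac bit_add_cancel add_0 add_0_right)
    qed
    moreover have "4 dvd walsh (\<lambda>g. eis_om (y g)) h"
    proof (rule half_lattice)
      show "4 dvd eis_om (y g) - (ib (aff (pt 0 1 0) 0 g) + 2 * ib (zo g))" for g
        using z by blast
      show "(\<Sum>g\<in>UNIV. zo g) = 0"
        by (simp only: sum_idx zo_def pt_nth P_def \<delta>_def Y_def pt_eq_iff zero_neq_one one_neq_zero simp_thms
            if_True if_False add_ac bit_add_cancel add_0 add_0_right)
    qed
    ultimately show "4 dvd walsh (\<lambda>g. eis_re (y g)) h \<and> 4 dvd walsh (\<lambda>g. eis_om (y g)) h" ..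
  qed
  moreover have "R_vec (\<lambda>_. 1) \<subseteq> R_set 8"
    by (auto simp: R_set_def intro!: exI[of _ "\<lambda>_. 1"])
  moreover have "(\<Sum>h\<in>UNIV. f h) = r" "\<And>h. f h > 0"
    using r by (auto simp: f_def sum_idx)
  then have "Q_vec f \<subseteq> Q_set r"
    using r by (auto simp: Q_set_def)
  ultimately show ?thesis
    unfolding set_mult_def by blast
qed

lemma C0_covers:
  assumes k: "k \<in> {28, 29, 30, 31}" and x: "unit_tuple x" and om: "\<not> omitted k x"
  shows "theta x \<in> C0 k"
proof -
  have C0: "theta x \<in> C0 k" if "theta x \<in> R_set a <#>\<^bsub>H_grp\<^esub> Q_set r"
    "a + 2 * r = k" "a \<in> {0, 8} \<union> {12..}" "r \<in> {0, 8} \<union> {10..}" for a r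
    unfolding C0_def using that by blast
  show ?thesis
  proof (cases "(\<forall>v c. charB v c x = 0) \<and> charA x + of_nat (k - 16) = 1")
    case False
    then have "theta x \<in> R_set (k - 16) <#>\<^bsub>H_grp\<^esub> Q_set 8"
      using k x by (intro cover_ones) auto
    then show ?thesis
      using k by (intro C0) auto
  next
    case True
    \<comment> \<open>Here \<open>charA x\<close> is 1 for even \<open>k\<close> and 0 for odd
      \<open>k\<close>. Not being omitted therefore rules out odd \<open>k\<close> and forces
      \<open>charS x = 0\<close>.\<close>
    have "even k" "charS x = 0"
      using True om k by (auto simp: omitted_def of_nat_bit)
    moreover define r where "r = (k - 8) div 2"
    ultimately have r: "r \<in> {10, 11}" "8 + 2 * r = k"
      using k by auto
    have "theta x \<in> R_set 8 <#>\<^bsub>H_grp\<^esub> Q_set r"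
      using x r(1) \<open>charS x = 0\<close> by (rule cover_eight)
    then show ?thesis
      using r by (intro C0) auto
  qed
qed

lemma bit_hom_simps: "ib (b + c) = (ib b + ib c) mod 2" "ib b = ib c \<longleftrightarrow> b = c" "ib b \<in> {0..<2}"
  by (cases b; cases c; simp)+

subsection \<open>Stabilizers of complements of cosets\<close>

text \<open>The abstract situation behind the theorem: \<open>B\<close> is the complement of one
  fibre of a surjective homomorphism.\<close>

locale omitting_hom = group_hom G K \<Phi> for G (structure) and K (structure) and \<Phi> +
  fixes t B
  assumes surj: "\<Phi> ` carrier G = carrier K" and t: "t \<in> carrier K"
    and B: "B = {x \<in> carrier G. \<Phi> x \<noteq> t}"
begin

text \<open>Translation by \<open>g\<close> moves the fibre over \<open>t\<close> to the fibre over
  the product of \<open>t\<close> and \<open>\<Phi> g\<close>, so it fixes the complement only for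
  \<open>g\<close> in the kernel.\<close>

lemma stab_eq: "stab G B = kernel G K \<Phi>"
proof (intro equalityI subsetI)
  fix g assume g: "g \<in> stab G B"
  then have gG: "g \<in> carrier G" and Bg: "B #> g = B"
    by (auto simp: stab_def)
  obtain y where y: "y \<in> carrier G" "\<Phi> y = t"
    using t surj by (metis imageE)
  have "y \<otimes> inv g \<notin> B"
  proof
    assume "y \<otimes> inv g \<in> B"
    then have "y \<otimes> inv g \<otimes> g \<in> B #> g"
      by (auto simp: r_coset_def)
    then show False
      using y gG unfolding Bg by (simp add: B G.m_assoc)
  qed
  then have "\<Phi> (y \<otimes> inv g) = t"
    using y gG by (simp add: B)
  then have "t \<otimes>\<^bsub>K\<^esub> inv\<^bsub>K\<^esub> (\<Phi> g) = t"
    using y gG by simp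
  then have "\<Phi> g = \<one>\<^bsub>K\<^esub>"
    using gG t by simp
  then show "g \<in> kernel G K \<Phi>"
    using gG by (simp add: kernel_def)
next
  fix g assume "g \<in> kernel G K \<Phi>"
  then have g: "g \<in> carrier G" "\<Phi> g = \<one>\<^bsub>K\<^esub>"
    by (auto simp: kernel_def)
  have "B #> g = B"
  proof (intro equalityI subsetI)
    fix x assume "x \<in> B #> g"
    then show "x \<in> B"
      using g by (auto simp: r_coset_def B)
  next
    fix x assume x: "x \<in> B"
    then have "x \<otimes> inv g \<in> B" "x = x \<otimes> inv g \<otimes> g"
      using g by (auto simp: B G.m_assoc)
    then show "x \<in> B #> g"
      by (auto simp: r_coset_def)
  qed
  then show "g \<in> stab G B"
    using g by (simp add: stab_def)
qed

lemma quot_iso: "quot G B \<cong> K"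
  unfolding quot_def stab_eq by (rule FactGroup_iso[OF surj])

lemma proj_eq: "proj G B x = {y \<in> carrier G. \<Phi> y = \<Phi> x}" if "x \<in> carrier G"
proof (intro equalityI subsetI)
  fix y assume "y \<in> proj G B x"
  then show "y \<in> {y \<in> carrier G. \<Phi> y = \<Phi> x}"
    using that by (auto simp: proj_def stab_eq kernel_def r_coset_def)
next
  fix y assume "y \<in> {y \<in> carrier G. \<Phi> y = \<Phi> x}"
  then have "y \<otimes> inv x \<in> kernel G K \<Phi>" "y = y \<otimes> inv x \<otimes> x"
    using that by (simp_all add: kernel_def G.m_assoc)
  then show "y \<in> proj G B x"
    by (auto simp: proj_def stab_eq r_coset_def)
qed

lemma proj_eq_iff: "proj G B x = proj G B y \<longleftrightarrow> \<Phi> x = \<Phi> y" if "x \<in> carrier G" "y \<in> carrier G"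
  using that by (auto simp: proj_eq)

lemma proj_eq_one_iff: "proj G B x = \<one>\<^bsub>quot G B\<^esub> \<longleftrightarrow> \<Phi> x = \<one>\<^bsub>K\<^esub>" if "x \<in> carrier G"
proof -
  have "\<one>\<^bsub>quot G B\<^esub> = proj G B \<one>"
    unfolding quot_def proj_def stab_eq FactGroup_def
    using subgroup.subset[OF subgroup_kernel] by simp
  then show ?thesis
    using proj_eq_iff[OF that G.one_closed] by simp
qed

lemma omits_one_class:
  "\<exists>T. carrier (quot G B) - proj G B ` B = {T} \<and> (\<forall>x\<in>carrier G. proj G B x = T \<longleftrightarrow> \<Phi> x = t)"
proof -
  obtain y where y: "y \<in> carrier G" "\<Phi> y = t"
    using t surj by (metis imageE)
  have carr: "carrier (quot G B) = proj G B ` carrier G"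
    by (auto simp: quot_def proj_def FactGroup_def RCOSETS_def)
  have iff: "\<forall>x\<in>carrier G. proj G B x = proj G B y \<longleftrightarrow> \<Phi> x = t"
    using proj_eq_iff y by simp
  have "carrier (quot G B) - proj G B ` B = {proj G B y}"
    unfolding carr
  proof (intro equalityI subsetI)
    fix T assume "T \<in> proj G B ` carrier G - proj G B ` B"
    then show "T \<in> {proj G B y}"
      using iff by (auto simp: B)
  next
    fix T assume "T \<in> {proj G B y}"
    then show "T \<in> proj G B ` carrier G - proj G B ` B"
      using iff y by (auto simp: B)
  qed
  then show ?thesis
    using iff by blast
qed

end

section \<open>The joint homomorphism onto C_2^5 and C_2^6\<close>

definition chr :: "nat \<Rightarrow> (idx \<Rightarrow> int \<times> eis) \<Rightarrow> bit"
  where "chr i = (if i = 0 then charB 0 1 else if i = 1 then charB (pt 1 0 0) 0 else if i = 2 then charB (pt 0 1 0) 0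
    else if i = 3 then charB (pt 0 0 1) 0 else if i = 4 then charA else charS)"

interpretation chr: tuple_char "chr i"
  unfolding chr_def
  by (simp add: charA.tuple_char_axioms charB.tuple_char_axioms charS.tuple_char_axioms)

text \<open>In the enumeration \<open>chr\<close> the character \<open>charS\<close> comes last, so
  passing from \<open>n = 6\<close> to \<open>n = 5\<close> drops exactly it.\<close>

definition Phi :: "nat \<Rightarrow> (idx \<Rightarrow> int set \<times> eis set) set \<Rightarrow> nat \<Rightarrow> int"
  where "Phi n X = (\<lambda>i\<in>{..<n}. ib (H_char (chr i) X))"

lemma group_C2_power: "group (C2_power n)"
  by (simp add: C2_power_def)

lemma Phi_hom: "Phi n \<in> hom H_grp (C2_power n)"
proof (rule homI)
  fix X Y assume XY: "X \<in> carrier H_grp" "Y \<in> carrier H_grp"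
  show "Phi n (X \<otimes>\<^bsub>H_grp\<^esub> Y) = Phi n X \<otimes>\<^bsub>C2_power n\<^esub> Phi n Y"
    unfolding Phi_def C2_power_def mult_product_group chr.H_char_mult[OF XY] bit_hom_simps(1)
    by (rule restrict_ext) simp
next
  fix X
  show "Phi n X \<in> carrier (C2_power n)"
    unfolding Phi_def C2_power_def carrier_product_group carrier_integer_mod_group
    using bit_hom_simps(3) by (intro restrict_PiE_iff[THEN iffD2]) simp
qed

text \<open>The bits of \<open>b\<close> at the unit vectors realise the coordinate weights, and the
  bit at 0 corrects the total. A single rational entry, chosen modulo 12, then adjusts
  \<open>charA\<close> and \<open>charS\<close> independently.\<close>

lemma chr_surj: "\<exists>x. unit_tuple x \<and> (\<forall>i<6. chr i x = d i)"
proof -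
  define b where "b h = (if h = pt 1 0 0 then d 1 else if h = pt 0 1 0 then d 2 else if h = pt 0 0 1 then d 3
    else if h = pt 0 0 0 then d 0 + d 1 + d 2 + d 3 else 0)" for h
  \<comment> \<open>\<open>Eis 1 (- 2)\<close> agrees with \<open>1 + 2 * omega\<close> modulo 4,
    hence has \<open>bsgn\<close> 1, but unlike the latter it is prime to
    \<open>lam\<close>.\<close>
  define \<beta> where "\<beta> h = (if b h = 1 then Eis 1 (- 2) else 1)" for h
  define z where "z = (\<Sum>h\<in>UNIV. lsgn (\<beta> h) + asgn (\<beta> h))"
  obtain n :: int where n: "coprime n 6" "sgn3 n = d 4 + z" "sgn4 n = d 5"
  proof -
    have "\<forall>s t. \<exists>n :: int. coprime n 6 \<and> sgn3 n = s \<and> sgn4 n = t"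
      unfolding all_bit
      by (intro conjI exI[of _ 1] exI[of _ 7] exI[of _ 5] exI[of _ 11]; simp add: coprime_6_iff sgn3_def sgn4_def)
    then show ?thesis
      using that by metis
  qed
  define a where "a h = (if h = pt 0 0 0 then n else 1)" for h
  let ?x = "\<lambda>h. (a h, \<beta> h)"
  have bsgn: "bsgn (\<beta> h) = b h" for h
    by (cases "b h") (simp_all add: \<beta>_def bsgn_def power3_eq_cube)
  have "unit_tuple ?x"
    using n(1) by (simp add: unit_tuple_def a_def \<beta>_def eis_cop_iff)
  moreover have S: "charS ?x = d 5"
    by (simp add: charS_def sum_idx a_def n) (simp add: sgn4_def)
  moreover have "(\<Sum>h\<in>UNIV. sgn3 (a h)) = d 4 + z"
    by (simp only: sum_idx a_def pt_eq_iff zero_neq_one one_neq_zero simp_thms if_True if_False n) (simp add: sgn3_def)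
  then have A: "charA ?x = d 4"
    by (simp only: charA_def fst_conv snd_conv add.assoc sum.distrib[of _ "\<lambda>h. lsgn (\<beta> h) + asgn (\<beta> h)"] z_def[symmetric] bit_add_cancel add_0_right)
  moreover have "charB 0 1 ?x = d 0" "charB (pt 1 0 0) 0 ?x = d 1" "charB (pt 0 1 0) 0 ?x = d 2" "charB (pt 0 0 1) 0 ?x = d 3"
    by (simp_all only: charB_def snd_conv bsgn sum_idx b_def aff_def pt_0 dot_pt pt_eq_iff zero_neq_one one_neq_zero simp_thms
      if_True if_False mult_zero_left mult_zero_right mult_1 add_0 add_0_right add_ac bit_add_cancel)
  ultimately have "unit_tuple ?x \<and> (\<forall>i<6. chr i ?x = d i)"
    by (auto simp: chr_def less_Suc_eq numeral_eq_Suc)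
  then show ?thesis
    by (intro exI[of _ ?x])
qed

lemma Phi_surj: "Phi n ` carrier H_grp = carrier (C2_power n)" if "n \<le> 6"
proof (intro equalityI subsetI)
  fix y assume "y \<in> Phi n ` carrier H_grp"
  then show "y \<in> carrier (C2_power n)"
    using hom_carrier[OF Phi_hom] by blast
next
  fix y assume "y \<in> carrier (C2_power n)"
  then have y: "y \<in> (\<Pi>\<^sub>E i\<in>{..<n}. {0..<2})"
    by (simp add: C2_power_def carrier_integer_mod_group)
  obtain x where x: "unit_tuple x" "\<forall>i<6. chr i x = (if y i = 1 then 1 else 0)"
    using chr_surj[of "\<lambda>i. if y i = 1 then 1 else 0"] by blast
  have "Phi n (theta x) i = y i" if "i < n" for i
  proof -
    have "y i \<in> {0..<2}"
      using PiE_mem[OF y, of i] that by simp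
    then have "y i = 0 \<or> y i = 1"
      by auto
    moreover have "Phi n (theta x) i = ib (if y i = 1 then 1 else 0)"
      using that \<open>n \<le> 6\<close> x by (simp add: Phi_def chr.H_char_theta)
    ultimately show ?thesis
      by auto
  qed
  then have "Phi n (theta x) = y"
    using y by (intro PiE_ext[of _ "{..<n}" "\<lambda>_. UNIV" _]) (auto simp: Phi_def PiE_iff)
  then show "y \<in> Phi n ` carrier H_grp"
    using x(1) theta_in_H by blast
qed

lemma omitted_iff_Phi:
  assumes "unit_tuple x"
  shows "omitted k x \<longleftrightarrow> Phi (if even k then 6 else 5) (theta x) =
    (\<lambda>i\<in>{..<(if even k then 6 else 5)}. if even k \<and> i \<ge> 4 then 1 else 0)"
    (is "_ \<longleftrightarrow> Phi ?n _ = ?t")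
proof -
  have "(\<forall>v c. charB v c x = 0) \<longleftrightarrow> (\<forall>i<4. chr i x = 0)"
  proof
    assume "\<forall>i<4. chr i x = 0"
    then have "chr 0 x = 0" "chr 1 x = 0" "chr 2 x = 0" "chr 3 x = 0"
      by simp_all
    then have B: "charB 0 1 x = 0" "charB (pt 1 0 0) 0 x = 0" "charB (pt 0 1 0) 0 x = 0" "charB (pt 0 0 1) 0 x = 0"
      by (simp_all add: chr_def)
    show "\<forall>v c. charB v c x = 0"
    proof (intro allI)
      show "charB v c x = 0" for v c
        unfolding charB_linear[of v c x] B by simp
    qed
  qed (simp add: chr_def)
  then have om: "omitted k x \<longleftrightarrow> (\<forall>i<4. chr i x = 0) \<and> (if even k then chr 4 x = 1 \<and> chr 5 x = 1 else chr 4 x = 0)"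
    by (simp add: omitted_def chr_def)
  have "Phi ?n (theta x) = ?t \<longleftrightarrow> (\<forall>i<?n. ib (chr i x) = (if even k \<and> i \<ge> 4 then 1 else 0))"
    using assms by (auto simp: Phi_def fun_eq_iff chr.H_char_theta restrict_def)
  also have "\<dots> \<longleftrightarrow> (\<forall>i<?n. chr i x = (if even k \<and> i \<ge> 4 then 1 else 0))"
  proof -
    have "ib b = (if P then 1 else 0) \<longleftrightarrow> b = (if P then 1 else 0)" for b P
      by (simp add: ib_def)
    then show ?thesis
      by (simp only:)
  qed
  also have "\<dots> \<longleftrightarrow> omitted k x"
  proof -
    have "{..<6} = {..<4} \<union> {4, 5 :: nat}" "{..<5} = {..<4} \<union> {4 :: nat}"
      by auto
    then have "(\<forall>i<6. P i) \<longleftrightarrow> (\<forall>i<4. P i) \<and> P 4 \<and> P 5" "(\<forall>i<5. P i) \<longleftrightarrow> (\<forall>i<4. P i) \<and> P 4"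
      for P :: "nat \<Rightarrow> bool"
      unfolding lessThan_iff[symmetric] by auto
    then show ?thesis
      unfolding om by (cases "even k") simp_all
  qed
  finally show ?thesis ..
qed

lemma omitting_hom_C0:
  assumes k: "k \<in> {28, 29, 30, 31}"
  defines "n \<equiv> if even k then 6 else 5"
  shows "omitting_hom H_grp (C2_power n) (Phi n) (\<lambda>i\<in>{..<n}. if even k \<and> i \<ge> 4 then 1 else 0) (C0 k)"
proof -
  have "group_hom H_grp (C2_power n) (Phi n)"
    using comm_group_H group_C2_power Phi_hom
    by (simp add: group_hom_def group_hom_axioms_def comm_group.axioms(2))
  moreover have "C0 k = {X \<in> carrier H_grp. Phi n X \<noteq> (\<lambda>i\<in>{..<n}. if even k \<and> i \<ge> 4 then 1 else 0)}"
  proof (intro equalityI subsetI)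
    fix X assume "X \<in> C0 k"
    then show "X \<in> {X \<in> carrier H_grp. Phi n X \<noteq> (\<lambda>i\<in>{..<n}. if even k \<and> i \<ge> 4 then 1 else 0)}"
      using C0_avoids[OF k] omitted_iff_Phi[where k = k] theta_in_H unfolding n_def by blast
  next
    fix X assume "X \<in> {X \<in> carrier H_grp. Phi n X \<noteq> (\<lambda>i\<in>{..<n}. if even k \<and> i \<ge> 4 then 1 else 0)}"
    then show "X \<in> C0 k"
      using C0_covers[OF k] omitted_iff_Phi[where k = k] unfolding n_def carrier_H by blast
  qed
  ultimately show ?thesis
    unfolding omitting_hom_def omitting_hom_axioms_def
    using Phi_surj[of n] by (auto simp: n_def C2_power_def carrier_integer_mod_group)
qed

subsection \<open>Prime moves\<close>

lemma theta1_closed: "theta1 h v \<in> carrier H_grp" if "coprime v 6"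
  using that unfolding theta1_def by (intro theta_in_H) (simp add: unit_tuple_def eis_cop_one)

lemma theta3_closed: "theta3 h v \<in> carrier H_grp" if "eis_cop v"
  using that unfolding theta3_def by (intro theta_in_H) (simp add: unit_tuple_def eis_cop_one)

text \<open>The norm of a generator divides the norm \<open>q ^ 2\<close> of \<open>q\<close>, so a
  move costs at most 2. Hence the cap 26 never excludes a single move.\<close>

lemma moves_closed:
  assumes q: "prime q" "coprime (int q) 6" and "(g, d) \<in> moves q"
  shows "g \<in> carrier H_grp" "d \<le> 2"
proof -
  have "g \<in> carrier H_grp \<and> d \<le> 2"
    using assms(3) unfolding moves_def
  proof
    assume "(g, d) \<in> {(theta1 h (int q) \<otimes>\<^bsub>H_grp\<^esub> inv\<^bsub>H_grp\<^esub> theta1 0 (int q), 1) | h. h \<noteq> 0}"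
    then show ?thesis
      using theta1_closed[OF q(2)] by auto
  next
    assume "(g, d) \<in> {(theta3 h p \<otimes>\<^bsub>H_grp\<^esub> inv\<^bsub>H_grp\<^esub> (theta1 0 (int q) [^]\<^bsub>H_grp\<^esub> f), f) | h p f.
      primeideal (PIdl\<^bsub>eis_ring\<^esub> p) eis_ring \<and> of_nat q \<in> PIdl\<^bsub>eis_ring\<^esub> p \<and> eis_norm p = int q ^ f}"
    then obtain h p where g: "g = theta3 h p \<otimes>\<^bsub>H_grp\<^esub> inv\<^bsub>H_grp\<^esub> (theta1 0 (int q) [^]\<^bsub>H_grp\<^esub> d)"
      and p: "of_nat q \<in> PIdl\<^bsub>eis_ring\<^esub> p" "eis_norm p = int q ^ d"
      by blast
    have "eis_cop p"
      unfolding eis_cop_iff_norm p using q(2) by simp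
    then have "g \<in> carrier H_grp"
      unfolding g using theta1_closed[OF q(2)] theta3_closed by simp
    obtain r where "of_nat q = p * r"
      using p(1) unfolding PIdl_eis by (auto elim: dvdE)
    moreover have "eis_norm (of_nat q) = int q ^ 2"
      using eis_of_int[of "int q"] by (simp add: eis_norm_def)
    ultimately have "int q ^ 2 = int q ^ d * eis_norm r"
      by (simp only: eis_norm_mult p(2))
    then have "int q ^ d dvd int q ^ 2"
      by (rule dvdI)
    then have "d \<le> 2"
      using prime_gt_1_nat[OF q(1)] unfolding of_nat_power[symmetric] int_dvd_int_iff
      by (rule power_dvd_imp_le)
    with \<open>g \<in> carrier H_grp\<close> show ?thesis ..
  qed
  then show "g \<in> carrier H_grp" "d \<le> 2"
    by simp_all
qed

lemma prime_factor_coprime: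
  assumes "coprime m 6" "q \<in> prime_factors (nat \<bar>m\<bar>)"
  shows "prime q" "coprime (int q) 6"
proof -
  show "prime q"
    using assms(2) by auto
  have "q dvd nat \<bar>m\<bar>"
    using assms(2) by auto
  then have "int q dvd m"
    by (simp add: nat_dvd_iff flip: int_dvd_int_iff)
  then show "coprime (int q) 6"
    using assms(1) by (meson coprime_divisors dvd_refl)
qed

context omitting_hom
begin

lemma foldr_kernel:
  assumes "set gs \<subseteq> carrier G"
  shows "foldr (\<otimes>) gs \<one> \<in> carrier G \<and> ((\<forall>g\<in>set gs. \<Phi> g = \<one>\<^bsub>K\<^esub>) \<longrightarrow> \<Phi> (foldr (\<otimes>) gs \<one>) = \<one>\<^bsub>K\<^esub>)"
  using assms by (induction gs) auto

lemma finprod_kernel: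
  assumes "comm_group G" "finite I" "\<And>i. i \<in> I \<Longrightarrow> s i \<in> carrier G \<and> \<Phi> (s i) = \<one>\<^bsub>K\<^esub>"
  shows "\<Phi> (finprod G s I) = \<one>\<^bsub>K\<^esub>"
proof -
  interpret comm_group G
    by (rule assms(1))
  show ?thesis
    using assms(2,3)
  proof (induction I rule: finite_induct)
    case (insert i I)
    then have "finprod G s (insert i I) = s i \<otimes> finprod G s I"
      by (intro finprod_insert) auto
    moreover have "finprod G s I \<in> carrier G"
      using insert by (intro finprod_closed) auto
    ultimately show ?case
      using insert by simp
  qed simp
qed

end

text \<open>Only the fibre over \<open>t\<close> is forbidden. If the baseline avoids it, the empty
  sum works; otherwise one move with nontrivial image leaves it. Sums of moves in the kernel never
  change the image.\<close>

lemma move_sums_meet_iff: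
  assumes om: "omitting_hom H_grp K \<Phi> t B" and m: "coprime m 6"
  shows "(c_class m <#\<^bsub>H_grp\<^esub> move_sums m) \<inter> B \<noteq> {} \<longleftrightarrow> \<Phi> (c_class m) \<noteq> t \<or>
    (\<exists>q\<in>prime_factors (nat \<bar>m\<bar>). \<exists>(g, d)\<in>moves q. \<Phi> g \<noteq> \<one>\<^bsub>K\<^esub> \<and> d \<le> multiplicity q (nat \<bar>m\<bar>))"
proof -
  interpret omitting_hom H_grp K \<Phi> t B
    by (rule om)
  let ?I = "prime_factors (nat \<bar>m\<bar>)" and ?e = "\<lambda>q. multiplicity q (nat \<bar>m\<bar>)"
  let ?S = "\<lambda>q. P_moves q (min (?e q) 26)"
  note q = prime_factor_coprime[OF m]
  have c: "c_class m \<in> carrier H_grp"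
    unfolding c_class_def using m by (rule theta1_closed)
  have P: "s \<in> carrier H_grp \<and> (\<Phi> s \<noteq> \<one>\<^bsub>K\<^esub> \<longrightarrow> (\<exists>(g, d)\<in>moves q. \<Phi> g \<noteq> \<one>\<^bsub>K\<^esub> \<and> d \<le> ?e q))"
    if "q \<in> ?I" "s \<in> ?S q" for q s
  proof -
    obtain xs where xs: "s = foldr (\<otimes>\<^bsub>H_grp\<^esub>) (map fst xs) \<one>\<^bsub>H_grp\<^esub>" "set xs \<subseteq> moves q"
      "sum_list (map snd xs) \<le> min (?e q) 26"
      using \<open>s \<in> ?S q\<close> unfolding P_moves_def by blast
    have "set (map fst xs) \<subseteq> carrier H_grp"
      using xs(2) moves_closed(1)[OF q[OF \<open>q \<in> ?I\<close>]] by force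
    from foldr_kernel[OF this] have s: "s \<in> carrier H_grp" "\<Phi> s \<noteq> \<one>\<^bsub>K\<^esub> \<Longrightarrow> \<exists>x\<in>set xs. \<Phi> (fst x) \<noteq> \<one>\<^bsub>K\<^esub>"
      unfolding xs(1) by auto
    have "\<exists>(g, d)\<in>moves q. \<Phi> g \<noteq> \<one>\<^bsub>K\<^esub> \<and> d \<le> ?e q" if ne: "\<Phi> s \<noteq> \<one>\<^bsub>K\<^esub>"
    proof -
      obtain x where x: "x \<in> set xs" "\<Phi> (fst x) \<noteq> \<one>\<^bsub>K\<^esub>"
        using s(2)[OF ne] by blast
      \<comment> \<open>Costs are natural numbers, so each move of an affordable sequence is
        affordable by itself.\<close>
      have "snd x \<le> sum_list (map snd xs)"
        using x(1) by (intro member_le_sum_list) auto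
      then have "snd x \<le> ?e q"
        using xs(3) by simp
      then show ?thesis
        using x xs(2) by (intro bexI[of _ x]) (auto simp: case_prod_beta)
    qed
    then show ?thesis
      using s(1) by blast
  qed
  have one: "\<one>\<^bsub>H_grp\<^esub> \<in> ?S q" for q
    unfolding P_moves_def by (intro CollectI exI[of _ "[]"]) simp
  have sums: "(c_class m <#\<^bsub>H_grp\<^esub> move_sums m) \<inter> B \<noteq> {} \<longleftrightarrow> (\<exists>y\<in>move_sums m. c_class m \<otimes>\<^bsub>H_grp\<^esub> y \<in> B)"
    unfolding l_coset_def by blast
  show ?thesis
    unfolding sums
  proof
    assume "\<exists>y\<in>move_sums m. c_class m \<otimes>\<^bsub>H_grp\<^esub> y \<in> B"
    then obtain s where s: "\<And>q. q \<in> ?I \<Longrightarrow> s q \<in> ?S q" "\<Phi> (c_class m \<otimes>\<^bsub>H_grp\<^esub> finprod H_grp s ?I) \<noteq> t"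
      unfolding move_sums_def sumset_def B by auto
    show "\<Phi> (c_class m) \<noteq> t \<or> (\<exists>q\<in>?I. \<exists>(g, d)\<in>moves q. \<Phi> g \<noteq> \<one>\<^bsub>K\<^esub> \<and> d \<le> ?e q)"
    proof (rule ccontr)
      assume neg: "\<not> ?thesis"
      then have "s q \<in> carrier H_grp \<and> \<Phi> (s q) = \<one>\<^bsub>K\<^esub>" if "q \<in> ?I" for q
        using P[OF that s(1)[OF that]] that by blast
      then have "\<Phi> (finprod H_grp s ?I) = \<one>\<^bsub>K\<^esub>" "finprod H_grp s ?I \<in> carrier H_grp"
        by (auto intro!: finprod_kernel comm_group_H H.finprod_closed)
      then show False
        using s(2) neg c by simp
    qed
  next
    assume "\<Phi> (c_class m) \<noteq> t \<or> (\<exists>q\<in>?I. \<exists>(g, d)\<in>moves q. \<Phi> g \<noteq> \<one>\<^bsub>K\<^esub> \<and> d \<le> ?e q)"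
    then consider "\<Phi> (c_class m) \<noteq> t" | "\<Phi> (c_class m) = t" "\<exists>q\<in>?I. \<exists>(g, d)\<in>moves q. \<Phi> g \<noteq> \<one>\<^bsub>K\<^esub> \<and> d \<le> ?e q"
      by blast
    then show "\<exists>y\<in>move_sums m. c_class m \<otimes>\<^bsub>H_grp\<^esub> y \<in> B"
    proof cases
      case 1
      have "\<one>\<^bsub>H_grp\<^esub> \<in> move_sums m"
        unfolding move_sums_def sumset_def
        by (intro CollectI exI[of _ "\<lambda>_. \<one>\<^bsub>H_grp\<^esub>"] conjI) (use one in simp_all)
      then show ?thesis
        using 1 c by (intro bexI[of _ "\<one>\<^bsub>H_grp\<^esub>"]) (simp_all add: B)
    next
      case 2
      then obtain q g d where qg: "q \<in> ?I" "(g, d) \<in> moves q" "\<Phi> g \<noteq> \<one>\<^bsub>K\<^esub>" "d \<le> ?e q"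
        by blast
      have g: "g \<in> carrier H_grp" "d \<le> 2"
        using moves_closed[OF q[OF qg(1)] qg(2)] by blast+
      have "g \<in> ?S q"
        unfolding P_moves_def
        by (intro CollectI exI[of _ "[(g, d)]"]) (use g qg in simp)
      moreover have "finprod H_grp (\<lambda>r. if q = r then g else \<one>\<^bsub>H_grp\<^esub>) ?I = g"
        using H.finprod_singleton[of q ?I "\<lambda>_. g"] qg(1) g by simp
      ultimately have "g \<in> move_sums m"
        unfolding move_sums_def sumset_def
        by (intro CollectI exI[of _ "\<lambda>r. if q = r then g else \<one>\<^bsub>H_grp\<^esub>"] conjI) (use one in simp_all)
      moreover have "\<Phi> (c_class m \<otimes>\<^bsub>H_grp\<^esub> g) \<noteq> t"
        using 2(1) c g qg(3) t by simp
      ultimately show ?thesis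
        using c g by (intro bexI[of _ g]) (simp_all add: B)
    qed
  qed
qed

theorem corollary5p5:
  fixes k :: nat
  assumes "k \<in> {28, 29, 30, 31}"
  shows "(k \<in> {28, 30} \<longrightarrow> quot H_grp (C0 k) \<cong> C2_power 6) \<and>
    (k \<in> {29, 31} \<longrightarrow> quot H_grp (C0 k) \<cong> C2_power 5) \<and>
    (\<exists>t. carrier (quot H_grp (C0 k)) - proj H_grp (C0 k) ` C0 k = {t} \<and>
      (\<forall>m :: int. coprime m 6 \<longrightarrow>
        ((c_class m <#\<^bsub>H_grp\<^esub> move_sums m) \<inter> C0 k \<noteq> {} \<longleftrightarrow>
          proj H_grp (C0 k) (c_class m) \<noteq> t \<or>
          (\<exists>q\<in>prime_factors (nat \<bar>m\<bar>). \<exists>(g, d)\<in>moves q.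
            proj H_grp (C0 k) g \<noteq> \<one>\<^bsub>quot H_grp (C0 k)\<^esub> \<and> d \<le> multiplicity q (nat \<bar>m\<bar>)))))"
proof -
  define n :: nat where "n = (if even k then 6 else 5)"
  \<comment> \<open>The omitted value: all entries 0, except that for even \<open>k\<close> the
    entries of \<open>charA\<close> and \<open>charS\<close> are 1.\<close>
  define t where "t = (\<lambda>i\<in>{..<n}. if even k \<and> i \<ge> 4 then 1 else 0 :: int)"
  have om: "omitting_hom H_grp (C2_power n) (Phi n) t (C0 k)"
    unfolding n_def t_def using assms by (rule omitting_hom_C0)
  interpret omitting_hom H_grp "C2_power n" "Phi n" t "C0 k"
    by (rule om)
  from omits_one_class obtain T where T: "carrier (quot H_grp (C0 k)) - proj H_grp (C0 k) ` C0 k = {T}"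
    and T_iff: "\<forall>x\<in>carrier H_grp. proj H_grp (C0 k) x = T \<longleftrightarrow> Phi n x = t"
    by (elim exE conjE)
  have "\<forall>m :: int. coprime m 6 \<longrightarrow>
      ((c_class m <#\<^bsub>H_grp\<^esub> move_sums m) \<inter> C0 k \<noteq> {} \<longleftrightarrow>
        proj H_grp (C0 k) (c_class m) \<noteq> T \<or>
        (\<exists>q\<in>prime_factors (nat \<bar>m\<bar>). \<exists>(g, d)\<in>moves q.
          proj H_grp (C0 k) g \<noteq> \<one>\<^bsub>quot H_grp (C0 k)\<^esub> \<and> d \<le> multiplicity q (nat \<bar>m\<bar>)))"
  proof (intro allI impI)
    fix m :: int assume m: "coprime m 6"
    have "c_class m \<in> carrier H_grp"
      unfolding c_class_def using m by (rule theta1_closed)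
    then have c: "proj H_grp (C0 k) (c_class m) = T \<longleftrightarrow> Phi n (c_class m) = t"
      using T_iff by (rule bspec[rotated])
    have "(\<exists>(g, d)\<in>moves q. proj H_grp (C0 k) g \<noteq> \<one>\<^bsub>quot H_grp (C0 k)\<^esub> \<and> d \<le> e) \<longleftrightarrow>
        (\<exists>(g, d)\<in>moves q. Phi n g \<noteq> \<one>\<^bsub>C2_power n\<^esub> \<and> d \<le> e)"
      if q: "q \<in> prime_factors (nat \<bar>m\<bar>)" for q e
    proof (rule bex_cong[OF refl])
      fix x assume "x \<in> moves q"
      then have "fst x \<in> carrier H_grp"
        using moves_closed(1)[OF prime_factor_coprime[OF m q], of "fst x" "snd x"] by simp
      then show "(case x of (g, d) \<Rightarrow> proj H_grp (C0 k) g \<noteq> \<one>\<^bsub>quot H_grp (C0 k)\<^esub> \<and> d \<le> e) \<longleftrightarrow>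
          (case x of (g, d) \<Rightarrow> Phi n g \<noteq> \<one>\<^bsub>C2_power n\<^esub> \<and> d \<le> e)"
        unfolding case_prod_beta by (simp only: proj_eq_one_iff)
    qed
    then have "(\<exists>q\<in>prime_factors (nat \<bar>m\<bar>). \<exists>(g, d)\<in>moves q.
          proj H_grp (C0 k) g \<noteq> \<one>\<^bsub>quot H_grp (C0 k)\<^esub> \<and> d \<le> multiplicity q (nat \<bar>m\<bar>)) \<longleftrightarrow>
        (\<exists>q\<in>prime_factors (nat \<bar>m\<bar>). \<exists>(g, d)\<in>moves q.
          Phi n g \<noteq> \<one>\<^bsub>C2_power n\<^esub> \<and> d \<le> multiplicity q (nat \<bar>m\<bar>))"
      by (rule bex_cong[OF refl])
    then show "(c_class m <#\<^bsub>H_grp\<^esub> move_sums m) \<inter> C0 k \<noteq> {} \<longleftrightarrow>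
        proj H_grp (C0 k) (c_class m) \<noteq> T \<or>
        (\<exists>q\<in>prime_factors (nat \<bar>m\<bar>). \<exists>(g, d)\<in>moves q.
          proj H_grp (C0 k) g \<noteq> \<one>\<^bsub>quot H_grp (C0 k)\<^esub> \<and> d \<le> multiplicity q (nat \<bar>m\<bar>))"
      unfolding c by (simp only: move_sums_meet_iff[OF om m])
  qed
  with T have "\<exists>t. carrier (quot H_grp (C0 k)) - proj H_grp (C0 k) ` C0 k = {t} \<and>
      (\<forall>m :: int. coprime m 6 \<longrightarrow>
        ((c_class m <#\<^bsub>H_grp\<^esub> move_sums m) \<inter> C0 k \<noteq> {} \<longleftrightarrow>
          proj H_grp (C0 k) (c_class m) \<noteq> t \<or>
          (\<exists>q\<in>prime_factors (nat \<bar>m\<bar>). \<exists>(g, d)\<in>moves q.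
            proj H_grp (C0 k) g \<noteq> \<one>\<^bsub>quot H_grp (C0 k)\<^esub> \<and> d \<le> multiplicity q (nat \<bar>m\<bar>))))"
    by (intro exI[of _ T] conjI)
  moreover have "n = 6" if "k \<in> {28, 30}"
    using that by (auto simp: n_def)
  moreover have "n = 5" if "k \<in> {29, 31}"
    using that by (auto simp: n_def)
  ultimately show ?thesis
    using quot_iso by (intro conjI impI) simp_all
qed

end
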